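(* Let $\mathcal{N}=(D,s,t,u,\tau)$ be a flow over time network with $D=(V,A)$ a finite directed graph, $s\neq t$ in $V$, $u\in\mathbb{Z}_+^A$, $\tau\in\mathbb{Z}_+^A$, and let $c\in\mathbb{Z}^A$. Put $$T=\sum_{a\in A}\tau(a),\qquad M=\sum_{a\in A}|c(a)|\,u(a),\qquad h=2T(1+M),$$ $$J(x)=T\Big((|V|+1)(2T+3)+1+2h+2x\Big)M+3T\quad(x\in\mathbb{R}),\qquad p=6MT,$$ $$B=2\big(p+J(p)+J(p+J(p))\big).$$ Then for every time horizon $\theta\in\mathbb{Z}_+$ with $\theta>B$, the maximum minimum-cost flow over time problem for $\mathcal{N}$, $c$ and $\theta$ has an optimal solution that is repeated. Explicitly: there is a number $K\ge 0$ with $2K\le B$, depending only on $\mathcal{N}$ and $c$ and not on $\theta$, such that for every integer $\theta\geq 1$ with $\theta>B$ there is an optimal solution $f$ with $$f(a^{\theta'})=f(a^{\theta'+1})\quad\text{for all }a\in A\text{ and all integers }\theta'\ge 1\text{ with }K\le\theta'\text{ and }\theta'+1\le\theta-K .$$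
   Context: Here $\mathbb{Z}_+$ denotes the nonnegative integers. A flow over time network $\mathcal{N}=(D,s,t,u,\tau)$ consists of a directed graph $D=(V,A)$, arc capacities $u\in\mathbb{Z}_+^A$, arc transit times $\tau\in\mathbb{Z}_+^A$, a source $s$ and a sink $t$. Time-expanded network. For an integer $\theta\ge1$, the time-expanded network $\mathcal{N}^{[1,\theta]}$ has nodes $v^{\theta'}$ for $v\in V$, $\theta'\in\{1,\dots,\theta\}$, plus a super-source $\hat s$ and a super-sink $\hat t$. Its arcs are the copies $a^{\theta'}=(v^{\theta'},w^{\theta'+\tau(a)})$ of each $a=(v,w)\in A$, for all $\theta'\ge 1$ with $\theta'+\tau(a)\le\theta$, with capacity $u(a)$ and cost $c(a)$; and the arcs $(\hat s,s^{\theta'})$ and $(t^{\theta'},\hat t)$ for $\theta'\in\{1,\dots,\theta\}$, with infinite capacity and zero cost. Flows over time. A flow over time $f$ with time horizon $\theta$ (discrete time, no waiting at intermediate nodes) is identified with a static integral flow from $\hat s$ to $\hat t$ in $\mathcal{N}^{[1,\theta]}$: nonnegative integer values on arcs, respecting the capacities, with flow conservation at every node other than $\hat s,\hat t$. Its value is the net flow out of $\hat s$, and its cost is $\sum c(a)f(a^{\theta'})$ over all arc copies $a^{\theta'}$. We set $f(a^{\theta'})=0$ if the copy $a^{\theta'}$ does not exist. Maximum minimum-cost flow over time problem. Among all flows over time with time horizon $\theta$ of maximum possible value, find one of minimum cost. An optimal solution is a flow attaining this minimum. Repeated. Informally, a flow over time is repeated if the flow value on each arc is constant almost always, provided that the time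 horizon is large enough; i.e. constant in time except during an initial and a final period whose lengths do not depend on $\theta$. *)

theory Defs
  imports Complex_Main "HOL-Library.Extended_Nat" "Graph_Theory.Digraph"
begin

section \<open>Static integral flows\<close>

definition net_outflow :: "('v, 'e) pre_digraph \<Rightarrow> ('e \<Rightarrow> nat) \<Rightarrow> 'v \<Rightarrow> int" where
  "net_outflow G f v =
     (\<Sum>e\<in>out_arcs G v. int (f e)) - (\<Sum>e\<in>in_arcs G v. int (f e))"

text \<open>
  Flows are total functions on the arc type; requiring the value 0 outside of
  \<open>arcs G\<close> implements the convention that a nonexistent arc carries no flow.
\<close>

definition integral_flow ::
  "('v, 'e) pre_digraph \<Rightarrow> ('e \<Rightarrow> enat) \<Rightarrow> 'v \<Rightarrow> 'v \<Rightarrow> ('e \<Rightarrow> nat) \<Rightarrow> bool" where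
  "integral_flow G cap x y f \<longleftrightarrow>
     (\<forall>e\<in>arcs G. enat (f e) \<le> cap e) \<and>
     (\<forall>e. e \<notin> arcs G \<longrightarrow> f e = 0) \<and>
     (\<forall>v\<in>verts G - {x, y}. net_outflow G f v = 0)"

definition flow_cost :: "('v, 'e) pre_digraph \<Rightarrow> ('e \<Rightarrow> int) \<Rightarrow> ('e \<Rightarrow> nat) \<Rightarrow> int" where
  "flow_cost G c f = (\<Sum>e\<in>arcs G. c e * int (f e))"


section \<open>Flow over time networks\<close>

text \<open>Finite digraphs in the sense of \<open>fin_digraph\<close> may have loops and parallel arcs.\<close>

locale flow_over_time_network = fin_digraph D
  for D :: "('v, 'a) pre_digraph" +
  fixes s t :: 'v
    and u \<tau> :: "'a \<Rightarrow> nat"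
  assumes source_in_verts: "s \<in> verts D"
    and sink_in_verts: "t \<in> verts D"
    and source_neq_sink: "s \<noteq> t"

datatype 'v time_node = Super_Source | Super_Sink | Node_Copy 'v nat

datatype 'a time_arc = Arc_Copy 'a nat | Source_Arc nat | Sink_Arc nat

definition time_expanded ::
  "('v, 'a) pre_digraph \<Rightarrow> 'v \<Rightarrow> 'v \<Rightarrow> ('a \<Rightarrow> nat) \<Rightarrow> nat \<Rightarrow> ('v time_node, 'a time_arc) pre_digraph"
where
  "time_expanded D s t \<tau> \<theta> = \<lparr>
     verts = {Super_Source, Super_Sink} \<union> {Node_Copy v i | v i. v \<in> verts D \<and> i \<in> {1..\<theta>}},
     arcs = {Arc_Copy a i | a i. a \<in> arcs D \<and> 1 \<le> i \<and> i + \<tau> a \<le> \<theta>}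
       \<union> Source_Arc ` {1..\<theta>} \<union> Sink_Arc ` {1..\<theta>},
     tail = (\<lambda>e. case e of
         Arc_Copy a i \<Rightarrow> Node_Copy (tail D a) i
       | Source_Arc i \<Rightarrow> Super_Source
       | Sink_Arc i \<Rightarrow> Node_Copy t i),
     head = (\<lambda>e. case e of
         Arc_Copy a i \<Rightarrow> Node_Copy (head D a) (i + \<tau> a)
       | Source_Arc i \<Rightarrow> Node_Copy s i
       | Sink_Arc i \<Rightarrow> Super_Sink) \<rparr>"

primrec time_capacity :: "('a \<Rightarrow> nat) \<Rightarrow> 'a time_arc \<Rightarrow> enat" where
  "time_capacity u (Arc_Copy a i) = enat (u a)"
| "time_capacity u (Source_Arc i) = \<infinity>"
| "time_capacity u (Sink_Arc i) = \<infinity>"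

primrec time_cost :: "('a \<Rightarrow> int) \<Rightarrow> 'a time_arc \<Rightarrow> int" where
  "time_cost c (Arc_Copy a i) = c a"
| "time_cost c (Source_Arc i) = 0"
| "time_cost c (Sink_Arc i) = 0"

context flow_over_time_network
begin

definition flow_over_time :: "nat \<Rightarrow> ('a time_arc \<Rightarrow> nat) \<Rightarrow> bool" where
  "flow_over_time \<theta> f \<longleftrightarrow>
     integral_flow (time_expanded D s t \<tau> \<theta>) (time_capacity u) Super_Source Super_Sink f"

definition fot_value :: "nat \<Rightarrow> ('a time_arc \<Rightarrow> nat) \<Rightarrow> int" where
  "fot_value \<theta> f = net_outflow (time_expanded D s t \<tau> \<theta>) f Super_Source"

definition fot_cost :: "('a \<Rightarrow> int) \<Rightarrow> nat \<Rightarrow> ('a time_arc \<Rightarrow> nat) \<Rightarrow> int" where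
  "fot_cost c \<theta> f = flow_cost (time_expanded D s t \<tau> \<theta>) (time_cost c) f"

definition maximum_fot :: "nat \<Rightarrow> ('a time_arc \<Rightarrow> nat) \<Rightarrow> bool" where
  "maximum_fot \<theta> f \<longleftrightarrow>
     flow_over_time \<theta> f \<and> (\<forall>g. flow_over_time \<theta> g \<longrightarrow> fot_value \<theta> g \<le> fot_value \<theta> f)"

definition max_min_cost_fot :: "('a \<Rightarrow> int) \<Rightarrow> nat \<Rightarrow> ('a time_arc \<Rightarrow> nat) \<Rightarrow> bool" where
  "max_min_cost_fot c \<theta> f \<longleftrightarrow>
     maximum_fot \<theta> f \<and> (\<forall>g. maximum_fot \<theta> g \<longrightarrow> fot_cost c \<theta> f \<le> fot_cost c \<theta> g)"

definition T_const :: real where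
  "T_const = (\<Sum>a\<in>arcs D. real (\<tau> a))"

definition M_const :: "('a \<Rightarrow> int) \<Rightarrow> real" where
  "M_const c = (\<Sum>a\<in>arcs D. \<bar>real_of_int (c a)\<bar> * real (u a))"

definition h_const :: "('a \<Rightarrow> int) \<Rightarrow> real" where
  "h_const c = 2 * T_const * (1 + M_const c)"

definition J_const :: "('a \<Rightarrow> int) \<Rightarrow> real \<Rightarrow> real" where
  "J_const c x =
     T_const * ((real (card (verts D)) + 1) * (2 * T_const + 3) + 1 + 2 * h_const c + 2 * x)
       * M_const c + 3 * T_const"

definition p_const :: "('a \<Rightarrow> int) \<Rightarrow> real" where
  "p_const c = 6 * M_const c * T_const"

definition B_const :: "('a \<Rightarrow> int) \<Rightarrow> real" where
  "B_const c = 2 * (p_const c + J_const c (p_const c) + J_const c (p_const c + J_const c (p_const c)))"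

end

end

theory Submission
  imports Defs
begin

text \<open>
Extend the network by terminals \<open>s0\<close> and \<open>t0\<close> with arcs \<open>s0 \<rightarrow> s\<close> and \<open>t \<rightarrow> t0\<close>, and fix a maximum
static flow \<open>x\<close> in it. Sending \<open>x\<close> at every time, also before and after the horizon, is the steady
state. An optimal flow over time \<open>\<phi>\<close> is shown to agree with it at all times that are far from both
ends of the horizon. Let \<open>H\<close> be the set of arc copies on which \<open>\<phi>\<close> deviates from \<open>x\<close>, oriented by the
sign of the deviation. Forgetting the time, \<open>H\<close> is residual for \<open>x\<close>; within the horizon, its reverse
is residual for \<open>\<phi>\<close>. Nonterminal nodes are balanced within the horizon, and \<open>H\<close> has no closed
walk, so every arc of \<open>H\<close> lies on a walk of \<open>H\<close> that starts at a terminal or in the future (beyond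
the horizon) and ends at a terminal or in the past (before time 1): outside the horizon it is the
steady flow that \<open>\<phi>\<close> lacks, hence \<open>H\<close> runs there against the direction of time.

Both flows are chosen with care. The flow \<open>x\<close> minimises lexicographically the transit time outside
the strong components \<open>S\<close> of \<open>s0\<close> and \<open>Q\<close> of \<open>t0\<close> in the residual graph, then the cost, then the
whole transit time (\<open>steady_flow_exists\<close>). So outside \<open>S\<close> and \<open>Q\<close> no closed residual walk runs back
in time, and inside them running back in time costs at least 1 per round. Among the optimal flows
over time, \<open>\<phi>\<close> is nearest to \<open>x\<close> in the interior of the horizon, and then nearest overall
(\<open>optimal_flow_near_steady\<close>); the locale \<open>turnpike\<close> collects what this means for residual walks.

Suppose that \<open>H\<close> has an arc in the interior (\<open>deep_interior\<close>). A walk of \<open>H\<close> through it that joins two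
terminals is closed, or contradicts the maximality of \<open>x\<close> or of \<open>\<phi>\<close> (\<open>ground_to_ground\<close>). If it
comes from a terminal and runs into the past, then that terminal can also supply the target of the
arc by a residual walk of \<open>\<phi>\<close> of least possible cost (\<open>descent\<close>); together with the reversed walk of
\<open>H\<close> this gives an exchange that brings \<open>\<phi>\<close> closer to \<open>x\<close> (\<open>interior_not_supplied\<close>). A walk from the
future to a terminal is the mirror image under time reversal (\<open>mirror\<close>). A walk from the future into
the past visits \<open>S\<close> or \<open>Q\<close> both late and early; going back that far in time costs more than the
detour through the terminal, which contradicts the minimality of the cost (\<open>no_crossing\<close>).

The heart is \<open>descent\<close>. A walk of \<open>H\<close> from a node \<open>b\<close> of a component into the past passes through
\<open>2 T M + 1\<close> disjoint time windows. In each of them a cheapest walk leads from the terminal to a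
node from which \<open>b\<close> can be reached. If one of these walks is residual for \<open>\<phi>\<close>, then \<open>b\<close> is supplied. Otherwise
each is blocked by a copy in \<open>H\<close>, so that \<open>2 T M + 1\<close> units of deviation enter the set of nodes
reachable from these copies. They can only leave it through arcs of nonzero cost within a time
window of length \<open>2 T\<close>, and the capacity of these arcs is at most \<open>2 T M\<close>.

If \<open>T = 0\<close> or \<open>M = 0\<close>, then no closed residual walk of \<open>x\<close> runs back in time, and a margin of \<open>T + 1\<close>
suffices (\<open>shallow_interior\<close>); otherwise the margin is \<open>12 T\<^sup>2 M + 13 T + 2\<close>. Half of the bound \<open>B\<close>
is at least \<open>d + T - 1\<close> for either margin \<open>d\<close>, where \<open>T\<close> accounts for the transit time of the copy.
\<close>

section \<open>Walks in multigraphs given by their oriented arcs\<close>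

fun owalk :: "('o \<Rightarrow> 'n) \<Rightarrow> ('o \<Rightarrow> 'n) \<Rightarrow> 'o set \<Rightarrow> 'n \<Rightarrow> 'o list \<Rightarrow> 'n \<Rightarrow> bool" where
  "owalk sr ds B p [] q \<longleftrightarrow> p = q"
| "owalk sr ds B p (a # w) q \<longleftrightarrow> a \<in> B \<and> sr a = p \<and> owalk sr ds B (ds a) w q"

definition wt :: "('o \<Rightarrow> int) \<Rightarrow> 'o list \<Rightarrow> int" where
  "wt f w = sum_list (map f w)"

lemma wt_simps [simp]:
  "wt f [] = 0" "wt f (a # w) = f a + wt f w" "wt f (v @ w) = wt f v + wt f w"
  by (simp_all add: wt_def)

lemma wt_rev [simp]: "wt f (rev w) = wt f w"
  by (induction w) auto

lemma wt_map: "wt f (map h w) = wt (f \<circ> h) w"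
  by (simp add: wt_def)

lemma wt_uminus: "wt (\<lambda>a. - f a) w = - wt f w"
  by (induction w) simp_all

lemma wt_cong: "(\<And>a. a \<in> set w \<Longrightarrow> f a = g a) \<Longrightarrow> wt f w = wt g w"
  by (induction w) auto

lemma wt_add: "wt (\<lambda>a. f a + g a) w = wt f w + wt g w"
  by (induction w) auto

lemma wt_cmult: "wt (\<lambda>a. k * f a) w = k * wt f w"
  by (induction w) (auto simp: algebra_simps)

lemma owalk_append [simp]:
  "owalk sr ds B p (v @ w) q \<longleftrightarrow> (\<exists>m. owalk sr ds B p v m \<and> owalk sr ds B m w q)"
  by (induction v arbitrary: p) auto

lemma owalk_snoc: "owalk sr ds B p w (sr a) \<Longrightarrow> a \<in> B \<Longrightarrow> owalk sr ds B p (w @ [a]) (ds a)"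
  by (induction w arbitrary: p) simp_all

lemma owalk_set: "owalk sr ds B p w q \<Longrightarrow> set w \<subseteq> B"
  by (induction w arbitrary: p) auto

lemma owalk_mono: "owalk sr ds B p w q \<Longrightarrow> set w \<subseteq> B' \<Longrightarrow> owalk sr ds B' p w q"
  by (induction w arbitrary: p) auto

lemma owalk_start: "owalk sr ds B p w q \<Longrightarrow> p = (if w = [] then q else sr (hd w))"
  by (cases w) auto

lemma owalk_end: "owalk sr ds B p w q \<Longrightarrow> q = (if w = [] then p else ds (last w))"
  by (induction w arbitrary: p) auto

lemma owalk_map:
  assumes "owalk sr ds B p w q"
    and "\<And>a. a \<in> set w \<Longrightarrow> h a \<in> B' \<and> sr' (h a) = f (sr a) \<and> ds' (h a) = f (ds a)"
  shows "owalk sr' ds' B' (f p) (map h w) (f q)"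
  using assms by (induction w arbitrary: p) auto

lemma owalk_rev: "owalk sr ds B p w q \<Longrightarrow> owalk ds sr B q (rev w) p"
  by (induction w arbitrary: p) auto

lemma owalk_arc:
  assumes "owalk sr ds B p w q" "a \<in> set w"
  obtains v v' where "w = v @ a # v'" "owalk sr ds B p v (sr a)" "owalk sr ds B (ds a) v' q"
proof -
  obtain v v' where w: "w = v @ a # v'" using assms(2) by (auto dest: split_list)
  then show ?thesis using assms(1) by (intro that[of v v']) auto
qed

lemma owalk_potential:
  assumes "owalk sr ds B p w q" "\<And>a. a \<in> B \<Longrightarrow> \<pi> (ds a) \<le> \<pi> (sr a) + (f a :: int)"
  shows "\<pi> q \<le> \<pi> p + wt f w"
  using assms(1)
proof (induction w arbitrary: p)
  case (Cons a w)
  then have "\<pi> q \<le> \<pi> (ds a) + wt f w" "\<pi> (ds a) \<le> \<pi> (sr a) + f a" "sr a = p"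
    using assms(2) by auto
  then show ?case by simp
qed simp

lemma owalk_invariant:
  assumes "owalk sr ds B p w q" "P p" "\<And>a. a \<in> set w \<Longrightarrow> P (sr a) \<Longrightarrow> P (ds a)"
  shows "P q"
  using assms
proof (induction w arbitrary: p)
  case (Cons a w)
  then show ?case by (intro Cons.IH[of "ds a"]) auto
qed simp

lemma owalk_enter:
  assumes "owalk sr ds B p w q" "p \<notin> U" "q \<in> U"
  obtains v a v' where "w = v @ a # v'" "sr a \<notin> U" "ds a \<in> U"
    "owalk sr ds B p v (sr a)" "owalk sr ds B (ds a) v' q" "a \<in> B"
  using assms
proof (induction w arbitrary: p thesis)
  case (Cons a w)
  show ?case
  proof (cases "ds a \<in> U")
    case True
    then show ?thesis using Cons.prems by (intro Cons.prems(1)[of "[]" a w]) auto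
  next
    case False
    obtain v b v' where "w = v @ b # v'" "sr b \<notin> U" "ds b \<in> U"
      "owalk sr ds B (ds a) v (sr b)" "owalk sr ds B (ds b) v' q" "b \<in> B"
      using Cons.IH[OF _ _ False] Cons.prems by auto
    then show ?thesis using Cons.prems by (intro Cons.prems(1)[of "a # v" b v']) auto
  qed
qed simp

lemma owalk_repeat:
  assumes "owalk sr ds B p w q" "\<not> distinct (map sr w)"
  obtains a b c m where "w = a @ b @ c" "b \<noteq> []" "c \<noteq> []"
    "owalk sr ds B p a m" "owalk sr ds B m b m" "owalk sr ds B m c q"
proof -
  obtain i j where ij: "i < j" "j < length w" "sr (w ! i) = sr (w ! j)"
    using assms(2) by (auto simp: distinct_conv_nth) (metis linorder_neqE_nat)
  define a where "a = take i w"
  define b where "b = drop i (take j w)"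
  define c where "c = drop j w"
  have w: "w = a @ b @ c"
    using ij by (simp add: a_def b_def c_def) (metis append_assoc append_take_drop_id less_or_eq_imp_le min.absorb1 take_take)
  have bc: "b = w ! i # tl b" "c = w ! j # tl c"
    using ij by (auto simp: b_def c_def Cons_nth_drop_Suc[symmetric] drop_take take_Cons')
  show ?thesis
  proof (rule that[of a b c "sr (w ! i)"])
    show "w = a @ b @ c" by (fact w)
    show "b \<noteq> []" "c \<noteq> []" using bc by auto
    obtain m m' where m: "owalk sr ds B p a m" "owalk sr ds B m b m'" "owalk sr ds B m' c q"
      using assms(1) w by auto
    moreover have "m = sr (w ! i)" using m(2) bc(1) by (metis owalk.simps(2))
    moreover have "m' = sr (w ! j)" using m(3) bc(2) by (metis owalk.simps(2))
    ultimately show "owalk sr ds B p a (sr (w ! i))" "owalk sr ds B (sr (w ! i)) b (sr (w ! i))"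
      "owalk sr ds B (sr (w ! i)) c q" using ij by auto
  qed
qed

subsection \<open>Splitting closed walks into simple ones\<close>

text \<open>
  A closed walk that repeats a vertex splits there into two shorter closed walks.
\<close>

lemma closed_walks_nonneg:
  assumes simple: "\<And>p w. owalk sr ds B p w p \<Longrightarrow> distinct (map sr w) \<Longrightarrow> 0 \<le> wt f w"
  shows "owalk sr ds B p w p \<Longrightarrow> 0 \<le> wt f w"
proof (induction "length w" arbitrary: p w rule: less_induct)
  case less
  show ?case
  proof (cases "distinct (map sr w)")
    case False
    then obtain a b c m where *: "w = a @ b @ c" "b \<noteq> []" "c \<noteq> []"
      "owalk sr ds B p a m" "owalk sr ds B m b m" "owalk sr ds B m c p"
      using owalk_repeat[OF less.prems] by metis
    have "0 \<le> wt f b" by (rule less.hyps[OF _ *(5)]) (use * in auto)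
    moreover have "0 \<le> wt f (a @ c)" by (rule less.hyps[of _ p]) (use * in auto)
    ultimately show ?thesis using * by simp
  qed (use less simple in auto)
qed

text \<open>
  When a closed walk splits, both parts are nonnegative, so both inherit the bound \<open>0\<close> from above,
  and the part that contains \<open>a\<close> can be split further.
\<close>

lemma simple_closed_walk_through:
  assumes nonneg: "\<And>p w. owalk sr ds B p w p \<Longrightarrow> 0 \<le> wt f w"
  shows "owalk sr ds B p w p \<Longrightarrow> a \<in> set w \<Longrightarrow> wt f w \<le> 0 \<Longrightarrow>
    \<exists>q v. owalk sr ds B q v q \<and> distinct (map sr v) \<and> a \<in> set v \<and> set v \<subseteq> set w \<and> wt f v \<le> 0"
proof (induction "length w" arbitrary: p w rule: less_induct)
  case less
  show ?case
  proof (cases "distinct (map sr w)")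
    case False
    then obtain v b c m where *: "w = v @ b @ c" "b \<noteq> []" "c \<noteq> []"
      "owalk sr ds B p v m" "owalk sr ds B m b m" "owalk sr ds B m c p"
      using owalk_repeat[OF less.prems(1)] by metis
    have vc: "owalk sr ds B p (v @ c) p" using * by auto
    have b: "0 \<le> wt f b" and vc0: "0 \<le> wt f (v @ c)" using nonneg *(5) vc by blast+
    show ?thesis
    proof (cases "a \<in> set b")
      case True
      have "wt f b \<le> 0" using vc0 less.prems(3) * by simp
      then show ?thesis using less.hyps[OF _ *(5) True] * by auto
    next
      case False
      then have "a \<in> set (v @ c)" using less.prems * by auto
      moreover have "wt f (v @ c) \<le> 0" using b less.prems(3) * by simp
      ultimately show ?thesis using less.hyps[OF _ vc] * by auto
    qed
  qed (use less.prems in blast)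
qed

lemma loop_erasure:
  assumes nonneg: "\<And>p w. owalk sr ds B p w p \<Longrightarrow> 0 \<le> wt f w"
  shows "owalk sr ds B p w q \<Longrightarrow>
    \<exists>v. owalk sr ds B p v q \<and> distinct (map sr v) \<and> q \<notin> sr ` set v \<and> set v \<subseteq> set w \<and> wt f v \<le> wt f w"
proof (induction "length w" arbitrary: w rule: less_induct)
  case less
  consider "\<not> distinct (map sr w)" | "q \<in> sr ` set w" | "distinct (map sr w)" "q \<notin> sr ` set w"
    by blast
  then show ?case
  proof cases
    case 1
    then obtain v b c m where *: "w = v @ b @ c" "b \<noteq> []" "c \<noteq> []"
      "owalk sr ds B p v m" "owalk sr ds B m b m" "owalk sr ds B m c q"
      using owalk_repeat[OF less.prems(1)] by metis
    have vc: "owalk sr ds B p (v @ c) q" using * by auto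
    obtain x where "owalk sr ds B p x q" "distinct (map sr x)" "q \<notin> sr ` set x"
      "set x \<subseteq> set (v @ c)" "wt f x \<le> wt f (v @ c)"
      using less.hyps[OF _ vc] * by auto
    then show ?thesis using nonneg[OF *(5)] * by (intro exI[of _ x]) auto
  next
    case 2
    then obtain a where a: "a \<in> set w" "sr a = q" by auto
    obtain v v' where *: "w = v @ a # v'" "owalk sr ds B p v q" "owalk sr ds B (ds a) v' q"
      using owalk_arc[OF less.prems a(1)] a(2) by metis
    have "owalk sr ds B q (a # v') q" using less.prems * a by (auto dest: owalk_set)
    then have "0 \<le> wt f (a # v')" by (rule nonneg)
    moreover obtain x where "owalk sr ds B p x q" "distinct (map sr x)" "q \<notin> sr ` set x"
      "set x \<subseteq> set v" "wt f x \<le> wt f v"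
      using less.hyps[OF _ *(2)] * by auto
    ultimately show ?thesis using * by (intro exI[of _ x]) auto
  qed (use less.prems in auto)
qed

lemma simple_walk_exists:
  assumes "owalk sr ds B p w q"
  shows "\<exists>v. owalk sr ds B p v q \<and> distinct (map sr v) \<and> q \<notin> sr ` set v \<and> set v \<subseteq> set w"
  using loop_erasure[where f = "\<lambda>_. 0", of sr ds B p w q] assms
  by (auto simp: wt_def map_replicate_const sum_list_replicate)

subsection \<open>Oriented arcs of a digraph\<close>

definition osrc :: "('e \<Rightarrow> 'n) \<Rightarrow> ('e \<Rightarrow> 'n) \<Rightarrow> 'e \<times> bool \<Rightarrow> 'n" where
  "osrc ta he o' = (if snd o' then ta (fst o') else he (fst o'))"

definition owt :: "('e \<Rightarrow> int) \<Rightarrow> 'e \<times> bool \<Rightarrow> int" where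
  "owt c o' = (if snd o' then c (fst o') else - c (fst o'))"

definition orev :: "'e \<times> bool \<Rightarrow> 'e \<times> bool" where
  "orev o' = (fst o', \<not> snd o')"

text \<open>The target of an oriented arc is its source in the digraph with swapped ends.\<close>

abbreviation odst :: "('e \<Rightarrow> 'n) \<Rightarrow> ('e \<Rightarrow> 'n) \<Rightarrow> 'e \<times> bool \<Rightarrow> 'n" where
  "odst ta he \<equiv> osrc he ta"

abbreviation "dwalk ta he \<equiv> owalk (osrc ta he) (odst ta he)"

lemma orev_simps [simp]:
  "orev (orev a) = a" "fst (orev a) = fst a" "snd (orev a) \<longleftrightarrow> \<not> snd a"
  "owt c (orev a) = - owt c a" "osrc ta he (orev a) = odst ta he a"
  by (auto simp: orev_def owt_def osrc_def)

lemma wt_orev [simp]: "wt (owt c) (map orev w) = - wt (owt c) w"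
  by (induction w) auto

lemma dwalk_orev:
  assumes "dwalk ta he B p w q" "\<And>a. a \<in> set w \<Longrightarrow> orev a \<in> B'"
  shows "dwalk ta he B' q (rev (map orev w)) p"
  using assms
  by (induction w arbitrary: p) auto

lemma distinct_wt_bound:
  assumes "distinct w" "fst ` set w \<subseteq> E" "finite E"
  shows "\<bar>wt (owt c) w\<bar> \<le> (\<Sum>e\<in>E. \<bar>c e\<bar>)"
proof -
  have fin: "finite (E \<times> (UNIV :: bool set))" using assms by simp
  have sub: "set w \<subseteq> E \<times> UNIV" using assms by force
  have upper: "wt (owt c) w \<le> (\<Sum>e\<in>E. \<bar>c e\<bar>)" for c
  proof -
    have "wt (owt c) w = (\<Sum>a\<in>set w. owt c a)"
      unfolding wt_def using assms(1) by (rule sum_list_distinct_conv_sum_set)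
    also have "\<dots> \<le> (\<Sum>a\<in>set w. max 0 (owt c a))" by (rule sum_mono) auto
    also have "\<dots> \<le> (\<Sum>a\<in>E \<times> UNIV. max 0 (owt c a))"
      by (rule sum_mono2[OF fin sub]) auto
    also have "\<dots> = (\<Sum>e\<in>E. \<Sum>b\<in>UNIV. max 0 (owt c (e, b)))"
      by (simp add: sum.cartesian_product)
    also have "\<dots> = (\<Sum>e\<in>E. \<bar>c e\<bar>)"
      by (rule sum.cong) (auto simp: UNIV_bool owt_def)
    finally show ?thesis .
  qed
  have "wt (owt (\<lambda>e. - c e)) w = - wt (owt c) w"
    by (simp flip: wt_uminus) (auto intro!: wt_cong simp: owt_def)
  then show ?thesis using upper[of c] upper[of "\<lambda>e. - c e"] by simp
qed

text \<open>
  After the second traversal a vertex-simple walk is back at a vertex that it has already left, so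
  nothing else can be part of it. A walk \<open>[a, orev a]\<close> has weight 0; all other simple closed walks
  can carry a unit of flow.
\<close>

lemma simple_closed_walk_arcs:
  assumes w: "dwalk ta he B p w p" and dist: "distinct (map (osrc ta he) w)"
  shows "distinct (map fst w) \<or> (\<exists>a. w = [a, orev a])"
proof (cases "distinct (map fst w)")
  case False
  let ?s = "osrc ta he" and ?d = "odst ta he"
  obtain xs ys zs e where "map fst w = xs @ [e] @ ys @ [e] @ zs"
    using not_distinct_decomp[OF False] by blast
  then obtain v1 a v2 b v3 where w': "w = v1 @ a # v2 @ b # v3" "fst a = e" "fst b = e"
    by (auto simp: map_eq_append_conv Cons_eq_map_conv map_eq_Cons_conv append_eq_map_conv)
  have "a \<noteq> b" using dist w' by auto
  then have b: "b = orev a" using w' by (cases a; cases b) (auto simp: orev_def)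
  have "owalk ?s ?d B (?d a) v2 (?d a)" "owalk ?s ?d B (?s a) v3 p" "owalk ?s ?d B p v1 (?s a)"
    using w w' b by auto
  then have ends: "v2 \<noteq> [] \<Longrightarrow> ?s (hd v2) = ?s b" "v3 \<noteq> [] \<Longrightarrow> ?s (hd v3) = ?s a" "v1 \<noteq> [] \<Longrightarrow> ?s (hd v1) = p"
    using b by (auto dest: owalk_start)
  have notin: "?s b \<notin> ?s ` set v2" "?s a \<notin> ?s ` set v3" "?s a \<notin> ?s ` set v1"
    using dist w' by auto
  have v2: "v2 = []" using ends(1) notin(1) hd_in_set imageI[of _ "set v2" ?s] by metis
  have v3: "v3 = []" using ends(2) notin(2) hd_in_set imageI[of _ "set v3" ?s] by metis
  have "p = ?s a" using w w' b v3 by simp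
  then have "v1 = []" using ends(3) notin(3) hd_in_set imageI[of _ "set v1" ?s] by metis
  then show ?thesis using v2 v3 w' b by simp
qed simp

lemma simple_open_walk_arcs:
  assumes w: "dwalk ta he B p w q" and dist: "distinct (map (osrc ta he) w)" "q \<notin> osrc ta he ` set w"
  shows "distinct (map fst w)"
proof (rule ccontr)
  assume False: "\<not> distinct (map fst w)"
  let ?s = "osrc ta he" and ?d = "odst ta he"
  obtain xs ys zs e where "map fst w = xs @ [e] @ ys @ [e] @ zs"
    using not_distinct_decomp[OF False] by blast
  then obtain v1 a v2 b v3 where w': "w = v1 @ a # v2 @ b # v3" "fst a = e" "fst b = e"
    by (auto simp: map_eq_append_conv Cons_eq_map_conv map_eq_Cons_conv append_eq_map_conv)
  have "a \<noteq> b" using dist w' by auto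
  then have b: "b = orev a" using w' by (cases a; cases b) (auto simp: orev_def)
  have "owalk ?s ?d B (?s a) v3 q" using w w' b by auto
  then have v3: "?s a = (if v3 = [] then q else ?s (hd v3))" by (rule owalk_start)
  show False
  proof (cases "v3 = []")
    case True
    then show False using v3 dist(2) w' by auto
  next
    case False
    then have "?s a \<in> ?s ` set v3" using v3 hd_in_set[OF False] by simp
    then show False using dist(1) w' by auto
  qed
qed

subsection \<open>Potentials and shortest walks\<close>

lemma int_attains_min:
  assumes "\<And>a. P a \<Longrightarrow> (b :: int) \<le> f a" "\<exists>a. P a"
  shows "\<exists>a. P a \<and> (\<forall>a'. P a' \<longrightarrow> f a \<le> f a')"
proof -
  obtain a where "P a" and a: "\<And>a'. P a' \<Longrightarrow> nat (f a - b) \<le> nat (f a' - b)"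
    using assms(2) ex_has_least_nat[of P _ "\<lambda>a. nat (f a - b)"] by blast
  have "f a \<le> f a'" if "P a'" for a'
    using assms(1)[OF that] assms(1)[OF \<open>P a\<close>] a[OF that] by linarith
  then show ?thesis using \<open>P a\<close> by blast
qed

context
  fixes ta he :: "'e \<Rightarrow> 'n" and B :: "('e \<times> bool) set" and c :: "'e \<Rightarrow> int" and E :: "'e set"
  assumes fin: "finite E" and sub: "fst ` B \<subseteq> E"
    and nonneg: "\<And>p w. dwalk ta he B p w p \<Longrightarrow> 0 \<le> wt (owt c) w"
begin

lemma simple_walk_bound:
  assumes "dwalk ta he B p w q"
  shows "\<exists>v. dwalk ta he B p v q \<and> distinct v \<and> set v \<subseteq> set w \<and>
    wt (owt c) v \<le> wt (owt c) w \<and> \<bar>wt (owt c) v\<bar> \<le> (\<Sum>e\<in>E. \<bar>c e\<bar>)"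
proof -
  obtain v where v: "dwalk ta he B p v q" "distinct (map (osrc ta he) v)" "set v \<subseteq> set w"
    "wt (owt c) v \<le> wt (owt c) w"
    using loop_erasure[where f = "owt c" and B = B, OF _ assms] nonneg by blast
  have "fst ` set v \<subseteq> E" using owalk_set[OF v(1)] sub by blast
  then show ?thesis using v distinct_wt_bound[OF _ _ fin, of v c] distinct_map by blast
qed

lemma walk_weight_lower_bound:
  assumes "dwalk ta he B p w q"
  shows "- (\<Sum>e\<in>E. \<bar>c e\<bar>) \<le> wt (owt c) w"
  using simple_walk_bound[OF assms] by force

text \<open>Each vertex gets the least weight of a walk that ends there.\<close>

lemma potential_exists:
  "\<exists>\<pi>. (\<forall>v. - (\<Sum>e\<in>E. \<bar>c e\<bar>) \<le> \<pi> v \<and> \<pi> v \<le> 0) \<and>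
    (\<forall>a\<in>B. \<pi> (odst ta he a) \<le> \<pi> (osrc ta he a) + owt c a)"
proof -
  let ?P = "\<lambda>v w. \<exists>p. dwalk ta he B p w v"
  have "\<exists>w. ?P v w \<and> (\<forall>w'. ?P v w' \<longrightarrow> wt (owt c) w \<le> wt (owt c) w')" for v
    by (rule int_attains_min[where b = "- (\<Sum>e\<in>E. \<bar>c e\<bar>)"])
      (use walk_weight_lower_bound in \<open>auto intro!: exI[of _ "[]"]\<close>)
  then obtain W where W: "\<And>v. ?P v (W v)" "\<And>v w'. ?P v w' \<Longrightarrow> wt (owt c) (W v) \<le> wt (owt c) w'"
    by metis
  show ?thesis
  proof (intro exI[of _ "\<lambda>v. wt (owt c) (W v)"] conjI allI ballI)
    fix v
    show "- (\<Sum>e\<in>E. \<bar>c e\<bar>) \<le> wt (owt c) (W v)" using W(1) walk_weight_lower_bound by blast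
    show "wt (owt c) (W v) \<le> 0" using W(2)[of "[]" v] by simp
  next
    fix a assume "a \<in> B"
    then have "?P (odst ta he a) (W (osrc ta he a) @ [a])" using W(1) by auto
    then show "wt (owt c) (W (odst ta he a)) \<le> wt (owt c) (W (osrc ta he a)) + owt c a"
      using W(2)[of "W (osrc ta he a) @ [a]" "odst ta he a"] by simp
  qed
qed

text \<open>
  The values of \<open>y\<close> at vertices that cannot be reached from \<open>r\<close> are arbitrary.
\<close>

lemma distance_exists:
  "\<exists>y. (\<forall>v. (\<exists>w. dwalk ta he B r w v) \<longrightarrow>
      (\<exists>w. dwalk ta he B r w v \<and> distinct w \<and> wt (owt c) w = y v)) \<and>
    (\<forall>v w. dwalk ta he B r w v \<longrightarrow> y v \<le> wt (owt c) w)"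
proof -
  have "\<exists>k. ((\<exists>w. dwalk ta he B r w v) \<longrightarrow> (\<exists>w. dwalk ta he B r w v \<and> distinct w \<and> wt (owt c) w = k)) \<and>
      (\<forall>w. dwalk ta he B r w v \<longrightarrow> k \<le> wt (owt c) w)" for v
  proof (cases "\<exists>w. dwalk ta he B r w v")
    case True
    have "\<exists>w. dwalk ta he B r w v \<and> (\<forall>w'. dwalk ta he B r w' v \<longrightarrow> wt (owt c) w \<le> wt (owt c) w')"
      by (rule int_attains_min[where b = "- (\<Sum>e\<in>E. \<bar>c e\<bar>)"]) (use walk_weight_lower_bound True in auto)
    then obtain w where w: "dwalk ta he B r w v"
      "\<And>w'. dwalk ta he B r w' v \<Longrightarrow> wt (owt c) w \<le> wt (owt c) w'" by blast
    obtain w' where w': "dwalk ta he B r w' v" "distinct w'" "wt (owt c) w' \<le> wt (owt c) w"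
      using simple_walk_bound[OF w(1)] by blast
    have "wt (owt c) w' = wt (owt c) w" using w(2)[OF w'(1)] w'(3) by simp
    then show ?thesis using w w'(1,2) by blast
  qed blast
  from choice[OF allI[OF this]] obtain y where y:
    "\<forall>v. ((\<exists>w. dwalk ta he B r w v) \<longrightarrow> (\<exists>w. dwalk ta he B r w v \<and> distinct w \<and> wt (owt c) w = y v)) \<and>
      (\<forall>w. dwalk ta he B r w v \<longrightarrow> y v \<le> wt (owt c) w)" ..
  show ?thesis
  proof (intro exI[of _ y] conjI allI impI)
    fix v assume "\<exists>w. dwalk ta he B r w v"
    then show "\<exists>w. dwalk ta he B r w v \<and> distinct w \<and> wt (owt c) w = y v"
      using spec[OF y, of v] by (rule_tac mp[OF conjunct1])
  next
    fix v w assume "dwalk ta he B r w v"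
    then show "y v \<le> wt (owt c) w" using spec[OF y, of v] by simp
  qed
qed

end

section \<open>Integral flows in multigraphs\<close>

definition bal :: "'e set \<Rightarrow> ('e \<Rightarrow> 'n) \<Rightarrow> ('e \<Rightarrow> 'n) \<Rightarrow> ('e \<Rightarrow> int) \<Rightarrow> 'n \<Rightarrow> int" where
  "bal A ta he f v = (\<Sum>a\<in>{a \<in> A. ta a = v}. f a) - (\<Sum>a\<in>{a \<in> A. he a = v}. f a)"

text \<open>
  Oriented arcs \<open>(a, True)\<close> run along \<open>a\<close>, and \<open>(a, False)\<close> against it. An arc with negative value
  is in the support with its reverse orientation.
\<close>

definition osupp :: "'e set \<Rightarrow> ('e \<Rightarrow> int) \<Rightarrow> ('e \<times> bool) set" where
  "osupp A f = {a. fst a \<in> A \<and> 0 < owt f a}"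

definition residual :: "'e set \<Rightarrow> ('e \<Rightarrow> int) \<Rightarrow> ('e \<Rightarrow> int) \<Rightarrow> ('e \<times> bool) set" where
  "residual A cap f = {a. fst a \<in> A \<and> (if snd a then f (fst a) < cap (fst a) else 0 < f (fst a))}"

definition iflow :: "'e set \<Rightarrow> ('e \<Rightarrow> 'n) \<Rightarrow> ('e \<Rightarrow> 'n) \<Rightarrow> ('e \<Rightarrow> int) \<Rightarrow> 'n \<Rightarrow> 'n \<Rightarrow> ('e \<Rightarrow> int) \<Rightarrow> bool" where
  "iflow A ta he cap s t f \<longleftrightarrow>
     (\<forall>a\<in>A. 0 \<le> f a \<and> f a \<le> cap a) \<and> (\<forall>a. a \<notin> A \<longrightarrow> f a = 0) \<and>
     (\<forall>v. v \<noteq> s \<longrightarrow> v \<noteq> t \<longrightarrow> bal A ta he f v = 0)"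

lemma bal_diff: "bal A ta he (\<lambda>a. f a - g a) v = bal A ta he f v - bal A ta he g v"
  by (simp add: bal_def sum_subtractf)

lemma bal_swap: "bal A he ta f v = - bal A ta he f v"
  by (simp add: bal_def)

lemma residual_orev_osupp:
  assumes "a \<in> osupp A (\<lambda>e. f e - g e)" "\<And>e. e \<in> A \<Longrightarrow> 0 \<le> f e \<and> f e \<le> cap e"
    "\<And>e. e \<in> A \<Longrightarrow> 0 \<le> g e \<and> g e \<le> cap e"
  shows "a \<in> residual A cap g" "orev a \<in> residual A cap f"
proof -
  have "0 \<le> f (fst a) \<and> f (fst a) \<le> cap (fst a)" "0 \<le> g (fst a) \<and> g (fst a) \<le> cap (fst a)"
    using assms by (auto simp: osupp_def)
  then show "a \<in> residual A cap g" "orev a \<in> residual A cap f"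
    using assms(1) by (auto simp: osupp_def residual_def owt_def split: if_splits)
qed

text \<open>
  The sum of the balances over \<open>F\<close> is the net outflow across the boundary, since arcs inside \<open>F\<close>
  cancel. With the orientation by sign, a negative outflow counts as a positive inflow.
\<close>

lemma balanced_cut:
  assumes fin: "finite A" and bal: "\<And>v. v \<in> F \<Longrightarrow> bal A ta he f v = 0"
  shows "(\<Sum>a\<in>{a \<in> osupp A f. osrc ta he a \<in> F \<and> odst ta he a \<notin> F}. owt f a) =
    (\<Sum>a\<in>{a \<in> osupp A f. osrc ta he a \<notin> F \<and> odst ta he a \<in> F}. owt f a)"
proof -
  let ?F = "F \<inter> (ta ` A \<union> he ` A)"
  have finF: "finite ?F" using fin by simp
  let ?out = "{a \<in> A. ta a \<in> F \<and> he a \<notin> F}" and ?in = "{a \<in> A. ta a \<notin> F \<and> he a \<in> F}"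
    and ?both = "{a \<in> A. ta a \<in> F \<and> he a \<in> F}"
  have fins: "finite ?out" "finite ?in" "finite ?both" using fin by auto
  have tails: "(\<Sum>v\<in>?F. \<Sum>a\<in>{a \<in> A. ta a = v}. f a) = sum f ?out + sum f ?both"
  proof -
    have "(\<Sum>v\<in>?F. \<Sum>a\<in>{a \<in> A. ta a = v}. f a) = (\<Sum>v\<in>?F. \<Sum>a\<in>{a \<in> {a \<in> A. ta a \<in> F}. ta a = v}. f a)"
      by (intro sum.cong) auto
    also have "\<dots> = sum f {a \<in> A. ta a \<in> F}"
      by (rule sum.group) (use fin finF in auto)
    also have "{a \<in> A. ta a \<in> F} = ?out \<union> ?both" by auto
    finally show ?thesis using fins by (subst (asm) sum.union_disjoint) auto
  qed
  have heads: "(\<Sum>v\<in>?F. \<Sum>a\<in>{a \<in> A. he a = v}. f a) = sum f ?in + sum f ?both"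
  proof -
    have "(\<Sum>v\<in>?F. \<Sum>a\<in>{a \<in> A. he a = v}. f a) = (\<Sum>v\<in>?F. \<Sum>a\<in>{a \<in> {a \<in> A. he a \<in> F}. he a = v}. f a)"
      by (intro sum.cong) auto
    also have "\<dots> = sum f {a \<in> A. he a \<in> F}"
      by (rule sum.group) (use fin finF in auto)
    also have "{a \<in> A. he a \<in> F} = ?in \<union> ?both" by auto
    finally show ?thesis using fins by (subst (asm) sum.union_disjoint) auto
  qed
  have "0 = (\<Sum>v\<in>?F. bal A ta he f v)" using bal by simp
  also have "\<dots> = sum f ?out - sum f ?in"
    unfolding bal_def sum_subtractf tails heads by simp
  finally have io: "sum f ?out = sum f ?in" by simp
  define pos where "pos S = (\<Sum>a\<in>S. max 0 (f a))" for S
  define neg where "neg S = (\<Sum>a\<in>S. max 0 (- f a))" for S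
  have pn: "sum f S = pos S - neg S" for S
    unfolding pos_def neg_def sum_subtractf[symmetric] by (rule sum.cong) auto
  have part: "(\<Sum>a\<in>{a \<in> osupp A f. osrc ta he a \<in> X \<and> odst ta he a \<in> Y}. owt f a) =
      pos {a \<in> A. ta a \<in> X \<and> he a \<in> Y} + neg {a \<in> A. ta a \<in> Y \<and> he a \<in> X}" for X Y
  proof -
    let ?P = "{a \<in> A. ta a \<in> X \<and> he a \<in> Y}" and ?N = "{a \<in> A. ta a \<in> Y \<and> he a \<in> X}"
    have "{a \<in> osupp A f. osrc ta he a \<in> X \<and> odst ta he a \<in> Y} =
        (\<lambda>a. (a, True)) ` {a \<in> ?P. 0 < f a} \<union> (\<lambda>a. (a, False)) ` {a \<in> ?N. 0 < - f a}" (is "_ = ?I \<union> ?J")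
      by (auto simp: osupp_def owt_def osrc_def image_iff split: if_splits)
    then have "(\<Sum>a\<in>{a \<in> osupp A f. osrc ta he a \<in> X \<and> odst ta he a \<in> Y}. owt f a) =
        (\<Sum>a\<in>?I. owt f a) + (\<Sum>a\<in>?J. owt f a)"
      using fin by (simp only:) (rule sum.union_disjoint, auto)
    also have "(\<Sum>a\<in>?I. owt f a) = (\<Sum>a\<in>{a \<in> ?P. 0 < f a}. max 0 (f a))"
      by (subst sum.reindex) (auto simp: inj_on_def owt_def intro!: sum.cong)
    also have "\<dots> = pos ?P"
      unfolding pos_def by (rule sum.mono_neutral_left) (use fin in auto)
    also have "(\<Sum>a\<in>?J. owt f a) = (\<Sum>a\<in>{a \<in> ?N. 0 < - f a}. max 0 (- f a))"
      by (subst sum.reindex) (auto simp: inj_on_def owt_def intro!: sum.cong)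
    also have "\<dots> = neg ?N"
      unfolding neg_def by (rule sum.mono_neutral_left) (use fin in auto)
    finally show ?thesis .
  qed
  show ?thesis
    using io part[of F "- F"] part[of "- F" F] pn[of ?out] pn[of ?in] by (simp add: conj_commute)
qed

text \<open>
  Nothing leaves the set of nodes that the support reaches from the target of \<open>a\<close>, but \<open>a\<close> itself
  enters it. By \<open>balanced_cut\<close> the set contains an unbalanced node.
\<close>

lemma support_reaches_unbalanced:
  assumes fin: "finite A" and a: "a \<in> osupp A f"
    and acyc: "\<And>w. \<not> dwalk ta he (osupp A f) (odst ta he a) w (osrc ta he a)"
  shows "\<exists>w v. dwalk ta he (osupp A f) (odst ta he a) w v \<and> bal A ta he f v \<noteq> 0"
proof (rule ccontr)
  assume *: "\<not> ?thesis"
  define F where "F = {v. \<exists>w. dwalk ta he (osupp A f) (odst ta he a) w v}"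
  let ?in = "{a \<in> osupp A f. osrc ta he a \<notin> F \<and> odst ta he a \<in> F}"
  have closed: "odst ta he b \<in> F" if b: "b \<in> osupp A f" "osrc ta he b \<in> F" for b
  proof -
    obtain w where "dwalk ta he (osupp A f) (odst ta he a) w (osrc ta he b)"
      using b(2) F_def by auto
    then have "dwalk ta he (osupp A f) (odst ta he a) (w @ [b]) (odst ta he b)" using b(1) by auto
    then show ?thesis unfolding F_def by blast
  qed
  have "odst ta he a \<in> F" unfolding F_def by (auto intro: exI[of _ "[]"])
  moreover have "osrc ta he a \<notin> F" using acyc F_def by auto
  ultimately have in_a: "a \<in> ?in" using a by auto
  have "finite ?in"
    by (rule finite_subset[of _ "A \<times> UNIV"]) (use fin in \<open>auto simp: osupp_def\<close>)
  then have "owt f a \<le> (\<Sum>b\<in>?in. owt f b)"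
    using in_a by (intro member_le_sum) (auto simp: osupp_def)
  also have "\<dots> = (\<Sum>b\<in>{b \<in> osupp A f. osrc ta he b \<in> F \<and> odst ta he b \<notin> F}. owt f b)"
    by (rule balanced_cut[OF fin, symmetric]) (use * F_def in auto)
  also have "{b \<in> osupp A f. osrc ta he b \<in> F \<and> odst ta he b \<notin> F} = {}" using closed by auto
  finally show False using a by (simp add: osupp_def)
qed

subsection \<open>Augmentation\<close>

definition aug :: "('e \<Rightarrow> int) \<Rightarrow> ('e \<times> bool) list \<Rightarrow> 'e \<Rightarrow> int" where
  "aug f w a = f a + wt (\<lambda>b. if fst b = a then if snd b then 1 else - 1 else 0) w"

lemma sum_aug:
  assumes "finite X"
  shows "(\<Sum>a\<in>X. c a * aug f w a) = (\<Sum>a\<in>X. c a * f a) + wt (\<lambda>b. if fst b \<in> X then owt c b else 0) w"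
proof (induction w)
  case (Cons b w)
  have "(\<Sum>a\<in>X. c a * aug f (b # w) a) =
      (\<Sum>a\<in>X. c a * aug f w a + (if a = fst b then owt c b else 0))"
    by (rule sum.cong) (auto simp: aug_def owt_def algebra_simps)
  then show ?case using Cons assms by (simp add: sum.distrib)
qed (simp add: aug_def)

lemma aug_cost:
  assumes "finite A" "fst ` set w \<subseteq> A"
  shows "(\<Sum>a\<in>A. c a * aug f w a) = (\<Sum>a\<in>A. c a * f a) + wt (owt c) w"
  unfolding sum_aug[OF assms(1)] using assms(2) by (auto intro!: wt_cong)

lemma aug_bal:
  assumes fin: "finite A" and w: "dwalk ta he B p w q" "fst ` B \<subseteq> A"
  shows "bal A ta he (aug f w) v = bal A ta he f v + (if v = p then 1 else 0) - (if v = q then 1 else 0)"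
proof -
  have "bal A ta he (aug f w) v = bal A ta he f v +
      wt (\<lambda>b. if fst b \<in> {a \<in> A. ta a = v} then owt (\<lambda>_. 1) b else 0) w -
      wt (\<lambda>b. if fst b \<in> {a \<in> A. he a = v} then owt (\<lambda>_. 1) b else 0) w"
    unfolding bal_def
    using sum_aug[of "{a \<in> A. ta a = v}" "\<lambda>_. 1" f w] sum_aug[of "{a \<in> A. he a = v}" "\<lambda>_. 1" f w] fin
    by simp
  also have "\<dots> = bal A ta he f v + (if v = p then 1 else 0) - (if v = q then 1 else 0)"
    using w(1)
  proof (induction w arbitrary: p)
    case (Cons b w)
    have b: "fst b \<in> A" "p = osrc ta he b" using Cons.prems w(2) by auto
    have "dwalk ta he B (odst ta he b) w q" using Cons.prems by simp
    from Cons.IH[OF this] b show ?case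
      by (cases "snd b") (auto simp: owt_def osrc_def)
  qed simp
  finally show ?thesis .
qed

lemma aug_value:
  assumes "distinct (map fst w)"
  shows "aug f w a = (if (a, True) \<in> set w then f a + 1 else if (a, False) \<in> set w then f a - 1 else f a)"
proof -
  let ?h = "\<lambda>b. if fst b = a then if snd b then 1 else - 1 else (0 :: int)"
  have "wt ?h w = (if (a, True) \<in> set w then 1 else if (a, False) \<in> set w then - 1 else 0)"
    using assms
  proof (induction w)
    case (Cons b w)
    have no: "a = fst b \<Longrightarrow> (a, True) \<notin> set w" "a = fst b \<Longrightarrow> (a, False) \<notin> set w"
      using Cons.prems by (auto simp: image_iff)
    have "wt ?h w = (if (a, True) \<in> set w then 1 else if (a, False) \<in> set w then - 1 else 0)"
      using Cons by simp
    then show ?case using no by (cases b) (auto split: if_splits)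
  qed simp
  then show ?thesis by (simp add: aug_def)
qed

text \<open>
  A residual arc has room for one unit, so no arc may be used twice, not even in both directions.
\<close>

lemma aug_bounds:
  assumes "distinct (map fst w)" "set w \<subseteq> residual A cap f" "iflow A ta he cap s t f"
  shows "a \<in> A \<Longrightarrow> 0 \<le> aug f w a \<and> aug f w a \<le> cap a" "a \<notin> A \<Longrightarrow> aug f w a = 0"
proof -
  have r: "(a, True) \<in> set w \<Longrightarrow> a \<in> A \<and> f a < cap a" "(a, False) \<in> set w \<Longrightarrow> a \<in> A \<and> 0 < f a"
    using assms(2) by (auto simp: residual_def)
  have f: "a \<in> A \<Longrightarrow> 0 \<le> f a \<and> f a \<le> cap a" "a \<notin> A \<Longrightarrow> f a = 0"
    using assms(3) by (auto simp: iflow_def)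
  show "a \<in> A \<Longrightarrow> 0 \<le> aug f w a \<and> aug f w a \<le> cap a" "a \<notin> A \<Longrightarrow> aug f w a = 0"
    unfolding aug_value[OF assms(1)] using r f by auto
qed

lemma aug_closed:
  assumes fin: "finite A" and f: "iflow A ta he cap s t f"
    and w: "dwalk ta he (residual A cap f) p w p" "distinct (map fst w)"
  shows "iflow A ta he cap s t (aug f w)" "bal A ta he (aug f w) v = bal A ta he f v"
proof -
  have "fst ` residual A cap f \<subseteq> A" by (auto simp: residual_def)
  then show bal: "bal A ta he (aug f w) v = bal A ta he f v" for v
    using aug_bal[OF fin w(1)] by simp
  show "iflow A ta he cap s t (aug f w)"
    using aug_bounds[OF w(2) owalk_set[OF w(1)] f] f bal by (simp add: iflow_def)
qed

lemma aug_path: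
  assumes fin: "finite A" and f: "iflow A ta he cap s t f" and st: "s \<noteq> t"
    and w: "dwalk ta he (residual A cap f) s w t"
  shows "\<exists>g. iflow A ta he cap s t g \<and> bal A ta he g s = bal A ta he f s + 1"
proof -
  obtain v where v: "dwalk ta he (residual A cap f) s v t" "distinct (map (osrc ta he) v)"
    "t \<notin> osrc ta he ` set v"
    using simple_walk_exists[OF w] by blast
  have dist: "distinct (map fst v)" by (rule simple_open_walk_arcs[OF v])
  have sub: "fst ` residual A cap f \<subseteq> A" by (auto simp: residual_def)
  have bal: "bal A ta he (aug f v) n = bal A ta he f n + (if n = s then 1 else 0) - (if n = t then 1 else 0)" for n
    by (rule aug_bal[OF fin v(1) sub])
  have "iflow A ta he cap s t (aug f v)"
    using aug_bounds[OF dist owalk_set[OF v(1)] f] f bal by (simp add: iflow_def)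
  then show ?thesis using bal[of s] st by auto
qed

lemma sum_bal:
  assumes "finite A" "finite N" "ta ` A \<subseteq> N" "he ` A \<subseteq> N"
  shows "(\<Sum>v\<in>N. bal A ta he f v) = 0"
proof -
  have "(\<Sum>v\<in>N. \<Sum>a\<in>{a \<in> A. ta a = v}. f a) = sum f A" "(\<Sum>v\<in>N. \<Sum>a\<in>{a \<in> A. he a = v}. f a) = sum f A"
    using assms by (auto intro!: sum.group)
  then show ?thesis by (simp add: bal_def sum_subtractf)
qed

lemma iflow_bal_sink:
  assumes fin: "finite A" and f: "iflow A ta he cap s t f" and st: "s \<noteq> t"
  shows "bal A ta he f t = - bal A ta he f s"
proof -
  let ?N = "insert s (insert t (ta ` A \<union> he ` A))"
  have "0 = (\<Sum>v\<in>?N. bal A ta he f v)" by (rule sum_bal[symmetric]) (use fin in auto)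
  also have "\<dots> = (\<Sum>v\<in>{s, t}. bal A ta he f v)"
    by (rule sum.mono_neutral_right) (use fin f in \<open>auto simp: iflow_def\<close>)
  finally show ?thesis using st by simp
qed

lemma iflow_value_bound:
  assumes fin: "finite A" and f: "iflow A ta he cap s t f"
  shows "bal A ta he f v \<le> (\<Sum>a\<in>A. cap a)"
proof -
  have f': "\<And>a. a \<in> A \<Longrightarrow> 0 \<le> f a \<and> f a \<le> cap a" using f by (simp add: iflow_def)
  have "bal A ta he f v \<le> (\<Sum>a\<in>{a \<in> A. ta a = v}. f a)"
    unfolding bal_def using sum_nonneg[of "{a \<in> A. he a = v}" f] f' by simp
  also have "\<dots> \<le> sum f A" by (rule sum_mono2) (use fin f' in auto)
  also have "\<dots> \<le> (\<Sum>a\<in>A. cap a)" using f' by (intro sum_mono) auto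
  finally show ?thesis .
qed

text \<open>
  It suffices to consider vertex-simple walks. Such a walk is an arc followed by its reverse, or it
  can be augmented by one unit, which changes the cost by its weight.
\<close>

lemma closed_residual_nonneg:
  assumes fin: "finite A" and f: "iflow A ta he cap s t f"
    and opt: "\<And>g. iflow A ta he cap s t g \<Longrightarrow> bal A ta he g s = bal A ta he f s \<Longrightarrow>
      (\<Sum>a\<in>A. c a * f a) \<le> (\<Sum>a\<in>A. c a * g a)"
    and w: "dwalk ta he (residual A cap f) p w p"
  shows "0 \<le> wt (owt c) w"
proof (rule closed_walks_nonneg[OF _ w])
  fix p w assume w: "dwalk ta he (residual A cap f) p w p" and d: "distinct (map (osrc ta he) w)"
  show "0 \<le> wt (owt c) w"
  proof (cases "distinct (map fst w)")
    case True
    note g = aug_closed[OF fin f w True]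
    have "fst ` set w \<subseteq> A" using owalk_set[OF w] by (auto simp: residual_def)
    then show ?thesis using opt[OF g] aug_cost[OF fin] by simp
  next
    case False
    then obtain a where "w = [a, orev a]" using simple_closed_walk_arcs[OF w d] by blast
    then show ?thesis by simp
  qed
qed

section \<open>The steady state\<close>

definition dconn :: "('e \<Rightarrow> 'n) \<Rightarrow> ('e \<Rightarrow> 'n) \<Rightarrow> ('e \<times> bool) set \<Rightarrow> 'n \<Rightarrow> 'n \<Rightarrow> bool" where
  "dconn ta he B v v' \<longleftrightarrow> (\<exists>w. dwalk ta he B v w v')"

definition scomp :: "('e \<Rightarrow> 'n) \<Rightarrow> ('e \<Rightarrow> 'n) \<Rightarrow> ('e \<times> bool) set \<Rightarrow> 'n \<Rightarrow> 'n set" where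
  "scomp ta he B r = {v. dconn ta he B r v \<and> dconn ta he B v r}"

lemma dconn_refl [simp]: "dconn ta he B v v"
  unfolding dconn_def by (rule exI[of _ "[]"]) simp

lemma dconn_trans: "dconn ta he B u v \<Longrightarrow> dconn ta he B v w \<Longrightarrow> dconn ta he B u w"
  unfolding dconn_def by (metis owalk_append)

lemma dconn_walk: "dwalk ta he B v w v' \<Longrightarrow> dconn ta he B v v'"
  by (auto simp: dconn_def)

lemma dconn_arc: "a \<in> B \<Longrightarrow> dconn ta he B (osrc ta he a) (odst ta he a)"
  unfolding dconn_def by (rule exI[of _ "[a]"]) simp

lemma dconn_walk_arc:
  assumes "dwalk ta he B p w q" "a \<in> set w"
  shows "dconn ta he B p (osrc ta he a)" "dconn ta he B (odst ta he a) q" "a \<in> B"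
  using owalk_arc[OF assms] owalk_set[OF assms(1)] assms(2) by (auto simp: dconn_def; metis)+

lemma dconn_swap: "dconn he ta B v v' \<longleftrightarrow> dconn ta he B v' v"
  unfolding dconn_def using owalk_rev by (metis rev_rev_ident)

lemma scomp_swap: "scomp he ta B r = scomp ta he B r"
  by (auto simp: scomp_def dconn_swap)

lemma scomp_refl [simp]: "r \<in> scomp ta he B r"
  by (simp add: scomp_def)

lemma scomp_between:
  "dconn ta he B u v \<Longrightarrow> dconn ta he B v w \<Longrightarrow> u \<in> scomp ta he B r \<Longrightarrow> w \<in> scomp ta he B r \<Longrightarrow>
    v \<in> scomp ta he B r"
  unfolding scomp_def using dconn_trans by fast

lemma scomp_closed_walk:
  assumes "dwalk ta he B p w p" "a \<in> set w"
  shows "osrc ta he a \<in> scomp ta he B r \<longleftrightarrow> p \<in> scomp ta he B r"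
    "odst ta he a \<in> scomp ta he B r \<longleftrightarrow> p \<in> scomp ta he B r"
proof -
  note * = dconn_walk_arc[OF assms]
  note d = dconn_arc[OF *(3), of ta he]
  have "dconn ta he B (osrc ta he a) p" "dconn ta he B p (odst ta he a)"
    using *(1,2) d by (blast intro: dconn_trans)+
  then show "osrc ta he a \<in> scomp ta he B r \<longleftrightarrow> p \<in> scomp ta he B r"
    "odst ta he a \<in> scomp ta he B r \<longleftrightarrow> p \<in> scomp ta he B r"
    using *(1,2) unfolding scomp_def mem_Collect_eq by (meson dconn_trans)+
qed

text \<open>
  Two maximum flows differ by a circulation. Every arc on which they differ lies on a closed
  walk of its support, so its ends are strongly connected in both residual graphs.
\<close>

lemma dconn_max_flows:
  assumes fin: "finite E" and st: "s \<noteq> t"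
    and x: "iflow E ta he u s t x" and x': "iflow E ta he u s t x'"
    and val: "bal E ta he x s = bal E ta he x' s"
    and conn: "dconn ta he (residual E u x') v v'"
  shows "dconn ta he (residual E u x) v v'"
proof -
  let ?R = "residual E u x" and ?d = "\<lambda>e. x e - x' e"
  let ?S = "osupp E ?d"
  have bnd: "\<And>e. e \<in> E \<Longrightarrow> 0 \<le> x e \<and> x e \<le> u e" "\<And>e. e \<in> E \<Longrightarrow> 0 \<le> x' e \<and> x' e \<le> u e"
    using x x' by (auto simp: iflow_def)
  have bal: "bal E ta he ?d n = 0" for n
  proof -
    have "bal E ta he x t = bal E ta he x' t"
      using iflow_bal_sink[OF fin x st] iflow_bal_sink[OF fin x' st] val by simp
    then show ?thesis using x x' val by (cases "n = s \<or> n = t") (auto simp: bal_diff iflow_def)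
  qed
  have both: "dconn ta he ?R (osrc ta he a) (odst ta he a)" "dconn ta he ?R (odst ta he a) (osrc ta he a)"
    if a: "a \<in> ?S" for a
  proof -
    have rev: "orev b \<in> ?R" if "b \<in> ?S" for b
      by (rule residual_orev_osupp(2)[OF that]) (use bnd in auto)
    then show "dconn ta he ?R (odst ta he a) (osrc ta he a)"
      using dconn_arc[OF rev[OF a], of ta he] by simp
    obtain w where w: "dwalk ta he ?S (odst ta he a) w (osrc ta he a)"
      using support_reaches_unbalanced[OF fin a] bal by blast
    have "dwalk ta he ?R (osrc ta he a) (rev (map orev w)) (odst ta he a)"
      using dwalk_orev[OF w] rev owalk_set[OF w] by blast
    then show "dconn ta he ?R (osrc ta he a) (odst ta he a)" by (rule dconn_walk)
  qed
  have arc: "dconn ta he ?R (osrc ta he a) (odst ta he a)" if a: "a \<in> residual E u x'" for a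
  proof (cases "a \<in> ?R")
    case False
    then have "orev a \<in> ?S \<or> a \<in> ?S"
      using a bnd by (cases a) (force simp: residual_def osupp_def owt_def orev_def split: if_splits)
    then show ?thesis using both[of a] both[of "orev a"] by auto
  qed (rule dconn_arc)
  obtain w where "dwalk ta he (residual E u x') v w v'" using conn by (auto simp: dconn_def)
  then show ?thesis
  proof (induction w arbitrary: v)
    case (Cons a w)
    then have "dconn ta he ?R (osrc ta he a) (odst ta he a)" "dconn ta he ?R (odst ta he a) v'" "v = osrc ta he a"
      using arc[of a] Cons.IH[of "odst ta he a"] by simp_all
    then show ?case using dconn_trans by metis
  qed simp
qed

text \<open>
  The set \<open>B\<close> is the residual graph of a static flow. Lifted to the time-expanded network, a closed
  walk drifts in time by its transit time. In the components of \<open>s\<close> and \<open>t\<close>, the terminal can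
  exchange units at all times, so there the cost comes first; drift into the past is possible but
  not free. Elsewhere there must be no drift into the past, and the cost is only restricted if there
  is no drift at all.
\<close>

definition steady :: "'e set \<Rightarrow> ('e \<Rightarrow> 'n) \<Rightarrow> ('e \<Rightarrow> 'n) \<Rightarrow> ('e \<times> bool) set \<Rightarrow> ('e \<Rightarrow> int) \<Rightarrow> ('e \<Rightarrow> int) \<Rightarrow>
    'n \<Rightarrow> 'n \<Rightarrow> bool" where
  "steady E ta he B \<tau> c s t \<longleftrightarrow> \<not> dconn ta he B s t \<and>
     (\<forall>p w. dwalk ta he B p w p \<longrightarrow>
       (if p \<in> scomp ta he B s \<union> scomp ta he B t
        then 0 \<le> wt (owt c) w \<and> (wt (owt \<tau>) w < 0 \<longrightarrow> 0 < wt (owt c) w)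
        else 0 \<le> wt (owt \<tau>) w \<and> (wt (owt \<tau>) w = 0 \<longrightarrow> 0 \<le> wt (owt c) w)))"

text \<open>
  The property \<open>Q\<close> is constant along a closed walk, so the parts into which the walk splits inherit it.
\<close>

lemma closed_walks_lexicographic:
  assumes simple: "\<And>p w. owalk sr ds B p w p \<Longrightarrow> distinct (map sr w) \<Longrightarrow> Q p \<Longrightarrow>
      0 \<le> wt f w \<and> (wt f w = 0 \<longrightarrow> 0 \<le> wt g w)"
    and Q: "\<And>p w a. owalk sr ds B p w p \<Longrightarrow> a \<in> set w \<Longrightarrow> Q (sr a) \<longleftrightarrow> Q p"
  shows "owalk sr ds B p w p \<Longrightarrow> Q p \<Longrightarrow> 0 \<le> wt f w \<and> (wt f w = 0 \<longrightarrow> 0 \<le> wt g w)"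
proof (induction "length w" arbitrary: p w rule: less_induct)
  case less
  show ?case
  proof (cases "distinct (map sr w)")
    case False
    then obtain a b c m where *: "w = a @ b @ c" "b \<noteq> []" "c \<noteq> []"
      "owalk sr ds B p a m" "owalk sr ds B m b m" "owalk sr ds B m c p"
      using owalk_repeat[OF less.prems(1)] by metis
    have "m = sr (hd b)" "hd b \<in> set w" using owalk_start[OF *(5)] *(1,2) by auto
    then have "Q m" using Q[OF less.prems(1)] less.prems(2) by metis
    then have "0 \<le> wt f b \<and> (wt f b = 0 \<longrightarrow> 0 \<le> wt g b)"
      using less.hyps[OF _ *(5)] * by simp
    moreover have "0 \<le> wt f (a @ c) \<and> (wt f (a @ c) = 0 \<longrightarrow> 0 \<le> wt g (a @ c))"
      by (rule less.hyps[of _ p]) (use * less.prems in auto)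
    ultimately show ?thesis using * by auto
  qed (use less simple in blast)
qed

text \<open>
  Among the maximum flows, \<open>x\<close> minimises the transit time outside the components, then the cost, then
  the whole transit time. The first criterion is linear in \<open>x\<close> because, by \<open>dconn_max_flows\<close>, all
  maximum flows have the same components; on closed walks it is the transit time outside the
  components and 0 inside.
\<close>

lemma steady_flow_exists:
  assumes fin: "finite E" and st: "s \<noteq> t" and u: "\<And>e. e \<in> E \<Longrightarrow> 0 \<le> u e"
    and \<tau>: "\<And>e. e \<in> E \<Longrightarrow> 0 \<le> \<tau> e"
  shows "\<exists>x. iflow E ta he u s t x \<and> steady E ta he (residual E u x) \<tau> c s t"
proof -
  let ?fl = "iflow E ta he u s t" and ?val = "\<lambda>x. bal E ta he x s"
  have "?fl (\<lambda>_. 0)" using u by (simp add: iflow_def bal_def)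
  then have "\<exists>x. ?fl x \<and> (\<forall>x'. ?fl x' \<longrightarrow> - ?val x \<le> - ?val x')"
    by (intro int_attains_min[where b = "- (\<Sum>e\<in>E. u e)"]) (use iflow_value_bound[OF fin] in auto)
  then obtain x0 where x0: "?fl x0" "\<And>x'. ?fl x' \<Longrightarrow> ?val x' \<le> ?val x0" by auto
  define mx where "mx x \<longleftrightarrow> ?fl x \<and> ?val x = ?val x0" for x
  define In where "In = (\<lambda>x e. \<exists>r\<in>{s, t}. ta e \<in> scomp ta he (residual E u x) r \<and>
    he e \<in> scomp ta he (residual E u x) r)"
  define tot where "tot k x = (\<Sum>e\<in>E. k e * x e :: int)" for k x
  define tq where "tq e = (if In x0 e then 0 else \<tau> e)" for e
  have low: "- (\<Sum>e\<in>E. \<bar>k e\<bar> * u e) \<le> tot k x" if "mx x" for k x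
  proof -
    have "- (\<bar>k e\<bar> * u e) \<le> k e * x e" if "e \<in> E" for e
    proof -
      have "0 \<le> x e" "x e \<le> u e" using \<open>mx x\<close> that by (auto simp: mx_def iflow_def)
      then have "\<bar>k e * x e\<bar> \<le> \<bar>k e\<bar> * u e" by (simp add: abs_mult mult_left_mono)
      then show ?thesis by linarith
    qed
    then show ?thesis unfolding tot_def by (simp flip: sum_negf) (rule sum_mono)
  qed
  have "\<exists>x. mx x \<and> (\<forall>x'. mx x' \<longrightarrow> tot tq x \<le> tot tq x')"
    by (rule int_attains_min[where b = "- (\<Sum>e\<in>E. \<bar>tq e\<bar> * u e)"]) (use low x0 mx_def in auto)
  then obtain x1 where x1: "mx x1" "\<And>x'. mx x' \<Longrightarrow> tot tq x1 \<le> tot tq x'" by auto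
  define mx1 where "mx1 x \<longleftrightarrow> mx x \<and> tot tq x = tot tq x1" for x
  have "\<exists>x. mx1 x \<and> (\<forall>x'. mx1 x' \<longrightarrow> tot c x \<le> tot c x')"
    by (rule int_attains_min[where b = "- (\<Sum>e\<in>E. \<bar>c e\<bar> * u e)"]) (use low x1 mx1_def in auto)
  then obtain x2 where x2: "mx1 x2" "\<And>x'. mx1 x' \<Longrightarrow> tot c x2 \<le> tot c x'" by auto
  define mx2 where "mx2 x \<longleftrightarrow> mx1 x \<and> tot c x = tot c x2" for x
  have "\<exists>x. mx2 x \<and> (\<forall>x'. mx2 x' \<longrightarrow> tot \<tau> x \<le> tot \<tau> x')"
    by (rule int_attains_min[where b = "- (\<Sum>e\<in>E. \<bar>\<tau> e\<bar> * u e)"])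
      (use low x2 mx1_def mx2_def in auto)
  then obtain x where x: "mx2 x" "\<And>x'. mx2 x' \<Longrightarrow> tot \<tau> x \<le> tot \<tau> x'" by auto
  have fl: "?fl x" and val: "?val x = ?val x0" using x by (auto simp: mx2_def mx1_def mx_def)
  let ?R = "residual E u x"
  have conn: "dconn ta he ?R = dconn ta he (residual E u x0)"
    using dconn_max_flows[OF fin st fl x0(1) val] dconn_max_flows[OF fin st x0(1) fl val[symmetric]]
    by (intro ext) blast
  then have comp: "scomp ta he (residual E u x0) r = scomp ta he ?R r" for r
    by (simp add: scomp_def)
  have maximal: "\<not> dconn ta he ?R s t"
    using aug_path[OF fin fl st] x0(2) val by (fastforce simp: dconn_def)
  have simple: "mx (aug x w)" "tot k (aug x w) = tot k x + wt (owt k) w"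
    if w: "dwalk ta he ?R p w p" "distinct (map fst w)" for p w k
  proof -
    show "mx (aug x w)" using aug_closed[OF fin fl w] val by (simp add: mx_def)
    have "fst ` set w \<subseteq> E" using owalk_set[OF w(1)] by (auto simp: residual_def)
    then show "tot k (aug x w) = tot k x + wt (owt k) w" unfolding tot_def by (rule aug_cost[OF fin])
  qed
  let ?C = "scomp ta he ?R s \<union> scomp ta he ?R t"
  have ends: "osrc ta he a \<in> ?C \<longleftrightarrow> p \<in> ?C" "In x0 (fst a) \<longleftrightarrow> p \<in> ?C"
    if w: "dwalk ta he ?R p w p" "a \<in> set w" for p w a
  proof -
    have "ta (fst a) \<in> scomp ta he ?R r \<longleftrightarrow> p \<in> scomp ta he ?R r"
      "he (fst a) \<in> scomp ta he ?R r \<longleftrightarrow> p \<in> scomp ta he ?R r" for r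
      using scomp_closed_walk[OF w, of r] by (cases "snd a"; simp add: osrc_def)+
    then show "In x0 (fst a) \<longleftrightarrow> p \<in> ?C" unfolding In_def comp by blast
    show "osrc ta he a \<in> ?C \<longleftrightarrow> p \<in> ?C" using scomp_closed_walk(1)[OF w] by blast
  qed
  have tq: "wt (owt tq) w = (if p \<in> ?C then 0 else wt (owt \<tau>) w)" if w: "dwalk ta he ?R p w p" for p w
  proof -
    have "wt (owt tq) w = wt (\<lambda>a. (if p \<in> ?C then 0 else 1) * owt \<tau> a) w"
      by (rule wt_cong) (use ends(2)[OF w] in \<open>auto simp: tq_def owt_def\<close>)
    then show ?thesis by (simp add: wt_cmult)
  qed
  have in_C: "0 \<le> wt (owt c) w \<and> (wt (owt c) w = 0 \<longrightarrow> 0 \<le> wt (owt \<tau>) w)"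
    if w: "dwalk ta he ?R p w p" and p: "p \<in> ?C" for p w
  proof (rule closed_walks_lexicographic[where Q = "\<lambda>p. p \<in> ?C", OF _ _ w p])
    fix p w assume w: "dwalk ta he ?R p w p" "distinct (map (osrc ta he) w)" and p: "p \<in> ?C"
    show "0 \<le> wt (owt c) w \<and> (wt (owt c) w = 0 \<longrightarrow> 0 \<le> wt (owt \<tau>) w)"
    proof (cases "distinct (map fst w)")
      case True
      note s = simple[OF w(1) True]
      have 1: "mx1 (aug x w)" using s(1) s(2)[of tq] tq[OF w(1)] p x by (auto simp: mx1_def mx2_def)
      then have 2: "0 \<le> wt (owt c) w" using x2(2)[OF 1] s(2)[of c] x by (auto simp: mx2_def)
      have "0 \<le> wt (owt \<tau>) w" if "wt (owt c) w = 0"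
        using x(2)[of "aug x w"] 1 s(2)[of c] s(2)[of \<tau>] x(1) that by (auto simp: mx2_def)
      then show ?thesis using 2 by blast
    next
      case False
      then obtain a where "w = [a, orev a]" using simple_closed_walk_arcs[OF w] by blast
      then show ?thesis by simp
    qed
  qed (use ends(1) in blast)
  have out_C: "0 \<le> wt (owt \<tau>) w \<and> (wt (owt \<tau>) w = 0 \<longrightarrow> 0 \<le> wt (owt c) w)"
    if w: "dwalk ta he ?R p w p" and p: "p \<notin> ?C" for p w
  proof (rule closed_walks_lexicographic[where Q = "\<lambda>p. p \<notin> ?C", OF _ _ w p])
    fix p w assume w: "dwalk ta he ?R p w p" "distinct (map (osrc ta he) w)" and p: "p \<notin> ?C"
    show "0 \<le> wt (owt \<tau>) w \<and> (wt (owt \<tau>) w = 0 \<longrightarrow> 0 \<le> wt (owt c) w)"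
    proof (cases "distinct (map fst w)")
      case True
      note s = simple[OF w(1) True]
      have 1: "0 \<le> wt (owt \<tau>) w"
        using x1(2)[OF s(1)] s(2)[of tq] tq[OF w(1)] p x by (auto simp: mx1_def mx2_def)
      have "0 \<le> wt (owt c) w" if "wt (owt \<tau>) w = 0"
        using x2(2)[of "aug x w"] s(1) s(2)[of tq] s(2)[of c] tq[OF w(1)] p x that
        by (auto simp: mx1_def mx2_def)
      then show ?thesis using 1 by blast
    next
      case False
      then obtain a where "w = [a, orev a]" using simple_closed_walk_arcs[OF w] by blast
      then show ?thesis by simp
    qed
  qed (use ends(1) in blast)
  have "steady E ta he ?R \<tau> c s t"
    unfolding steady_def
  proof (intro conjI allI impI)
    fix p w assume w: "dwalk ta he ?R p w p"
    show "if p \<in> ?C then 0 \<le> wt (owt c) w \<and> (wt (owt \<tau>) w < 0 \<longrightarrow> 0 < wt (owt c) w)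
        else 0 \<le> wt (owt \<tau>) w \<and> (wt (owt \<tau>) w = 0 \<longrightarrow> 0 \<le> wt (owt c) w)"
      using in_C[OF w] out_C[OF w] by (cases "p \<in> ?C") auto
  qed (rule maximal)
  then show ?thesis using fl by blast
qed

section \<open>Flows over time relative to the steady state\<close>

text \<open>
  All copies of a terminal are identified, because a terminal can send and receive units at any
  time. The node \<open>(s, 0)\<close> thus plays the role of the super-source.
\<close>

definition gnode :: "'v \<Rightarrow> 'v \<Rightarrow> 'v \<times> int \<Rightarrow> 'v \<times> int" where
  "gnode s t n = (fst n, if fst n = s \<or> fst n = t then 0 else snd n)"

definition ctail :: "('e \<Rightarrow> 'v) \<Rightarrow> 'e \<times> int \<Rightarrow> 'v \<times> int" where
  "ctail ta a = (ta (fst a), snd a)"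

definition chead :: "('e \<Rightarrow> 'v) \<Rightarrow> ('e \<Rightarrow> int) \<Rightarrow> 'e \<times> int \<Rightarrow> 'v \<times> int" where
  "chead he \<tau> a = (he (fst a), snd a + \<tau> (fst a))"

definition real_copies :: "'e set \<Rightarrow> ('e \<Rightarrow> int) \<Rightarrow> int \<Rightarrow> ('e \<times> int) set" where
  "real_copies E \<tau> \<theta> = {a. fst a \<in> E \<and> 1 \<le> snd a \<and> snd a + \<tau> (fst a) \<le> \<theta>}"

text \<open>
  These copies are only required to overlap the horizon. On those that are not real copies, the
  steady flow differs from a flow over time wherever it is not 0.
\<close>

definition copies :: "'e set \<Rightarrow> ('e \<Rightarrow> int) \<Rightarrow> int \<Rightarrow> ('e \<times> int) set" where
  "copies E \<tau> \<theta> = {a. fst a \<in> E \<and> 1 \<le> snd a + \<tau> (fst a) \<and> snd a \<le> \<theta>}"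

text \<open>
  The horizon consists of the times \<open>1..\<theta>\<close>. The margins are chosen such that reversing time, which
  sends \<open>i\<close> to \<open>\<theta> + 1 - i\<close>, preserves inner copies.
\<close>

definition inner :: "('e \<Rightarrow> int) \<Rightarrow> int \<Rightarrow> int \<Rightarrow> 'e \<times> int \<Rightarrow> bool" where
  "inner \<tau> \<theta> d a \<longleftrightarrow> d \<le> snd a \<and> snd a + \<tau> (fst a) \<le> \<theta> + 1 - d"

definition dev :: "('e \<Rightarrow> int) \<Rightarrow> ('e \<times> int \<Rightarrow> int) \<Rightarrow> 'e \<times> int \<Rightarrow> int" where
  "dev x \<phi> a = \<phi> a - x (fst a)"

definition proj :: "('e \<times> int) \<times> bool \<Rightarrow> 'e \<times> bool" where
  "proj a = (fst (fst a), snd a)"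

lemma proj_simps [simp]:
  "fst (proj a) = fst (fst a)" "snd (proj a) = snd a" "proj (orev a) = orev (proj a)"
  "owt (\<lambda>a. f (fst a)) a = owt f (proj a)"
  "fst (osrc (ctail ta) (chead he \<tau>) a) = osrc ta he (proj a)"
  "fst (odst (ctail ta) (chead he \<tau>) a) = odst ta he (proj a)"
  by (auto simp: proj_def orev_def owt_def osrc_def ctail_def chead_def)

lemma wt_proj: "wt (owt (\<lambda>a. f (fst a))) w = wt (owt f) (map proj w)"
  by (induction w) auto

lemma snd_odst:
  "snd (odst (ctail ta) (chead he \<tau>) a) = snd (osrc (ctail ta) (chead he \<tau>) a) + owt \<tau> (proj a)"
  by (auto simp: osrc_def ctail_def chead_def owt_def)

lemma walk_proj:
  assumes "dwalk (ctail ta) (chead he \<tau>) B p w q" "proj ` B \<subseteq> B'"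
  shows "dwalk ta he B' (fst p) (map proj w) (fst q)" "snd q = snd p + wt (owt \<tau>) (map proj w)"
proof -
  have "dwalk ta he B' (fst p) (map proj w) (fst q) \<and> snd q = snd p + wt (owt \<tau>) (map proj w)"
    using assms(1)
  proof (induction w arbitrary: p)
    case (Cons a w)
    then have "dwalk (ctail ta) (chead he \<tau>) B (odst (ctail ta) (chead he \<tau>) a) w q"
      "a \<in> B" "p = osrc (ctail ta) (chead he \<tau>) a" by auto
    from Cons.IH[OF this(1)] this(2,3) assms(2) snd_odst[of he \<tau> ta a] show ?case by auto
  qed simp
  then show "dwalk ta he B' (fst p) (map proj w) (fst q)" "snd q = snd p + wt (owt \<tau>) (map proj w)"
    by blast+
qed

text \<open>
  A copy is determined by its static arc and the time of its source, so a walk lifts uniquely once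
  the time of its first node is given.
\<close>

lemma walk_lift:
  assumes "dwalk ta he B v w v'"
  shows "\<exists>W. dwalk (ctail ta) (chead he \<tau>) {a. proj a \<in> B} (v, j) W (v', j + wt (owt \<tau>) w) \<and>
    map proj W = w"
  using assms
proof (induction w arbitrary: v j)
  case (Cons a w)
  define b where "b = ((fst a, if snd a then j else j - \<tau> (fst a)), snd a)"
  have b: "proj b = a" "osrc (ctail ta) (chead he \<tau>) b = (osrc ta he a, j)"
    by (auto simp: b_def proj_def osrc_def ctail_def chead_def)
  have "odst (ctail ta) (chead he \<tau>) b = (odst ta he a, j + owt \<tau> a)"
    using snd_odst[of he \<tau> ta b] b by (intro prod_eqI) auto
  moreover obtain W where "dwalk (ctail ta) (chead he \<tau>) {a. proj a \<in> B} (odst ta he a, j + owt \<tau> a) W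
      (v', j + owt \<tau> a + wt (owt \<tau>) w)" "map proj W = w"
    using Cons.IH[of "odst ta he a" "j + owt \<tau> a"] Cons.prems by auto
  ultimately show ?case using b Cons.prems by (intro exI[of _ "b # W"]) (auto simp: add.assoc)
qed (auto intro!: exI[of _ "[]"])

lemma osrc_comp: "osrc (f \<circ> ta) (f \<circ> he) a = f (osrc ta he a)"
  by (simp add: osrc_def)

lemma walk_gnode:
  assumes "dwalk ta he B p w q"
  shows "dwalk (gnode s t \<circ> ta) (gnode s t \<circ> he) B (gnode s t p) w (gnode s t q)"
  using assms by (induction w arbitrary: p) (auto simp: osrc_comp)

text \<open>
  The static flow \<open>x\<close> has the residual graph \<open>R\<close>, and the flow over time \<open>\<phi>\<close> has the residual graph \<open>A\<close>,
  whose walks live on nodes with identified terminals. The walks of the deviation \<open>H\<close> keep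
  the times at the terminals instead, as they must be comparable with the horizon.
\<close>

locale turnpike_base =
  fixes E :: "'e set" and ta he :: "'e \<Rightarrow> 'v" and \<tau> c u :: "'e \<Rightarrow> int" and s0 t0 :: 'v
    and x :: "'e \<Rightarrow> int" and \<phi> :: "'e \<times> int \<Rightarrow> int" and \<theta> :: int
  assumes fin: "finite E" and s0_t0: "s0 \<noteq> t0"
    and \<tau>_nonneg: "\<And>e. e \<in> E \<Longrightarrow> 0 \<le> \<tau> e"
    and ground_arc: "\<And>e. e \<in> E \<Longrightarrow> ta e \<in> {s0, t0} \<or> he e \<in> {s0, t0} \<Longrightarrow> \<tau> e = 0"
    and x_bounds: "\<And>e. e \<in> E \<Longrightarrow> 0 \<le> x e \<and> x e \<le> u e"
    and x_bal: "\<And>v. v \<noteq> s0 \<Longrightarrow> v \<noteq> t0 \<Longrightarrow> bal E ta he x v = 0"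
    and \<phi>_bounds: "\<And>e k. e \<in> E \<Longrightarrow> 0 \<le> \<phi> (e, k) \<and> \<phi> (e, k) \<le> u e"
    and \<phi>_zero: "\<And>a. a \<notin> real_copies E \<tau> \<theta> \<Longrightarrow> \<phi> a = 0"
    and \<phi>_bal: "\<And>v i. v \<noteq> s0 \<Longrightarrow> v \<noteq> t0 \<Longrightarrow> 1 \<le> i \<Longrightarrow> i \<le> \<theta> \<Longrightarrow>
      (\<Sum>e\<in>{e \<in> E. ta e = v}. \<phi> (e, i)) = (\<Sum>e\<in>{e \<in> E. he e = v}. \<phi> (e, i - \<tau> e))"
    and steady: "steady E ta he (residual E u x) \<tau> c s0 t0"
begin

abbreviation "R \<equiv> residual E u x"
abbreviation "H \<equiv> osupp (copies E \<tau> \<theta>) (dev x \<phi>)"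
abbreviation "A \<equiv> residual (real_copies E \<tau> \<theta>) (\<lambda>a. u (fst a)) \<phi>"
abbreviation "psrc \<equiv> osrc (ctail ta) (chead he \<tau>)"
abbreviation "pdst \<equiv> odst (ctail ta) (chead he \<tau>)"
abbreviation "pwalk \<equiv> dwalk (ctail ta) (chead he \<tau>)"
abbreviation "hwalk \<equiv> pwalk H"
abbreviation "N \<equiv> gnode s0 t0"
abbreviation "awalk \<equiv> dwalk (gnode s0 t0 \<circ> ctail ta) (gnode s0 t0 \<circ> chead he \<tau>) A"
abbreviation "aconn \<equiv> dconn (gnode s0 t0 \<circ> ctail ta) (gnode s0 t0 \<circ> chead he \<tau>) A"
abbreviation "cost \<equiv> wt (owt (\<lambda>a. c (fst a)))"
abbreviation "S \<equiv> scomp ta he R s0"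
abbreviation "Q \<equiv> scomp ta he R t0"

definition "T = (\<Sum>e\<in>E. \<tau> e)"
definition "M = (\<Sum>e\<in>E. \<bar>c e\<bar> * u e)"

lemma T_nonneg: "0 \<le> T"
  unfolding T_def using \<tau>_nonneg by (rule sum_nonneg)

lemma \<tau>_le_T: "e \<in> E \<Longrightarrow> \<tau> e \<le> T"
  unfolding T_def using \<tau>_nonneg fin by (intro member_le_sum) auto

lemma T_abs: "(\<Sum>e\<in>E. \<bar>\<tau> e\<bar>) = T"
  unfolding T_def using \<tau>_nonneg by (intro sum.cong) auto

lemma M_nonneg: "0 \<le> M"
  unfolding M_def using x_bounds by (intro sum_nonneg) (force intro: mult_nonneg_nonneg)

lemma R_E: "a \<in> R \<Longrightarrow> fst a \<in> E" "fst ` R \<subseteq> E"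
  by (auto simp: residual_def)

lemma H_E: "a \<in> H \<Longrightarrow> fst (fst a) \<in> E"
  by (auto simp: osupp_def copies_def)

lemma fin_copies: "finite (copies E \<tau> \<theta>)"
proof (rule finite_subset)
  show "copies E \<tau> \<theta> \<subseteq> E \<times> {1 - T..\<theta>}" using \<tau>_le_T by (fastforce simp: copies_def)
qed (use fin in simp)

lemma step_bound: "fst (fst a) \<in> E \<Longrightarrow> \<bar>owt \<tau> (proj a)\<bar> \<le> T"
  using \<tau>_nonneg[of "fst (fst a)"] \<tau>_le_T[of "fst (fst a)"] by (auto simp: owt_def)

lemma H_step: "a \<in> H \<Longrightarrow> \<bar>snd (pdst a) - snd (psrc a)\<bar> \<le> T"
  using step_bound[OF H_E] by (simp add: snd_odst)

lemma \<phi>_bounds': "a \<in> real_copies E \<tau> \<theta> \<Longrightarrow> 0 \<le> \<phi> a \<and> \<phi> a \<le> u (fst a)"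
  using \<phi>_bounds[of "fst a" "snd a"] by (simp add: real_copies_def)

lemma H_R: "a \<in> H \<Longrightarrow> proj a \<in> R"
  using \<phi>_bounds[of "fst (fst a)" "snd (fst a)"] x_bounds[of "fst (fst a)"]
  by (auto simp: osupp_def owt_def dev_def residual_def copies_def split: if_splits)

lemma H_R': "proj ` H \<subseteq> R"
  using H_R by blast

lemma H_times:
  assumes "a \<in> H"
  shows "1 \<le> snd (psrc a)" "snd (pdst a) \<le> \<theta>"
proof -
  have "fst a \<in> real_copies E \<tau> \<theta>" if "snd a"
    using \<phi>_zero[of "fst a"] x_bounds[of "fst (fst a)"] assms that
    by (cases "fst a \<in> real_copies E \<tau> \<theta>") (auto simp: osupp_def owt_def dev_def copies_def)
  then show "1 \<le> snd (psrc a)" "snd (pdst a) \<le> \<theta>"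
    using assms by (auto simp: osrc_def ctail_def chead_def real_copies_def osupp_def copies_def)
qed

lemma real_copy_iff:
  assumes "fst (fst a) \<in> E"
  shows "fst a \<in> real_copies E \<tau> \<theta> \<longleftrightarrow>
    1 \<le> snd (psrc a) \<and> 1 \<le> snd (pdst a) \<and> snd (psrc a) \<le> \<theta> \<and> snd (pdst a) \<le> \<theta>"
  using assms \<tau>_nonneg[OF assms] by (auto simp: real_copies_def osrc_def ctail_def chead_def)

lemma H_real:
  assumes "a \<in> H" "snd (psrc a) \<le> \<theta>" "1 \<le> snd (pdst a)"
  shows "fst a \<in> real_copies E \<tau> \<theta>" "orev a \<in> A"
proof -
  show "fst a \<in> real_copies E \<tau> \<theta>"
    using real_copy_iff[OF H_E[OF assms(1)]] H_times[OF assms(1)] assms by simp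
  then show "orev a \<in> A"
    using assms(1) x_bounds[of "fst (fst a)"]
    by (auto simp: residual_def osupp_def owt_def dev_def orev_def real_copies_def split: if_splits)
qed

text \<open>
  Room that \<open>x\<close> has and \<open>\<phi>\<close> lacks is a deviation.
\<close>

lemma nonresidual_copy_in_H:
  assumes "proj a \<in> R" "fst a \<in> real_copies E \<tau> \<theta>" "a \<notin> A"
  shows "a \<in> H"
  using assms \<phi>_bounds'[OF assms(2)] \<tau>_nonneg[of "fst (fst a)"]
  by (auto simp: residual_def osupp_def owt_def dev_def real_copies_def copies_def split: if_splits)

lemma dev_bal:
  assumes "v \<noteq> s0" "v \<noteq> t0" "1 \<le> i" "i \<le> \<theta>"
  shows "bal (copies E \<tau> \<theta>) (ctail ta) (chead he \<tau>) (dev x \<phi>) (v, i) = 0"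
proof -
  have pos: "1 \<le> i + \<tau> e" "i - \<tau> e \<le> \<theta>" if "e \<in> E" for e
    using \<tau>_nonneg[OF that] assms by auto
  have "{a \<in> copies E \<tau> \<theta>. ctail ta a = (v, i)} = (\<lambda>e. (e, i)) ` {e \<in> E. ta e = v}"
    using pos assms by (auto simp: copies_def ctail_def)
  then have "(\<Sum>a\<in>{a \<in> copies E \<tau> \<theta>. ctail ta a = (v, i)}. dev x \<phi> a) =
      (\<Sum>e\<in>{e \<in> E. ta e = v}. \<phi> (e, i) - x e)"
    by (simp add: sum.reindex inj_on_def dev_def)
  moreover have "{a \<in> copies E \<tau> \<theta>. chead he \<tau> a = (v, i)} = (\<lambda>e. (e, i - \<tau> e)) ` {e \<in> E. he e = v}"
    using pos assms by (auto simp: copies_def chead_def image_iff)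
  then have "(\<Sum>a\<in>{a \<in> copies E \<tau> \<theta>. chead he \<tau> a = (v, i)}. dev x \<phi> a) =
      (\<Sum>e\<in>{e \<in> E. he e = v}. \<phi> (e, i - \<tau> e) - x e)"
    by (simp add: sum.reindex inj_on_def dev_def)
  ultimately show ?thesis
    using \<phi>_bal[OF assms] x_bal[OF assms(1,2)] by (simp add: bal_def sum_subtractf)
qed

text \<open>
  Arcs at terminals have transit time 0, so a copy that overlaps the horizon does not leave it.
\<close>

lemma ground_time:
  assumes "a \<in> H"
  shows "fst (psrc a) \<in> {s0, t0} \<Longrightarrow> snd (psrc a) \<le> \<theta>" "fst (pdst a) \<in> {s0, t0} \<Longrightarrow> 1 \<le> snd (pdst a)"
proof -
  have *: "owt \<tau> (proj a) = 0" if "osrc ta he (proj a) \<in> {s0, t0} \<or> odst ta he (proj a) \<in> {s0, t0}"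
    using ground_arc[OF H_E[OF assms]] that by (cases "snd a") (auto simp: osrc_def owt_def)
  show "fst (psrc a) \<in> {s0, t0} \<Longrightarrow> snd (psrc a) \<le> \<theta>" "fst (pdst a) \<in> {s0, t0} \<Longrightarrow> 1 \<le> snd (pdst a)"
    using * H_times[OF assms] snd_odst[of he \<tau> ta a] by auto
qed

lemma no_st: "\<not> dconn ta he R s0 t0"
  using steady by (simp add: steady_def)

lemma S_Q_disjoint: "v \<in> S \<Longrightarrow> v \<notin> Q"
  using no_st dconn_trans unfolding scomp_def by fast

lemma s0_Q: "s0 \<notin> Q" and t0_S: "t0 \<notin> S"
  using no_st by (auto simp: scomp_def)

lemma closed_walk_in_component:
  assumes "dwalk ta he R p w p" "p \<in> S \<union> Q"
  shows "0 \<le> wt (owt c) w" "wt (owt \<tau>) w < 0 \<Longrightarrow> 0 < wt (owt c) w"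
  using steady assms unfolding steady_def by meson+

lemma closed_walk_outside:
  assumes "dwalk ta he R p w p" "p \<notin> S \<union> Q"
  shows "0 \<le> wt (owt \<tau>) w" "wt (owt \<tau>) w = 0 \<Longrightarrow> 0 \<le> wt (owt c) w"
  using steady assms unfolding steady_def by meson+

end

text \<open>
  Each assumption expresses that \<open>\<phi>\<close> cannot be improved by augmentation: in value, in cost, in its
  total distance from \<open>x\<close> (a closed walk of \<open>H\<close> could be cancelled), and in its distance from \<open>x\<close> on
  inner copies. For the last one, a closed walk of cost at most 0 that uses inner copies
  only against \<open>H\<close> would bring \<open>\<phi>\<close> closer to \<open>x\<close> there.
\<close>

locale turnpike = turnpike_base +
  fixes d :: int
  assumes max_value: "\<not> aconn (s0, 0) (t0, 0)"
    and min_cost: "\<And>p w. awalk p w p \<Longrightarrow> 0 \<le> cost w"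
    and acyclic: "\<And>p w. dwalk (N \<circ> ctail ta) (N \<circ> chead he \<tau>) H p w p \<Longrightarrow> w = []"
    and no_swap: "\<And>p w a. awalk p w p \<Longrightarrow> cost w \<le> 0 \<Longrightarrow> a \<in> set w \<Longrightarrow> inner \<tau> \<theta> d (fst a) \<Longrightarrow>
      \<exists>b\<in>set w. inner \<tau> \<theta> d (fst b) \<and> orev b \<notin> H"
begin

lemma H_acyclic: "hwalk p w p \<Longrightarrow> w = []"
  by (rule acyclic[OF walk_gnode])

lemma hwalk_le: "hwalk p w q \<Longrightarrow> snd p \<le> \<theta> \<Longrightarrow> snd q \<le> \<theta>"
  using owalk_end[of psrc pdst H p w q] subsetD[OF owalk_set[of psrc pdst H p w q] last_in_set] H_times(2)[of "last w"]
  by (auto split: if_splits)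

lemma hwalk_R: "hwalk p w q \<Longrightarrow> dconn ta he R (fst p) (fst q)"
  by (rule dconn_walk[OF walk_proj(1)[OF _ H_R']])

lemma H_forward:
  assumes a: "a \<in> H"
  shows "\<exists>w q. hwalk (pdst a) w q \<and> (snd q \<le> 0 \<or> fst q \<in> {s0, t0})"
proof -
  have "\<not> hwalk (pdst a) w (psrc a)" for w
  proof
    assume "hwalk (pdst a) w (psrc a)"
    then have "hwalk (psrc a) (a # w) (psrc a)" using a by simp
    then show False using H_acyclic by blast
  qed
  from support_reaches_unbalanced[OF fin_copies a this] obtain w v where
    w: "hwalk (pdst a) w v" "bal (copies E \<tau> \<theta>) (ctail ta) (chead he \<tau>) (dev x \<phi>) v \<noteq> 0" by blast
  have "snd v \<le> \<theta>" using hwalk_le[OF w(1)] H_times[OF a] by blast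
  then have "snd v \<le> 0 \<or> fst v \<in> {s0, t0}"
    using dev_bal[of "fst v" "snd v"] w(2) by (cases "1 \<le> snd v") auto
  then show ?thesis using w(1) by blast
qed

text \<open>
  A copy in \<open>H\<close> is real if its source is not beyond the horizon and its target is not before it. Only
  the first source and the last target of a walk can violate this.
\<close>

lemma hwalk_reverse:
  assumes "hwalk p w q" "snd p \<le> \<theta>" "1 \<le> snd q"
  shows "awalk (N q) (rev (map orev w)) (N p)" "\<forall>a\<in>set w. fst a \<in> real_copies E \<tau> \<theta>"
proof -
  have *: "\<forall>a\<in>set w. fst a \<in> real_copies E \<tau> \<theta> \<and> orev a \<in> A"
    using assms
  proof (induction w arbitrary: p)
    case (Cons a w)
    then have a: "a \<in> H" "p = psrc a" "hwalk (pdst a) w q" by auto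
    have "1 \<le> snd (pdst a)"
    proof (cases w)
      case (Cons b v)
      then have "b \<in> H" "psrc b = pdst a" using a(3) by auto
      then show ?thesis using H_times(1)[of b] by simp
    qed (use a(3) Cons.prems(3) in simp)
    then show ?case using H_real[OF a(1)] Cons.IH[OF a(3)] H_times[OF a(1)] Cons.prems(2,3) a(2) by auto
  qed simp
  then show "\<forall>a\<in>set w. fst a \<in> real_copies E \<tau> \<theta>" by blast
  have "pwalk A q (rev (map orev w)) p"
    by (rule dwalk_orev[OF assms(1)]) (use * in blast)
  then show "awalk (N q) (rev (map orev w)) (N p)" by (rule walk_gnode)
qed

subsection \<open>Components and drift\<close>

text \<open>
  The potentials of this and the next lemma bound how far a walk can drift into the past: by \<open>T\<close>
  in total as long as it stays outside the two components, or uses only arcs of cost 0. They exist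
  since closed residual walks of these kinds do not run back in time.
\<close>

lemma outside_potential:
  "\<exists>\<pi>. (\<forall>v. - T \<le> \<pi> v \<and> \<pi> v \<le> 0) \<and>
    (\<forall>a\<in>R. osrc ta he a \<notin> S \<union> Q \<longrightarrow> odst ta he a \<notin> S \<union> Q \<longrightarrow>
      \<pi> (odst ta he a) \<le> \<pi> (osrc ta he a) + owt \<tau> a)"
proof -
  let ?B = "{a \<in> R. osrc ta he a \<notin> S \<union> Q \<and> odst ta he a \<notin> S \<union> Q}"
  have "0 \<le> wt (owt \<tau>) w" if w: "dwalk ta he ?B p w p" for p w
  proof (cases w)
    case (Cons a v)
    then have "p \<notin> S \<union> Q" using w by auto
    moreover have "dwalk ta he R p w p" by (rule owalk_mono[OF w]) (use owalk_set[OF w] in blast)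
    ultimately show ?thesis using closed_walk_outside by blast
  qed simp
  moreover have "fst ` ?B \<subseteq> E" using R_E by blast
  ultimately obtain \<pi> where "\<forall>v. - T \<le> \<pi> v \<and> \<pi> v \<le> 0" "\<forall>a\<in>?B. \<pi> (odst ta he a) \<le> \<pi> (osrc ta he a) + owt \<tau> a"
    using potential_exists[where B = ?B and c = \<tau> and E = E and ta = ta and he = he] fin unfolding T_abs by meson
  then show ?thesis by (intro exI[of _ \<pi>]) blast
qed

lemma cost_free_potential:
  "\<exists>\<pi>. (\<forall>v. - T \<le> \<pi> v \<and> \<pi> v \<le> 0) \<and>
    (\<forall>a\<in>R. c (fst a) = 0 \<longrightarrow> \<pi> (odst ta he a) \<le> \<pi> (osrc ta he a) + owt \<tau> a)"
proof -
  let ?B = "{a \<in> R. c (fst a) = 0}"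
  have "0 \<le> wt (owt \<tau>) w" if w: "dwalk ta he ?B p w p" for p w
  proof -
    have R: "dwalk ta he R p w p" by (rule owalk_mono[OF w]) (use owalk_set[OF w] in blast)
    have "wt (owt c) w = wt (\<lambda>_. 0) w" by (rule wt_cong) (use owalk_set[OF w] in \<open>auto simp: owt_def\<close>)
    also have "\<dots> = 0" by (induction w) auto
    finally have c0: "wt (owt c) w = 0" .
    show ?thesis
    proof (cases "p \<in> S \<union> Q")
      case True
      then show ?thesis using closed_walk_in_component(2)[OF R True] c0 by linarith
    next
      case False
      then show ?thesis by (rule closed_walk_outside(1)[OF R])
    qed
  qed
  moreover have "fst ` ?B \<subseteq> E" using R_E by blast
  ultimately obtain \<pi> where "\<forall>v. - T \<le> \<pi> v \<and> \<pi> v \<le> 0" "\<forall>a\<in>?B. \<pi> (odst ta he a) \<le> \<pi> (osrc ta he a) + owt \<tau> a"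
    using potential_exists[where B = ?B and c = \<tau> and E = E and ta = ta and he = he] fin unfolding T_abs by meson
  then show ?thesis by (intro exI[of _ \<pi>]) blast
qed

text \<open>
  Outside the two components a walk of \<open>H\<close> that starts late stays late, so it cannot end in the
  past; it must have entered one of the components.
\<close>

lemma hwalk_outside:
  assumes w: "hwalk n w q" and out: "\<And>m v. hwalk n v m \<Longrightarrow> fst m \<notin> S \<union> Q"
  shows "snd n - T \<le> snd q"
proof -
  obtain \<pi> where \<pi>: "\<And>v. - T \<le> \<pi> v \<and> \<pi> v \<le> 0"
    "\<And>a. a \<in> R \<Longrightarrow> osrc ta he a \<notin> S \<union> Q \<Longrightarrow> odst ta he a \<notin> S \<union> Q \<Longrightarrow>
      \<pi> (odst ta he a) \<le> \<pi> (osrc ta he a) + owt \<tau> a"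
    using outside_potential by auto
  let ?P = "\<lambda>m. (\<exists>v. hwalk n v m) \<and> snd n + \<pi> (fst m) - \<pi> (fst n) \<le> snd m"
  have "?P q"
  proof (rule owalk_invariant[where P = ?P, OF w])
    show "?P n" by (auto intro: exI[of _ "[]"])
  next
    fix a assume a: "a \<in> set w" "?P (psrc a)"
    then have H: "a \<in> H" using owalk_set[OF w] by blast
    obtain v where v0: "hwalk n v (psrc a)" using a by blast
    have v: "hwalk n (v @ [a]) (pdst a)" by (rule owalk_snoc[OF v0 H])
    have "fst (psrc a) \<notin> S \<union> Q" "fst (pdst a) \<notin> S \<union> Q" using out[OF v0] out[OF v] by blast+
    then have "\<pi> (odst ta he (proj a)) \<le> \<pi> (osrc ta he (proj a)) + owt \<tau> (proj a)"
      using \<pi>(2)[OF H_R[OF H]] by simp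
    then have "snd n + \<pi> (fst (pdst a)) - \<pi> (fst n) \<le> snd (pdst a)"
      using a(2) snd_odst[of he \<tau> ta a] by simp
    then show "?P (pdst a)" using v by blast
  qed
  then show ?thesis using \<pi>(1)[of "fst q"] \<pi>(1)[of "fst n"] by linarith
qed

text \<open>
  After leaving \<open>S\<close> a walk of \<open>H\<close> can neither return, nor enter \<open>Q\<close>, as \<open>t0\<close> cannot be reached from
  \<open>s0\<close> in \<open>R\<close>. So it ends in the past without having drifted by more than \<open>T\<close>.
\<close>

lemma leave_S:
  assumes a: "a \<in> H" "fst (psrc a) \<in> S" "fst (pdst a) \<notin> S"
  shows "snd (pdst a) \<le> T"
proof -
  obtain w q where w: "hwalk (pdst a) w q" "snd q \<le> 0 \<or> fst q \<in> {s0, t0}"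
    using H_forward[OF a(1)] by blast
  have s0: "dconn ta he R s0 (fst (psrc a))" using a(2) by (simp add: scomp_def)
  have ad: "dconn ta he R (fst (psrc a)) (fst (pdst a))" using dconn_arc[OF H_R[OF a(1)]] by simp
  have out: "fst m \<notin> S \<union> Q" if m: "hwalk (pdst a) v m" for v m
  proof -
    have "fst m \<notin> S" using scomp_between[OF ad hwalk_R[OF m] a(2)] a(3) by blast
    moreover have "fst m \<notin> Q"
    proof
      assume "fst m \<in> Q"
      then have "dconn ta he R (fst m) t0" by (simp add: scomp_def)
      then show False using no_st s0 ad hwalk_R[OF m] by (blast intro: dconn_trans)
    qed
    ultimately show ?thesis by blast
  qed
  have "snd q \<le> 0" using w out[OF w(1)] by auto
  moreover have "snd (pdst a) - T \<le> snd q" by (rule hwalk_outside[OF w(1)]) (rule out)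
  ultimately show ?thesis by simp
qed

subsection \<open>Replacing a late supply by the terminal\<close>

lemma comp_walk:
  assumes w: "dwalk ta he R p w q" and pq: "p \<in> scomp ta he R r" "q \<in> scomp ta he R r"
  shows "dwalk ta he {a \<in> R. osrc ta he a \<in> scomp ta he R r \<and> odst ta he a \<in> scomp ta he R r} p w q"
proof (rule owalk_mono[OF w], rule subsetI)
  fix a assume a: "a \<in> set w"
  note * = dconn_walk_arc[OF w a]
  have "dconn ta he R (osrc ta he a) q" "dconn ta he R p (odst ta he a)"
    using * dconn_arc[OF *(3), of ta he] by (blast intro: dconn_trans)+
  then show "a \<in> {a \<in> R. osrc ta he a \<in> scomp ta he R r \<and> odst ta he a \<in> scomp ta he R r}"
    using * scomp_between[OF *(1) _ pq] scomp_between[OF _ *(2) pq] by blast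
qed

text \<open>
  If the terminal \<open>r\<close> cannot be reached backwards from \<open>b\<close> by the admissible steps \<open>St\<close>, then too
  many units of deviation are trapped: \<open>2 T M + 1\<close> of them enter a set \<open>U2\<close> of balanced nodes, one in
  each of as many time windows of length \<open>3 T\<close> above \<open>\<zeta> + 2 T\<close>, while at most \<open>2 T M\<close> can leave it.
  The assumption \<open>stay\<close> keeps \<open>H\<close> inside the component of \<open>r\<close> after time \<open>\<zeta>\<close>; the bound \<open>hi < d\<close> keeps
  the windows outside the interior.
\<close>

lemma descent:
  assumes r: "r \<in> {s0, t0}" and T: "1 \<le> T" and \<zeta>: "0 \<le> \<zeta>"
    and hi: "hi = \<zeta> + 2 * T + 3 * T * (2 * T * M + 1)" "hi < d" "hi \<le> Y"
    and stay: "\<And>a w m. a \<in> H \<Longrightarrow> fst (psrc a) \<in> scomp ta he R r \<Longrightarrow> fst (pdst a) \<notin> scomp ta he R r \<Longrightarrow>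
      \<zeta> < snd (pdst a) \<Longrightarrow> fst m \<in> scomp ta he R r \<Longrightarrow> snd m \<le> Y \<Longrightarrow> hwalk m w (psrc a) \<Longrightarrow> False"
    and b: "fst b \<in> scomp ta he R r" "hi < snd b" "snd b \<le> Y" "snd b \<le> \<theta>"
    and past: "hwalk b w0 q0" "snd q0 \<le> 0"
  shows "\<exists>w. awalk (r, 0) w (N b) \<and> (\<forall>v. dwalk ta he R r v (fst b) \<longrightarrow> cost w \<le> wt (owt c) v) \<and>
    (\<forall>a\<in>set w. inner \<tau> \<theta> d (fst a) \<longrightarrow> orev a \<in> H)"
proof -
  let ?C = "scomp ta he R r"
  let ?RC = "{a \<in> R. osrc ta he a \<in> ?C \<and> odst ta he a \<in> ?C}"
  define L where "L = 2 * T * M + 1"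
  have L: "1 \<le> L" using T M_nonneg unfolding L_def by (simp add: mult_nonneg_nonneg)
  have TL: "0 \<le> T * L" using T L by (intro mult_nonneg_nonneg) auto
  have r_C: "r \<in> ?C" by simp
  have C_SQ: "?C \<subseteq> S \<union> Q" using r by auto
  have nonneg: "0 \<le> wt (owt c) w" if w: "dwalk ta he ?RC p w p" for p w
  proof (cases w)
    case (Cons a v)
    then have "p \<in> S \<union> Q" using w C_SQ by auto
    moreover have "dwalk ta he R p w p" by (rule owalk_mono[OF w]) (use owalk_set[OF w] in blast)
    ultimately show ?thesis using closed_walk_in_component by blast
  qed simp
  have "\<exists>y. (\<forall>v. (\<exists>w. dwalk ta he ?RC r w v) \<longrightarrow> (\<exists>w. dwalk ta he ?RC r w v \<and> distinct w \<and> wt (owt c) w = y v)) \<and>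
      (\<forall>v w. dwalk ta he ?RC r w v \<longrightarrow> y v \<le> wt (owt c) w)"
  proof (rule distance_exists[where E = E])
    show "fst ` ?RC \<subseteq> E" using R_E by blast
  qed (fact fin, rule nonneg)
  then obtain y where y: "\<forall>v. (\<exists>w. dwalk ta he ?RC r w v) \<longrightarrow> (\<exists>w. dwalk ta he ?RC r w v \<and> distinct w \<and> wt (owt c) w = y v)"
    "\<forall>v w. dwalk ta he ?RC r w v \<longrightarrow> y v \<le> wt (owt c) w" by (elim exE conjE)
  have y_att: "\<exists>w. dwalk ta he ?RC r w v \<and> distinct w \<and> wt (owt c) w = y v" if "\<exists>w. dwalk ta he ?RC r w v" for v
    by (rule mp[OF spec[OF y(1)] that])
  have y_le: "y v \<le> wt (owt c) w" if "dwalk ta he ?RC r w v" for v w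
    by (rule mp[OF spec[OF spec[OF y(2)]] that])
  have reach: "\<exists>w. dwalk ta he ?RC r w v" if "v \<in> ?C" for v
    using comp_walk[OF _ r_C that] that unfolding scomp_def dconn_def by blast
  have y_r: "y r = 0"
  proof (rule antisym)
    show "y r \<le> 0" using y_le[of "[]" r] by simp
    obtain w where w: "dwalk ta he ?RC r w r" "wt (owt c) w = y r" using y_att[OF reach[OF r_C]] by blast
    show "0 \<le> y r" using nonneg[OF w(1)] w(2) by simp
  qed
  have y_step: "y (odst ta he a) \<le> y (osrc ta he a) + owt c a" if "a \<in> ?RC" for a
  proof -
    have "osrc ta he a \<in> ?C" using that by blast
    from y_att[OF reach[OF this]] obtain w where
      w: "dwalk ta he ?RC r w (osrc ta he a)" "wt (owt c) w = y (osrc ta he a)" by blast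
    show ?thesis using y_le[OF owalk_snoc[OF w(1) that]] w(2) by simp
  qed
  \<comment> \<open>The function \<open>y\<close> is the cost distance from \<open>r\<close> in its component; cheapest walks consist of tight arcs.\<close>
  define tight where "tight a \<longleftrightarrow> a \<in> ?RC \<and> y (odst ta he a) = y (osrc ta he a) + owt c a" for a
  have tight_walk: "\<exists>w. dwalk ta he {a. tight a} r w v \<and> distinct w" if v: "v \<in> ?C" for v
  proof -
    obtain w where w: "dwalk ta he ?RC r w v" "distinct w" "wt (owt c) w = y v"
      using y_att[OF reach[OF v]] by blast
    have "tight a" if a: "a \<in> set w" for a
    proof -
      obtain w1 w2 where s: "w = w1 @ a # w2" "dwalk ta he ?RC r w1 (osrc ta he a)"
        "dwalk ta he ?RC (odst ta he a) w2 v"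
        using owalk_arc[OF w(1) a] by blast
      have "a \<in> ?RC" using owalk_set[OF w(1)] a by blast
      moreover have "y v \<le> y (odst ta he a) + wt (owt c) w2"
        by (rule owalk_potential[OF s(3)]) (rule y_step)
      moreover have "y (osrc ta he a) \<le> wt (owt c) w1" by (rule y_le[OF s(2)])
      moreover have "y (odst ta he a) \<le> y (osrc ta he a) + owt c a" by (rule y_step) fact
      moreover have "y v = wt (owt c) w1 + owt c a + wt (owt c) w2" using w(3) s(1) by simp
      ultimately show ?thesis unfolding tight_def by linarith
    qed
    then have "set w \<subseteq> {a. tight a}" by blast
    then show ?thesis using owalk_mono[OF w(1)] w(2) by blast
  qed
  \<comment> \<open>These steps cost at most the increase of \<open>y\<close>, so a walk of them from \<open>r\<close> to \<open>b\<close> costs at most \<open>y (fst b)\<close>.\<close>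
  define St where "St = {a \<in> A. osrc ta he (proj a) \<in> ?C \<and> odst ta he (proj a) \<in> ?C \<and>
    (orev a \<in> H \<or> tight (proj a) \<and> \<not> inner \<tau> \<theta> d (fst a))}"
  have St_cost: "- y (odst ta he (proj a)) \<le> - y (osrc ta he (proj a)) + (- owt c (proj a))" if a: "a \<in> St" for a
  proof (cases "orev a \<in> H")
    case True
    then have "orev (proj a) \<in> ?RC" using H_R[OF True] a by (simp add: St_def)
    from y_step[OF this] show ?thesis by simp
  qed (use a in \<open>auto simp: St_def tight_def\<close>)
  define U where "U = {n. \<exists>w. pwalk St n w b}"
  have U_step: "psrc a \<in> U" if a: "a \<in> St" "pdst a \<in> U" for a
  proof -
    obtain w where "pwalk St (pdst a) w b" using a(2) U_def by blast
    then have "pwalk St (psrc a) (a # w) b" using a(1) by simp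
    then show ?thesis unfolding U_def by blast
  qed
  have rev_St: "orev a \<in> St" if a: "a \<in> H" "snd (psrc a) \<le> \<theta>" "1 \<le> snd (pdst a)"
    "fst (psrc a) \<in> ?C" "fst (pdst a) \<in> ?C" for a
    using H_real(2)[OF a(1-3)] a unfolding St_def by simp
  show ?thesis
  proof (cases "\<exists>i. (r, i) \<in> U")
    case True
    then obtain i w where w: "pwalk St (r, i) w b" unfolding U_def by blast
    have St: "set w \<subseteq> St" by (rule owalk_set[OF w])
    have "pwalk A (r, i) w b"
      by (rule owalk_mono[OF w]) (use St St_def in blast)
    then have 1: "awalk (r, 0) w (N b)" using walk_gnode[of "ctail ta" "chead he \<tau>" A "(r, i)" w b s0 t0] r
      by (auto simp: gnode_def)
    have "- y (fst b) \<le> - y (fst (r, i)) + wt (\<lambda>a. - owt c (proj a)) w"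
      by (rule owalk_potential[OF w, of "\<lambda>n. - y (fst n)"]) (use St_cost in simp)
    then have "cost w \<le> y (fst b)" using y_r by (simp add: wt_uminus wt_proj wt_map o_def)
    moreover have "y (fst b) \<le> wt (owt c) v" if "dwalk ta he R r v (fst b)" for v
      by (rule y_le[OF comp_walk[OF that r_C b(1)]])
    ultimately have 2: "cost w \<le> wt (owt c) v" if "dwalk ta he R r v (fst b)" for v
      using that by fastforce
    show ?thesis using 1 2 St by (intro exI[of _ w]) (auto simp: St_def)
  next
    case False
    \<comment> \<open>The windows lie around the levels \<open>lev l\<close>, all of them above \<open>z\<close>.\<close>
    define z where "z = \<zeta> + 2 * T"
    define lev where "lev l = \<zeta> + 4 * T + 3 * T * l" for l
    have lev_top: "lev l + T \<le> hi" if "l < L" for l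
    proof -
      have "T * (l + 1) \<le> T * L" using that T by (intro mult_left_mono) auto
      then show ?thesis unfolding lev_def hi(1) L_def[symmetric] by (simp add: algebra_simps)
    qed
    have lev_z: "z \<le> lev l - 2 * T" if "0 \<le> l" for l
      using T that by (simp add: lev_def z_def)
    have top_\<theta>: "hi < \<theta>" using b by simp
    \<comment> \<open>The walk from \<open>b\<close> into the past visits every level, at a node from which \<open>b\<close> can be reached.\<close>
    have hit: "\<exists>p\<in>U. fst p \<in> ?C \<and> lev l - T < snd p \<and> snd p \<le> lev l" if l: "0 \<le> l" "l < L" for l
    proof -
      let ?G = "\<exists>p\<in>U. fst p \<in> ?C \<and> lev l - T < snd p \<and> snd p \<le> lev l"
      let ?P = "\<lambda>m. ?G \<or> (m \<in> U \<and> fst m \<in> ?C \<and> lev l < snd m \<and> snd m \<le> \<theta> \<and> (\<exists>w. hwalk b w m))"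
      have lev_pos: "\<zeta> + T < lev l - T" using lev_z[OF l(1)] T by (simp add: z_def)
      have "?P q0"
      proof (rule owalk_invariant[where P = ?P, OF past(1)])
        have "b \<in> U" unfolding U_def by (auto intro: exI[of _ "[]"])
        moreover have "lev l < snd b" using lev_top[OF l(2)] T b by simp
        moreover have "\<exists>w. hwalk b w b" by (rule exI[of _ "[]"]) simp
        ultimately show "?P b" using b by blast
      next
        fix a assume a: "a \<in> set w0" and P: "?P (psrc a)"
        have H: "a \<in> H" using owalk_set[OF past(1)] a by blast
        show "?P (pdst a)"
        proof (rule disjCI)
          assume noG: "\<not> (pdst a \<in> U \<and> fst (pdst a) \<in> ?C \<and> lev l < snd (pdst a) \<and> snd (pdst a) \<le> \<theta> \<and> (\<exists>w. hwalk b w (pdst a)))"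
          show ?G
          proof (rule ccontr)
            assume G: "\<not> ?G"
            then obtain w where src: "psrc a \<in> U" "fst (psrc a) \<in> ?C" "lev l < snd (psrc a)" "snd (psrc a) \<le> \<theta>"
              "hwalk b w (psrc a)" using P by blast
            have low: "lev l - T < snd (pdst a)" using H_step[OF H] src(3) by linarith
            then have dst: "fst (pdst a) \<in> ?C"
              using stay[OF H src(2) _ _ b(1) b(3) src(5)] lev_pos \<zeta> T by force
            have "orev a \<in> St" using rev_St[OF H src(4) _ src(2) dst] low lev_pos \<zeta> T by simp
            then have U: "pdst a \<in> U" using U_step[of "orev a"] src(1) by simp
            have "\<exists>w. hwalk b w (pdst a)" using owalk_snoc[OF src(5) H] by blast
            then have "snd (pdst a) \<le> lev l" using noG U dst H_times(2)[OF H] by force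
            then show False using G U dst low by blast
          qed
        qed
      qed
      then show ?thesis using past(2) lev_pos \<zeta> T by auto
    qed
    \<comment> \<open>A tight walk from \<open>r\<close> to that node enters \<open>U\<close> by a copy that is no step, so it is not residual.\<close>
    have "\<exists>a. a \<in> H \<and> psrc a \<notin> U \<and> pdst a \<in> U \<and> fst (pdst a) \<in> ?C \<and>
        lev l - 2 * T < snd (pdst a) \<and> snd (pdst a) \<le> lev l + T" if l: "0 \<le> l" "l < L" for l
    proof -
      obtain p where p: "p \<in> U" "fst p \<in> ?C" "lev l - T < snd p" "snd p \<le> lev l"
        using hit[OF l] by blast
      obtain v where v: "dwalk ta he {a. tight a} r v (fst p)" "distinct v"
        using tight_walk[OF p(2)] by blast
      obtain W where W: "pwalk {a. proj a \<in> {a. tight a}} (r, snd p - wt (owt \<tau>) v) W p"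
        "map proj W = v"
        using walk_lift[OF v(1), of \<tau> "snd p - wt (owt \<tau>) v"] by auto
      obtain V a V' where a: "W = V @ a # V'" "psrc a \<notin> U" "pdst a \<in> U" "tight (proj a)"
        "pwalk {a. proj a \<in> {a. tight a}} (pdst a) V' p"
        using owalk_enter[OF W(1), of U] False p(1) by blast
      have aR: "proj a \<in> R" "osrc ta he (proj a) \<in> ?C" "odst ta he (proj a) \<in> ?C"
        using a(4) by (auto simp: tight_def)
      have sub: "fst ` set v \<subseteq> E" using owalk_set[OF v(1)] R_E by (auto simp: tight_def)
      have suffix: "\<bar>wt (owt \<tau>) x\<bar> \<le> T" if "v = x' @ x" for x x'
        using distinct_wt_bound[of x E \<tau>] that v(2) sub fin unfolding T_abs by auto
      have vs: "v = map proj V @ proj a # map proj V'" using W(2) a(1) by simp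
      then have "\<bar>wt (owt \<tau>) (map proj V')\<bar> \<le> T" by (intro suffix[of "map proj V @ [proj a]"]) simp
      moreover have "\<bar>wt (owt \<tau>) (proj a # map proj V')\<bar> \<le> T" by (rule suffix[OF vs])
      moreover have "snd p = snd (pdst a) + wt (owt \<tau>) (map proj V')"
        by (rule walk_proj(2)[OF a(5), of "{a. tight a}"]) auto
      ultimately have times: "snd p - T \<le> snd (pdst a)" "snd (pdst a) \<le> snd p + T"
        "snd p - T \<le> snd (psrc a)" "snd (psrc a) \<le> snd p + T"
        using snd_odst[of he \<tau> ta a] by simp_all
      have win: "1 \<le> lev l - 2 * T + 1" using lev_z[OF l(1)] T \<zeta> by (simp add: z_def)
      have lv: "lev l + T < d" "lev l + T < \<theta>" using lev_top[OF l(2)] hi(2) top_\<theta> by auto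
      have "fst (fst a) \<in> E" using R_E(1)[OF aR(1)] by simp
      then have real: "fst a \<in> real_copies E \<tau> \<theta>"
        using real_copy_iff[of a] times p(3,4) win lv by simp
      have "snd (fst a) = snd (psrc a) \<or> snd (fst a) = snd (pdst a)"
        by (auto simp: osrc_def ctail_def)
      then have "\<not> inner \<tau> \<theta> d (fst a)" using times p(4) lv by (auto simp: inner_def)
      then have "a \<notin> A" using U_step[of a] a aR by (auto simp: St_def)
      then have "a \<in> H" by (rule nonresidual_copy_in_H[OF aR(1) real])
      then show ?thesis using a times p aR by (intro exI[of _ a]) simp
    qed
    then have "\<forall>l\<in>{0..<L}. \<exists>a. a \<in> H \<and> psrc a \<notin> U \<and> pdst a \<in> U \<and> fst (pdst a) \<in> ?C \<and>
        lev l - 2 * T < snd (pdst a) \<and> snd (pdst a) \<le> lev l + T" by simp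
    from bchoice[OF this] obtain al where al: "\<And>l. l \<in> {0..<L} \<Longrightarrow> al l \<in> H \<and> psrc (al l) \<notin> U \<and>
        pdst (al l) \<in> U \<and> fst (pdst (al l)) \<in> ?C \<and>
        lev l - 2 * T < snd (pdst (al l)) \<and> snd (pdst (al l)) \<le> lev l + T" by blast
    \<comment> \<open>The windows are disjoint.\<close>
    have inj: "inj_on al {0..<L}"
    proof -
      have "al l \<noteq> al l'" if "l < l'" "l \<in> {0..<L}" "l' \<in> {0..<L}" for l l'
      proof -
        have "T * (l + 1) \<le> T * l'" using that T by (intro mult_left_mono) auto
        then have "lev l + T \<le> lev l' - 2 * T" unfolding lev_def by (simp add: algebra_simps)
        then show ?thesis using al[OF that(2)] al[OF that(3)] by force
      qed
      then show ?thesis unfolding inj_on_def by (metis linorder_neqE)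
    qed
    \<comment> \<open>Follow \<open>H\<close> from the heads of these arcs, but not through arcs of nonzero cost whose target is not after \<open>z\<close>.\<close>
    define Hc where "Hc = {a \<in> H. c (fst (fst a)) = 0 \<or> z < snd (pdst a)}"
    define U2 where "U2 = {n. \<exists>l\<in>{0..<L}. \<exists>w. pwalk Hc (pdst (al l)) w n}"
    obtain \<pi> where \<pi>: "\<And>v. - T \<le> \<pi> v \<and> \<pi> v \<le> 0"
      "\<And>a. a \<in> R \<Longrightarrow> c (fst a) = 0 \<Longrightarrow> \<pi> (odst ta he a) \<le> \<pi> (osrc ta he a) + owt \<tau> a"
      using cost_free_potential by blast
    let ?I = "\<lambda>n. n \<in> U \<and> fst n \<in> ?C \<and> z + 1 + \<pi> (fst n) \<le> snd n \<and> snd n \<le> \<theta> \<and>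
      (\<exists>m w. fst m \<in> ?C \<and> snd m \<le> Y \<and> hwalk m w n)"
    \<comment> \<open>As long as the walk uses arcs of cost 0, it drifts by at most \<open>T\<close> below \<open>z\<close>.\<close>
    have inv: "?I n" if n: "n \<in> U2" for n
    proof -
      obtain l w where l: "l \<in> {0..<L}" and w: "pwalk Hc (pdst (al l)) w n"
        using n unfolding U2_def by blast
      show "?I n"
      proof (rule owalk_invariant[where P = ?I, OF w])
        have "lev l + T \<le> hi" "z \<le> lev l - 2 * T" using lev_top lev_z l by auto
        then have "z + 1 + \<pi> (fst (pdst (al l))) \<le> snd (pdst (al l))" "snd (pdst (al l)) \<le> \<theta>" "snd (pdst (al l)) \<le> Y"
          using al[OF l] \<pi>(1)[of "fst (pdst (al l))"] hi(3) top_\<theta> by linarith+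
        moreover have "hwalk (pdst (al l)) [] (pdst (al l))" by simp
        ultimately show "?I (pdst (al l))" using al[OF l] by blast
      next
        fix a assume a: "a \<in> set w" and I: "?I (psrc a)"
        have Hc: "a \<in> Hc" using owalk_set[OF w] a by blast
        then have H: "a \<in> H" by (simp add: Hc_def)
        obtain m v where m: "fst m \<in> ?C" "snd m \<le> Y" "hwalk m v (psrc a)" using I by blast
        have late: "z + 1 + \<pi> (fst (pdst a)) \<le> snd (pdst a)"
        proof (cases "c (fst (fst a)) = 0")
          case True
          then have "\<pi> (fst (pdst a)) \<le> \<pi> (fst (psrc a)) + owt \<tau> (proj a)"
            using \<pi>(2)[OF H_R[OF H]] by simp
          then show ?thesis using I snd_odst[of he \<tau> ta a] by simp
        next
          case False
          then show ?thesis using Hc \<pi>(1)[of "fst (pdst a)"] by (simp add: Hc_def)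
        qed
        then have pos: "\<zeta> < snd (pdst a)" using \<pi>(1)[of "fst (pdst a)"] T by (simp add: z_def)
        have C: "fst (pdst a) \<in> ?C" using stay[OF H _ _ pos m] I by blast
        have "orev a \<in> St" using rev_St[OF H _ _ _ C] pos \<zeta> I by simp
        then have "pdst a \<in> U" using U_step[of "orev a"] I by simp
        then show "?I (pdst a)" using C late H_times(2)[OF H] m owalk_snoc[OF m(3) H] by blast
      qed
    qed
    have bal: "bal (copies E \<tau> \<theta>) (ctail ta) (chead he \<tau>) (dev x \<phi>) n = 0" if n: "n \<in> U2" for n
    proof -
      have I: "?I n" by (rule inv[OF n])
      have "fst n \<noteq> r" using I False by (metis prod.collapse)
      then have "fst n \<noteq> s0" "fst n \<noteq> t0" using I r t0_S s0_Q by auto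
      moreover have "1 \<le> snd n" using I \<pi>(1)[of "fst n"] T \<zeta> by (auto simp: z_def)
      ultimately show ?thesis using dev_bal[of "fst n" "snd n"] I by simp
    qed
    let ?out = "{a \<in> H. psrc a \<in> U2 \<and> pdst a \<notin> U2}" and ?in = "{a \<in> H. psrc a \<notin> U2 \<and> pdst a \<in> U2}"
    have finH: "finite H"
      by (rule finite_subset[of _ "copies E \<tau> \<theta> \<times> UNIV"]) (use fin_copies in \<open>auto simp: osupp_def\<close>)
    have "L = (\<Sum>l\<in>{0..<L}. 1)" using L by simp
    also have "\<dots> \<le> (\<Sum>l\<in>{0..<L}. owt (dev x \<phi>) (al l))"
    proof (rule sum_mono)
      fix l assume "l \<in> {0..<L}"
      then have "al l \<in> H" using al by blast
      then show "1 \<le> owt (dev x \<phi>) (al l)" by (simp add: osupp_def)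
    qed
    also have "\<dots> = (\<Sum>a\<in>al ` {0..<L}. owt (dev x \<phi>) a)" by (simp add: sum.reindex[OF inj])
    also have "\<dots> \<le> (\<Sum>a\<in>?in. owt (dev x \<phi>) a)"
    proof (rule sum_mono2)
      have "pdst (al l) \<in> U2" if "l \<in> {0..<L}" for l
        unfolding U2_def using that by (auto intro!: bexI[of _ l] exI[of _ "[]"])
      moreover have "n \<notin> U2" if "n \<notin> U" for n using inv that by blast
      ultimately show "al ` {0..<L} \<subseteq> ?in" using al by blast
      show "finite ?in" by (rule finite_subset[OF _ finH]) blast
      show "0 \<le> owt (dev x \<phi>) a" if "a \<in> ?in - al ` {0..<L}" for a
        using that by (auto simp: osupp_def)
    qed
    also have "\<dots> = (\<Sum>a\<in>?out. owt (dev x \<phi>) a)"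
      by (rule balanced_cut[OF fin_copies, symmetric]) (rule bal)
    \<comment> \<open>Only arcs of nonzero cost leave, at \<open>2 T\<close> different times; their capacities sum up to at most \<open>M\<close>.\<close>
    also have "\<dots> \<le> 2 * T * M"
    proof -
      let ?K = "{z + 1 - 2 * T..z}" and ?E = "{e \<in> E. c e \<noteq> 0}"
      have out: "c (fst (fst a)) \<noteq> 0 \<and> snd (pdst a) \<le> z \<and> z + 1 - T \<le> snd (psrc a)" if a: "a \<in> ?out" for a
      proof -
        have I: "?I (psrc a)" using inv a by blast
        have "a \<notin> Hc"
        proof
          assume Hc: "a \<in> Hc"
          obtain l w where l: "l \<in> {0..<L}" and w: "pwalk Hc (pdst (al l)) w (psrc a)"
            using a unfolding U2_def by blast
          have "pdst a \<in> U2" using l owalk_snoc[OF w Hc] unfolding U2_def by blast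
          then show False using a by blast
        qed
        then show ?thesis using a I \<pi>(1)[of "fst (psrc a)"] by (auto simp: Hc_def)
      qed
      have injf: "inj_on fst ?out"
        by (rule inj_onI, rule prod_eqI) (auto simp: osupp_def owt_def split: if_splits)
      have sub: "fst ` ?out \<subseteq> ?E \<times> ?K"
      proof
        fix e assume "e \<in> fst ` ?out"
        then obtain a where a: "a \<in> ?out" "e = fst a" by blast
        have E: "fst (fst a) \<in> E" using a H_E by blast
        then have "\<tau> (fst (fst a)) \<le> T" "0 \<le> \<tau> (fst (fst a))" using \<tau>_le_T \<tau>_nonneg by auto
        then have "snd (fst a) \<in> ?K"
          using out[OF a(1)] T by (auto simp: osrc_def ctail_def chead_def split: if_splits)
        then show "e \<in> ?E \<times> ?K" using out[OF a(1)] E a(2) by (simp add: mem_Times_iff)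
      qed
      have le: "owt (dev x \<phi>) a \<le> u (fst (fst a))" if a: "a \<in> ?out" for a
        using \<phi>_bounds[of "fst (fst a)" "snd (fst a)"] x_bounds[of "fst (fst a)"] H_E[of a] a
        by (auto simp: owt_def dev_def)
      have "(\<Sum>a\<in>?out. owt (dev x \<phi>) a) \<le> (\<Sum>a\<in>?out. u (fst (fst a)))" by (rule sum_mono) (rule le)
      also have "\<dots> = (\<Sum>e\<in>fst ` ?out. u (fst e))" by (simp add: sum.reindex[OF injf])
      also have "\<dots> \<le> (\<Sum>e\<in>?E \<times> ?K. u (fst e))"
      proof (rule sum_mono2[OF _ sub])
        show "0 \<le> u (fst e)" if "e \<in> ?E \<times> ?K - fst ` ?out" for e
          using x_bounds[of "fst e"] that by (auto simp: mem_Times_iff)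
      qed (use fin in simp)
      also have "\<dots> = (\<Sum>e\<in>?E. \<Sum>k\<in>?K. u e)"
        unfolding sum.cartesian_product by (simp add: case_prod_beta)
      also have "\<dots> = 2 * T * (\<Sum>e\<in>?E. u e)" using T by (simp add: sum_distrib_left)
      also have "(\<Sum>e\<in>?E. u e) \<le> M"
      proof -
        have "(\<Sum>e\<in>?E. u e) \<le> (\<Sum>e\<in>?E. \<bar>c e\<bar> * u e)"
        proof (rule sum_mono)
          fix e assume e: "e \<in> ?E"
          then have "1 * u e \<le> \<bar>c e\<bar> * u e" using x_bounds[of e] by (intro mult_right_mono) auto
          then show "u e \<le> \<bar>c e\<bar> * u e" by simp
        qed
        also have "\<dots> \<le> M" unfolding M_def
          by (rule sum_mono2) (use fin x_bounds in \<open>force intro: mult_nonneg_nonneg\<close>)+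
        finally show ?thesis .
      qed
      finally show ?thesis using T by simp
    qed
    finally show ?thesis unfolding L_def by simp
  qed
qed

end

section \<open>Reversing time\<close>

text \<open>
  Under reversed time, time \<open>i\<close> becomes \<open>\<theta> + 1 - i\<close>. A copy is named by the time at which it leaves its
  tail, which in the reversed network is the mirrored arrival time.
\<close>

definition rtime :: "('e \<Rightarrow> int) \<Rightarrow> int \<Rightarrow> 'e \<times> int \<Rightarrow> 'e \<times> int" where
  "rtime \<tau> \<theta> a = (fst a, \<theta> + 1 - snd a - \<tau> (fst a))"

definition ortime :: "('e \<Rightarrow> int) \<Rightarrow> int \<Rightarrow> ('e \<times> int) \<times> bool \<Rightarrow> ('e \<times> int) \<times> bool" where
  "ortime \<tau> \<theta> a = (rtime \<tau> \<theta> (fst a), snd a)"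

definition rnode :: "int \<Rightarrow> 'v \<times> int \<Rightarrow> 'v \<times> int" where
  "rnode \<theta> n = (fst n, \<theta> + 1 - snd n)"

lemma rtime_simps [simp]:
  "rtime \<tau> \<theta> (rtime \<tau> \<theta> a) = a" "fst (rtime \<tau> \<theta> a) = fst a"
  "ortime \<tau> \<theta> (ortime \<tau> \<theta> b) = b" "fst (ortime \<tau> \<theta> b) = rtime \<tau> \<theta> (fst b)"
  "snd (ortime \<tau> \<theta> b) = snd b" "orev (ortime \<tau> \<theta> b) = ortime \<tau> \<theta> (orev b)"
  "rnode \<theta> (rnode \<theta> n) = n" "fst (rnode \<theta> n) = fst n" "snd (rnode \<theta> n) = \<theta> + 1 - snd n"
  "proj (ortime \<tau> \<theta> b) = proj b"
  by (auto simp: rtime_def ortime_def orev_def rnode_def proj_def)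

lemma inner_rtime [simp]: "inner \<tau> \<theta> d (rtime \<tau> \<theta> a) = inner \<tau> \<theta> d a"
  by (auto simp: inner_def rtime_def)

lemma osrc_ortime [simp]:
  "osrc (ctail ta) (chead he \<tau>) (ortime \<tau> \<theta> b) = rnode \<theta> (odst (ctail he) (chead ta \<tau>) b)"
  "odst (ctail ta) (chead he \<tau>) (ortime \<tau> \<theta> b) = rnode \<theta> (osrc (ctail he) (chead ta \<tau>) b)"
  by (auto simp: osrc_def ctail_def chead_def rnode_def ortime_def rtime_def)

lemma walk_ortime:
  assumes w: "dwalk (ctail he) (chead ta \<tau>) B p w q" and B: "\<And>b. b \<in> B \<Longrightarrow> ortime \<tau> \<theta> b \<in> B'"
  shows "dwalk (ctail ta) (chead he \<tau>) B' (rnode \<theta> q) (rev (map (ortime \<tau> \<theta>) w)) (rnode \<theta> p)"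
proof -
  have "owalk (odst (ctail ta) (chead he \<tau>)) (osrc (ctail ta) (chead he \<tau>)) B'
      (rnode \<theta> p) (map (ortime \<tau> \<theta>) w) (rnode \<theta> q)"
    by (rule owalk_map[OF w]) (use owalk_set[OF w] B in auto)
  from owalk_rev[OF this] show ?thesis .
qed

lemma gwalk_ortime:
  assumes w: "dwalk (gnode t s \<circ> ctail he) (gnode t s \<circ> chead ta \<tau>) B p w q"
    and B: "\<And>b. b \<in> B \<Longrightarrow> ortime \<tau> \<theta> b \<in> B'"
  shows "dwalk (gnode s t \<circ> ctail ta) (gnode s t \<circ> chead he \<tau>) B'
    (gnode s t (rnode \<theta> q)) (rev (map (ortime \<tau> \<theta>) w)) (gnode s t (rnode \<theta> p))"
proof -
  have g: "gnode s t (rnode \<theta> (gnode t s n)) = gnode s t (rnode \<theta> n)" for n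
    by (auto simp: gnode_def rnode_def)
  have B': "ortime \<tau> \<theta> b \<in> B'" if "b \<in> set w" for b using owalk_set[OF w] B that by blast
  have "owalk (odst (gnode s t \<circ> ctail ta) (gnode s t \<circ> chead he \<tau>)) (osrc (gnode s t \<circ> ctail ta) (gnode s t \<circ> chead he \<tau>)) B'
      (gnode s t (rnode \<theta> p)) (map (ortime \<tau> \<theta>) w) (gnode s t (rnode \<theta> q))"
    by (rule owalk_map[where f = "\<lambda>n. gnode s t (rnode \<theta> n)" and h = "ortime \<tau> \<theta>", OF w])
      (simp only: B' osrc_comp osrc_ortime g simp_thms)
  from owalk_rev[OF this] show ?thesis .
qed

text \<open>
  All assumptions are symmetric in time once tails and heads, and the two terminals, are swapped.
  The orientation of walks turns around as well, so the future takes the place of the past.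
\<close>

lemma (in turnpike) mirror: "turnpike E he ta \<tau> c u t0 s0 x (\<lambda>a. \<phi> (rtime \<tau> \<theta> a)) \<theta> d"
proof -
  let ?\<phi> = "\<lambda>a. \<phi> (rtime \<tau> \<theta> a)"
  let ?H = "osupp (copies E \<tau> \<theta>) (dev x ?\<phi>)" and ?A = "residual (real_copies E \<tau> \<theta>) (\<lambda>a. u (fst a)) ?\<phi>"
  have real: "rtime \<tau> \<theta> a \<in> real_copies E \<tau> \<theta> \<longleftrightarrow> a \<in> real_copies E \<tau> \<theta>" for a
    by (auto simp: real_copies_def rtime_def)
  have H: "ortime \<tau> \<theta> b \<in> H \<longleftrightarrow> b \<in> ?H" for b
    by (auto simp: osupp_def copies_def rtime_def ortime_def owt_def dev_def)
  have A: "ortime \<tau> \<theta> b \<in> A \<longleftrightarrow> b \<in> ?A" for b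
    by (auto simp: residual_def real)
  have cost: "cost (rev (map (ortime \<tau> \<theta>) w)) = cost w" for w
    by (simp add: wt_map o_def wt_proj)
  show ?thesis
  proof
    show "finite E" by (rule fin)
    show "t0 \<noteq> s0" using s0_t0 by simp
    show "0 \<le> \<tau> e" if "e \<in> E" for e using \<tau>_nonneg that .
    show "\<tau> e = 0" if "e \<in> E" "he e \<in> {t0, s0} \<or> ta e \<in> {t0, s0}" for e using ground_arc that by blast
    show "0 \<le> x e \<and> x e \<le> u e" if "e \<in> E" for e using x_bounds that .
    show "bal E he ta x v = 0" if "v \<noteq> t0" "v \<noteq> s0" for v
      using x_bal[OF that(2,1)] by (simp add: bal_swap[of E he ta])
    show "0 \<le> \<phi> (rtime \<tau> \<theta> (e, k)) \<and> \<phi> (rtime \<tau> \<theta> (e, k)) \<le> u e" if "e \<in> E" for e k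
      using \<phi>_bounds[OF that] by (simp add: rtime_def)
    show "\<phi> (rtime \<tau> \<theta> a) = 0" if "a \<notin> real_copies E \<tau> \<theta>" for a using \<phi>_zero real that by blast
    show "(\<Sum>e\<in>{e \<in> E. he e = v}. \<phi> (rtime \<tau> \<theta> (e, i))) =
        (\<Sum>e\<in>{e \<in> E. ta e = v}. \<phi> (rtime \<tau> \<theta> (e, i - \<tau> e)))" if "v \<noteq> t0" "v \<noteq> s0" "1 \<le> i" "i \<le> \<theta>" for v i
    proof -
      have "\<theta> + 1 - (i - \<tau> e) - \<tau> e = \<theta> + 1 - i" for e by simp
      then show ?thesis using \<phi>_bal[of v "\<theta> + 1 - i"] that by (simp only: rtime_def fst_conv snd_conv) simp
    qed
    show "steady E he ta R \<tau> c t0 s0"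
      unfolding steady_def
    proof (intro conjI allI impI)
      show "\<not> dconn he ta R t0 s0" using no_st by (simp add: dconn_swap[of he ta])
      fix p w assume "dwalk he ta R p w p"
      then have w: "dwalk ta he R p (rev w) p" by (rule owalk_rev)
      show "if p \<in> scomp he ta R t0 \<union> scomp he ta R s0
          then 0 \<le> wt (owt c) w \<and> (wt (owt \<tau>) w < 0 \<longrightarrow> 0 < wt (owt c) w)
          else 0 \<le> wt (owt \<tau>) w \<and> (wt (owt \<tau>) w = 0 \<longrightarrow> 0 \<le> wt (owt c) w)"
        using closed_walk_in_component[OF w] closed_walk_outside[OF w] unfolding scomp_swap[of he ta] by auto
    qed
    show "\<not> dconn (gnode t0 s0 \<circ> ctail he) (gnode t0 s0 \<circ> chead ta \<tau>) ?A (t0, 0) (s0, 0)"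
    proof
      assume "dconn (gnode t0 s0 \<circ> ctail he) (gnode t0 s0 \<circ> chead ta \<tau>) ?A (t0, 0) (s0, 0)"
      then obtain w where "dwalk (gnode t0 s0 \<circ> ctail he) (gnode t0 s0 \<circ> chead ta \<tau>) ?A (t0, 0) w (s0, 0)"
        by (auto simp: dconn_def)
      from gwalk_ortime[OF this, of \<theta> A] have "awalk (s0, 0) (rev (map (ortime \<tau> \<theta>) w)) (t0, 0)"
        using A by (simp add: gnode_def rnode_def)
      from dconn_walk[OF this] show False using max_value by simp
    qed
    show "0 \<le> cost w" if "dwalk (gnode t0 s0 \<circ> ctail he) (gnode t0 s0 \<circ> chead ta \<tau>) ?A p w p" for p w
      using min_cost[OF gwalk_ortime[OF that, of \<theta> A]] A cost by simp
    show "w = []" if "dwalk (gnode t0 s0 \<circ> ctail he) (gnode t0 s0 \<circ> chead ta \<tau>) ?H p w p" for p w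
      using acyclic[OF gwalk_ortime[OF that, of \<theta> H]] H by simp
    show "\<exists>b\<in>set w. inner \<tau> \<theta> d (fst b) \<and> orev b \<notin> ?H"
      if w: "dwalk (gnode t0 s0 \<circ> ctail he) (gnode t0 s0 \<circ> chead ta \<tau>) ?A p w p" "cost w \<le> 0" "a \<in> set w"
        "inner \<tau> \<theta> d (fst a)" for p w a
    proof -
      have "awalk (N (rnode \<theta> p)) (rev (map (ortime \<tau> \<theta>) w)) (N (rnode \<theta> p))"
        by (rule gwalk_ortime[OF w(1)]) (simp add: A)
      moreover have "cost (rev (map (ortime \<tau> \<theta>) w)) \<le> 0" using w(2) cost by simp
      moreover have "ortime \<tau> \<theta> a \<in> set (rev (map (ortime \<tau> \<theta>) w))" using w(3) by simp
      moreover have "inner \<tau> \<theta> d (fst (ortime \<tau> \<theta> a))" using w(4) by simp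
      ultimately obtain b where b: "b \<in> set (rev (map (ortime \<tau> \<theta>) w))" "inner \<tau> \<theta> d (fst b)" "orev b \<notin> H"
        using no_swap by blast
      then obtain b' where b': "b' \<in> set w" "b = ortime \<tau> \<theta> b'" by auto
      then show ?thesis using b(2,3) H[of "orev b'"] by (intro bexI[OF _ b'(1)]) simp
    qed
  qed
qed

context turnpike
begin

lemma mirror_H: "b \<in> osupp (copies E \<tau> \<theta>) (dev x (\<lambda>a. \<phi> (rtime \<tau> \<theta> a))) \<longleftrightarrow> ortime \<tau> \<theta> b \<in> H"
  by (auto simp: osupp_def copies_def rtime_def ortime_def owt_def dev_def)

lemma mirror_A: "b \<in> residual (real_copies E \<tau> \<theta>) (\<lambda>a. u (fst a)) (\<lambda>a. \<phi> (rtime \<tau> \<theta> a)) \<longleftrightarrow> ortime \<tau> \<theta> b \<in> A"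
  by (auto simp: residual_def real_copies_def rtime_def)

lemma mirror_hwalk:
  "hwalk p w q \<Longrightarrow> dwalk (ctail he) (chead ta \<tau>) (osupp (copies E \<tau> \<theta>) (dev x (\<lambda>a. \<phi> (rtime \<tau> \<theta> a))))
    (rnode \<theta> q) (rev (map (ortime \<tau> \<theta>) w)) (rnode \<theta> p)"
  by (rule walk_ortime) (auto simp: mirror_H)

lemma mirror_hwalk':
  "dwalk (ctail he) (chead ta \<tau>) (osupp (copies E \<tau> \<theta>) (dev x (\<lambda>a. \<phi> (rtime \<tau> \<theta> a)))) p w q \<Longrightarrow>
    hwalk (rnode \<theta> q) (rev (map (ortime \<tau> \<theta>) w)) (rnode \<theta> p)"
  by (rule walk_ortime) (auto simp: mirror_H)

lemma mirror_awalk: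
  "dwalk (gnode t0 s0 \<circ> ctail he) (gnode t0 s0 \<circ> chead ta \<tau>)
      (residual (real_copies E \<tau> \<theta>) (\<lambda>a. u (fst a)) (\<lambda>a. \<phi> (rtime \<tau> \<theta> a))) p w q \<Longrightarrow>
    awalk (N (rnode \<theta> q)) (rev (map (ortime \<tau> \<theta>) w)) (N (rnode \<theta> p))"
  by (rule gwalk_ortime) (auto simp: mirror_A)

lemma H_backward:
  assumes a: "a \<in> H"
  shows "\<exists>w p. hwalk p w (psrc a) \<and> (\<theta> < snd p \<or> fst p \<in> {s0, t0})"
proof -
  interpret mir: turnpike E he ta \<tau> c u t0 s0 x "\<lambda>a. \<phi> (rtime \<tau> \<theta> a)" \<theta> d by (rule mirror)
  have "ortime \<tau> \<theta> a \<in> mir.H" using a by (simp add: mirror_H)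
  from mir.H_forward[OF this] obtain w q where
    "mir.hwalk (mir.pdst (ortime \<tau> \<theta> a)) w q" "snd q \<le> 0 \<or> fst q \<in> {t0, s0}" by blast
  then show ?thesis using mirror_hwalk'[of "mir.pdst (ortime \<tau> \<theta> a)" w q]
    by (intro exI[of _ "rev (map (ortime \<tau> \<theta>) w)"] exI[of _ "rnode \<theta> q"]) auto
qed

end

section \<open>The flow follows the steady state away from both ends\<close>

context turnpike
begin

text \<open>
  From time \<open>D1\<close> on, \<open>descent\<close> applies to the component of \<open>s0\<close>. For the component of \<open>t0\<close> it has to
  start above the times at which walks of \<open>H\<close> may leave \<open>Q\<close>, which leads to \<open>D2\<close>.
\<close>

definition "D1 = 3 * T + 3 * T * (2 * T * M + 1) + 1"
definition "D2 = D1 + 4 * T + 3 * T * (2 * T * M + 1) + 1"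

lemma D_bounds: "3 * T + 1 \<le> D1" "D1 + 4 * T + 1 \<le> D2"
proof -
  have "0 \<le> T * (2 * T * M + 1)" using T_nonneg M_nonneg by (intro mult_nonneg_nonneg add_nonneg_nonneg) auto
  then show "3 * T + 1 \<le> D1" "D1 + 4 * T + 1 \<le> D2" unfolding D1_def D2_def by linarith+
qed

lemma inner_times:
  assumes "inner \<tau> \<theta> d (fst a)" "fst (fst a) \<in> E"
  shows "d \<le> snd (psrc a)" "d \<le> snd (pdst a)" "snd (psrc a) \<le> \<theta> + 1 - d" "snd (pdst a) \<le> \<theta> + 1 - d"
  using assms \<tau>_nonneg[OF assms(2)] by (auto simp: inner_def osrc_def ctail_def chead_def)

text \<open>
  A walk from \<open>s0\<close> to \<open>t0\<close> would be augmenting for \<open>x\<close>, the reverse of a walk from \<open>t0\<close> to \<open>s0\<close> would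
  be augmenting for \<open>\<phi>\<close>, and between copies of the same terminal the walk is closed.
\<close>

lemma ground_to_ground:
  assumes w: "hwalk p w q" "w \<noteq> []" and p: "fst p \<in> {s0, t0}" and q: "fst q \<in> {s0, t0}"
  shows False
proof -
  have "hd w \<in> H" "psrc (hd w) = p" using w owalk_start[OF w(1)] owalk_set[OF w(1)] hd_in_set[OF w(2)] by auto
  then have tp: "snd p \<le> \<theta>" using ground_time(1) p by blast
  have "last w \<in> H" "pdst (last w) = q" using w owalk_end[OF w(1)] owalk_set[OF w(1)] last_in_set[OF w(2)] by auto
  then have tq: "1 \<le> snd q" using ground_time(2) q by blast
  have N: "N p = (fst p, 0)" "N q = (fst q, 0)" using p q by (auto simp: gnode_def)
  consider "fst p = fst q" | "fst p = s0" "fst q = t0" | "fst p = t0" "fst q = s0" using p q by auto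
  then show False
  proof cases
    case 1
    then show False using acyclic[of "N p" w] walk_gnode[OF w(1), of s0 t0] w(2) N by simp
  next
    case 2
    then show False using hwalk_R[OF w(1)] no_st by simp
  next
    case 3
    then show False using hwalk_reverse(1)[OF w(1) tp tq] max_value N by (auto simp: dconn_def)
  qed
qed

text \<open>
  The walk \<open>v\<close> and the reverse of \<open>w @ [a]\<close> form a closed residual walk of cost at most 0. It passes
  inner copies only against \<open>H\<close>, and \<open>a\<close> is one of them, which \<open>no_swap\<close> excludes.
\<close>

lemma interior_not_supplied:
  assumes a: "a \<in> H" "inner \<tau> \<theta> d (fst a)" and w: "hwalk p w (psrc a)" and r: "fst p \<in> {s0, t0}"
    and d: "1 \<le> d"
    and v: "awalk (fst p, 0) v (N (pdst a))" "\<And>v'. dwalk ta he R (fst p) v' (fst (pdst a)) \<Longrightarrow> cost v \<le> wt (owt c) v'"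
      "\<And>b. b \<in> set v \<Longrightarrow> inner \<tau> \<theta> d (fst b) \<Longrightarrow> orev b \<in> H"
  shows False
proof -
  let ?w = "w @ [a]"
  note times = inner_times[OF a(2) H_E[OF a(1)]]
  have hw: "hwalk p ?w (pdst a)" by (rule owalk_snoc[OF w a(1)])
  have "snd p \<le> \<theta>"
  proof (cases w)
    case Nil
    then show ?thesis using w times d by simp
  next
    case (Cons b w')
    then have "b \<in> H" "psrc b = p" using w by auto
    then show ?thesis using ground_time(1)[of b] r by simp
  qed
  moreover have "N p = (fst p, 0)" using r by (auto simp: gnode_def)
  ultimately have rev: "awalk (N (pdst a)) (rev (map orev ?w)) (fst p, 0)"
    using hwalk_reverse(1)[OF hw] times(2) d by simp
  let ?c = "v @ rev (map orev ?w)"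
  have closed: "awalk (fst p, 0) ?c (fst p, 0)" using v(1) rev unfolding owalk_append by blast
  have "cost v \<le> wt (owt c) (map proj ?w)" by (rule v(2)[OF walk_proj(1)[OF hw H_R']])
  then have "cost ?c \<le> 0" by (simp add: wt_proj[symmetric] rev_map[symmetric])
  moreover have "orev a \<in> set ?c" by simp
  ultimately obtain b where b: "b \<in> set ?c" "inner \<tau> \<theta> d (fst b)" "orev b \<notin> H"
    using no_swap[OF closed] a(2) by (metis orev_simps(2))
  have "b \<notin> set v" using v(3) b(2,3) by blast
  then have "b \<in> orev ` set ?w" using b(1) by simp
  then have "orev b \<in> set ?w" by auto
  then show False using owalk_set[OF hw] b(3) by blast
qed

text \<open>
  From such a node on, the walk of \<open>H\<close> does not return to \<open>Q\<close>, and stays out of \<open>S\<close> by assumption as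
  long as it is late. So it stays late by \<open>outside_potential\<close> and cannot end anywhere.
\<close>

lemma escape:
  assumes a: "a \<in> H" and n: "dconn ta he R t0 (fst (pdst a))" "fst (pdst a) \<notin> Q" "D1 + 2 * T < snd (pdst a)"
    and no_S: "\<And>w q. hwalk (pdst a) w q \<Longrightarrow> fst q \<in> S \<Longrightarrow> D1 \<le> snd q \<Longrightarrow> False"
  shows False
proof -
  let ?n = "pdst a"
  obtain w q where w: "hwalk ?n w q" "snd q \<le> 0 \<or> fst q \<in> {s0, t0}" using H_forward[OF a] by blast
  have not_Q: "fst m \<notin> Q" if m: "hwalk ?n v m" for v m
  proof
    assume "fst m \<in> Q"
    then have "fst ?n \<in> Q" using scomp_between[OF n(1) hwalk_R[OF m], of t0] by simp
    then show False using n(2) by blast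
  qed
  obtain \<pi> where \<pi>: "\<And>v. - T \<le> \<pi> v \<and> \<pi> v \<le> 0"
    "\<And>a. a \<in> R \<Longrightarrow> osrc ta he a \<notin> S \<union> Q \<Longrightarrow> odst ta he a \<notin> S \<union> Q \<Longrightarrow>
      \<pi> (odst ta he a) \<le> \<pi> (osrc ta he a) + owt \<tau> a"
    using outside_potential by auto
  let ?P = "\<lambda>m. fst m \<notin> S \<union> Q \<and> snd ?n + \<pi> (fst m) - \<pi> (fst ?n) \<le> snd m \<and> (\<exists>v. hwalk ?n v m)"
  have "?P q"
  proof (rule owalk_invariant[where P = ?P, OF w(1)])
    have nil: "hwalk ?n [] ?n" by simp
    have "D1 \<le> snd ?n" using n(3) T_nonneg by linarith
    then have "fst ?n \<notin> S" using no_S[OF nil] by blast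
    then show "?P ?n" using n(2) nil by (metis Un_iff add_diff_cancel_right' order_refl)
  next
    fix b assume b: "b \<in> set w" "?P (psrc b)"
    have H: "b \<in> H" using owalk_set[OF w(1)] b by blast
    obtain v where v: "hwalk ?n v (psrc b)" using b(2) by blast
    have v': "hwalk ?n (v @ [b]) (pdst b)" by (rule owalk_snoc[OF v H])
    have "snd ?n - T \<le> snd (psrc b)" using b(2) \<pi>(1)[of "fst (psrc b)"] \<pi>(1)[of "fst ?n"] by linarith
    then have "D1 \<le> snd (pdst b)" using H_step[OF H] n(3) by linarith
    then have "fst (pdst b) \<notin> S" using no_S[OF v'] by blast
    then have out: "fst (pdst b) \<notin> S \<union> Q" using not_Q[OF v'] by blast
    then have "\<pi> (odst ta he (proj b)) \<le> \<pi> (osrc ta he (proj b)) + owt \<tau> (proj b)"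
      using \<pi>(2)[OF H_R[OF H]] b(2) by simp
    then have "snd ?n + \<pi> (fst (pdst b)) - \<pi> (fst ?n) \<le> snd (pdst b)"
      using b(2) snd_odst[of he \<tau> ta b] by simp
    then show "?P (pdst b)" using out v' by blast
  qed
  moreover have "0 < snd ?n - T" using n(3) D_bounds(1) T_nonneg by linarith
  ultimately show False using w(2) \<pi>(1)[of "fst q"] \<pi>(1)[of "fst ?n"] by auto
qed

text \<open>
  After its last node above \<open>k\<close>, a walk outside the components would stay above \<open>k - 2 T\<close>, as it
  starts above \<open>k - T\<close> and drifts by at most \<open>T\<close>.
\<close>

lemma crossing:
  assumes w: "hwalk p w q" and p: "k < snd p" and q: "snd q \<le> k - 3 * T"
    and T: "1 \<le> T"
  shows "\<exists>w1 n w2. hwalk p w1 n \<and> hwalk n w2 q \<and> fst n \<in> S \<union> Q \<and> k - 3 * T < snd n \<and> snd n \<le> k"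
proof (rule ccontr)
  assume none: "\<not> ?thesis"
  have "w \<noteq> []" using w p q T by auto
  then have "psrc (hd w) = p" "hd w \<in> set w" using owalk_start[OF w] by auto
  then have "\<exists>a\<in>set w. k < snd (psrc a)" using p by auto
  then obtain w1 a w2 where s: "w = w1 @ a # w2" "k < snd (psrc a)" "\<forall>b\<in>set w2. \<not> k < snd (psrc b)"
    using split_list_last_prop[of w "\<lambda>a. k < snd (psrc a)"] by blast
  have H: "a \<in> H" and w1: "hwalk p w1 (psrc a)" and w2: "hwalk (pdst a) w2 q" using w s(1) by auto
  have w1': "hwalk p (w1 @ [a]) (pdst a)" by (rule owalk_snoc[OF w1 H])
  have "snd (pdst a) \<le> k"
  proof (cases "w2 = []")
    case True
    then show ?thesis using w2 q T by simp
  next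
    case False
    then have "hd w2 \<in> set w2" "psrc (hd w2) = pdst a" using owalk_start[OF w2] by auto
    then show ?thesis using s(3) by force
  qed
  moreover have low: "k - T < snd (pdst a)" using H_step[OF H] s(2) by linarith
  moreover have none': "fst m \<notin> S \<union> Q"
    if "hwalk p v m" "hwalk m v' q" "k - 3 * T < snd m" "snd m \<le> k" for m v v'
    using none that by blast
  ultimately have start: "fst (pdst a) \<notin> S \<union> Q" using none'[OF w1' w2] T by linarith
  obtain \<pi> where \<pi>: "\<And>v. - T \<le> \<pi> v \<and> \<pi> v \<le> 0"
    "\<And>a. a \<in> R \<Longrightarrow> osrc ta he a \<notin> S \<union> Q \<Longrightarrow> odst ta he a \<notin> S \<union> Q \<Longrightarrow>
      \<pi> (odst ta he a) \<le> \<pi> (osrc ta he a) + owt \<tau> a"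
    using outside_potential by auto
  let ?n = "pdst a"
  let ?P = "\<lambda>m. fst m \<notin> S \<union> Q \<and> snd ?n + \<pi> (fst m) - \<pi> (fst ?n) \<le> snd m"
  have "\<And>m v. hwalk m v q \<Longrightarrow> set v \<subseteq> set w2 \<Longrightarrow> (\<exists>v. hwalk p v m) \<Longrightarrow> ?P m \<Longrightarrow> ?P q"
  proof -
    fix m v assume "hwalk m v q" "set v \<subseteq> set w2" "\<exists>v. hwalk p v m" "?P m"
    then show "?P q"
    proof (induction v arbitrary: m)
      case Nil
      then have "m = q" by simp
      then show ?case using Nil.prems(4) by blast
    next
      case (Cons b v)
      then have b: "b \<in> H" "m = psrc b" "hwalk (pdst b) v q" "b \<in> set w2" by auto
      obtain v0 where v0: "hwalk p v0 (psrc b)" using Cons.prems b by blast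
      have v1: "hwalk p (v0 @ [b]) (pdst b)" by (rule owalk_snoc[OF v0 b(1)])
      have "snd ?n + \<pi> (fst (psrc b)) - \<pi> (fst ?n) \<le> snd (psrc b)" using Cons.prems(4) b(2) by simp
      then have "k - 2 * T < snd (psrc b)"
        using low \<pi>(1)[of "fst (psrc b)"] \<pi>(1)[of "fst ?n"] by linarith
      then have "k - 3 * T < snd (pdst b)" using H_step[OF b(1)] by linarith
      moreover have "snd (pdst b) \<le> k"
      proof (cases v)
        case Nil
        then show ?thesis using b(3) q T by simp
      next
        case (Cons b' v')
        then have "b' \<in> set w2" "psrc b' = pdst b" using b(3) Cons.prems by auto
        then show ?thesis using s(3) by auto
      qed
      ultimately have out: "fst (pdst b) \<notin> S \<union> Q" using none'[OF v1 b(3)] by blast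
      then have "\<pi> (odst ta he (proj b)) \<le> \<pi> (osrc ta he (proj b)) + owt \<tau> (proj b)"
        using \<pi>(2)[OF H_R[OF b(1)]] Cons.prems(4) b(2) by simp
      then have "?P (pdst b)" using Cons.prems(4) b(2) snd_odst[of he \<tau> ta b] out by simp
      moreover have "\<exists>v. hwalk p v (pdst b)" using v1 by blast
      moreover have "set v \<subseteq> set w2" using Cons.prems(2) by simp
      ultimately show ?case using Cons.IH[OF b(3)] by blast
    qed
  qed
  moreover have "\<exists>v. hwalk p v ?n" using w1' by blast
  moreover have "?P ?n" using start by simp
  ultimately have "?P q" using w2 subset_refl by blast
  then show False using q low \<pi>(1)[of "fst q"] \<pi>(1)[of "fst ?n"] by linarith
qed

text \<open>
  Arcs of capacity 0 contribute nothing to \<open>M\<close>, but they are not residual either.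
\<close>

lemma cost_bound: "(\<Sum>e\<in>fst ` R. \<bar>c e\<bar>) \<le> M"
proof -
  have "(\<Sum>e\<in>fst ` R. \<bar>c e\<bar>) \<le> (\<Sum>e\<in>fst ` R. \<bar>c e\<bar> * u e)"
  proof (rule sum_mono)
    fix e assume e: "e \<in> fst ` R"
    then have "1 \<le> u e" using x_bounds[of e] by (auto simp: residual_def split: if_splits)
    then show "\<bar>c e\<bar> \<le> \<bar>c e\<bar> * u e" using mult_left_mono[of 1 "u e" "\<bar>c e\<bar>"] by simp
  qed
  also have "\<dots> \<le> M" unfolding M_def
    by (rule sum_mono2[OF fin R_E(2)]) (use x_bounds in \<open>force intro: mult_nonneg_nonneg\<close>)
  finally show ?thesis .
qed

lemma cheap_walk:
  assumes "dconn ta he R v v'"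
  shows "\<exists>w. dwalk ta he R v w v' \<and> wt (owt c) w \<le> M"
proof -
  obtain w where "dwalk ta he R v w v'" using assms by (auto simp: dconn_def)
  then obtain w where w: "dwalk ta he R v w v'" "distinct (map (osrc ta he) w)"
    using simple_walk_exists by meson
  have "finite (fst ` R)" by (rule finite_subset[OF R_E(2) fin])
  moreover have "distinct w" using w(2) by (simp add: distinct_map)
  ultimately have "\<bar>wt (owt c) w\<bar> \<le> (\<Sum>e\<in>fst ` R. \<bar>c e\<bar>)"
    using distinct_wt_bound[of w "fst ` R" c] image_mono[OF owalk_set[OF w(1)], of fst] by blast
  then show ?thesis using w(1) cost_bound by (intro exI[of _ w]) simp
qed

text \<open>
  A simple closed walk in a component runs back in time by at most \<open>T\<close>, and if it does, it costs at
  least 1. So with the weights \<open>T * c + \<tau>\<close> there is no negative closed walk.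
\<close>

lemma backward_cost:
  assumes w: "dwalk ta he R v w v'" and v: "v \<in> scomp ta he R r" "v' \<in> scomp ta he R r" and r: "r \<in> {s0, t0}"
  shows "- T * M - T \<le> T * wt (owt c) w + wt (owt \<tau>) w"
proof -
  let ?RC = "{a \<in> R. osrc ta he a \<in> scomp ta he R r \<and> odst ta he a \<in> scomp ta he R r}"
  let ?k = "\<lambda>e. T * c e + \<tau> e"
  have k: "wt (owt ?k) w = T * wt (owt c) w + wt (owt \<tau>) w" for w
  proof -
    have "wt (owt ?k) w = wt (\<lambda>a. T * owt c a + owt \<tau> a) w"
      by (rule wt_cong) (simp add: owt_def)
    then show ?thesis by (simp add: wt_add wt_cmult)
  qed
  have "0 \<le> wt (owt ?k) w" if "dwalk ta he ?RC p w p" for p w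
  proof (rule closed_walks_nonneg[OF _ that])
    fix p w assume w: "dwalk ta he ?RC p w p" and dist: "distinct (map (osrc ta he) w)"
    show "0 \<le> wt (owt ?k) w"
    proof (cases w)
      case (Cons a w')
      have R: "dwalk ta he R p w p" by (rule owalk_mono[OF w]) (use owalk_set[OF w] in blast)
      have "p \<in> S \<union> Q" using w Cons r by auto
      note c = closed_walk_in_component[OF R this]
      have sub: "fst ` set w \<subseteq> E" using owalk_set[OF R] R_E(2) by blast
      have "distinct w" using dist by (simp add: distinct_map)
      from distinct_wt_bound[OF this sub fin, of \<tau>] have "- T \<le> wt (owt \<tau>) w" unfolding T_abs by linarith
      moreover have "T \<le> T * wt (owt c) w" if "wt (owt \<tau>) w < 0"
        using c(2)[OF that] T_nonneg mult_left_mono[of 1 "wt (owt c) w" T] by simp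
      moreover have "0 \<le> T * wt (owt c) w" using c(1) T_nonneg by (intro mult_nonneg_nonneg)
      ultimately show ?thesis unfolding k by linarith
    qed simp
  qed
  moreover have fR: "finite (fst ` R)" by (rule finite_subset[OF R_E(2) fin])
  ultimately have "- (\<Sum>e\<in>fst ` R. \<bar>?k e\<bar>) \<le> wt (owt ?k) w"
    using walk_weight_lower_bound[of "fst ` R" ?RC ta he ?k v w v'] comp_walk[OF w v] by blast
  moreover have "(\<Sum>e\<in>fst ` R. \<bar>?k e\<bar>) \<le> (\<Sum>e\<in>fst ` R. T * \<bar>c e\<bar> + \<bar>\<tau> e\<bar>)"
  proof (rule sum_mono)
    fix e
    have "\<bar>T * c e\<bar> = T * \<bar>c e\<bar>" using T_nonneg by (simp add: abs_mult)
    then show "\<bar>?k e\<bar> \<le> T * \<bar>c e\<bar> + \<bar>\<tau> e\<bar>" using abs_triangle_ineq[of "T * c e" "\<tau> e"] by simp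
  qed
  moreover have "\<dots> = T * (\<Sum>e\<in>fst ` R. \<bar>c e\<bar>) + (\<Sum>e\<in>fst ` R. \<bar>\<tau> e\<bar>)"
    by (simp add: sum.distrib sum_distrib_left)
  moreover have "T * (\<Sum>e\<in>fst ` R. \<bar>c e\<bar>) \<le> T * M" by (rule mult_left_mono[OF cost_bound T_nonneg])
  moreover have "(\<Sum>e\<in>fst ` R. \<bar>\<tau> e\<bar>) \<le> T"
    unfolding T_abs[symmetric] by (rule sum_mono2[OF fin R_E(2)]) simp
  ultimately show ?thesis unfolding k by linarith
qed

end

locale turnpike_deep = turnpike +
  assumes T_pos: "1 \<le> T" and d_D2: "D2 \<le> d" and horizon: "2 * d + 7 * T + 3 * T * M \<le> \<theta>"
begin

lemma \<theta>_large: "2 * d + 7 * T \<le> \<theta>" "D1 + 4 * T + 1 \<le> d" "1 \<le> d"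
proof -
  have "0 \<le> T * M" using T_nonneg M_nonneg by (rule mult_nonneg_nonneg)
  then show "2 * d + 7 * T \<le> \<theta>" using horizon by linarith
  show "D1 + 4 * T + 1 \<le> d" "1 \<le> d" using D_bounds d_D2 T_pos by linarith+
qed

lemma descent_S:
  assumes b: "fst b \<in> S" "D1 \<le> snd b" "snd b \<le> \<theta>" and w: "hwalk b w0 q0" "snd q0 \<le> 0"
  shows "\<exists>w. awalk (s0, 0) w (N b) \<and> (\<forall>v. dwalk ta he R s0 v (fst b) \<longrightarrow> cost w \<le> wt (owt c) v) \<and>
    (\<forall>a\<in>set w. inner \<tau> \<theta> d (fst a) \<longrightarrow> orev a \<in> H)"
proof (rule descent[of s0 T "D1 - 1" \<theta>, OF _ T_pos T_nonneg])
  show "D1 - 1 = T + 2 * T + 3 * T * (2 * T * M + 1)" by (simp add: D1_def)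
  show "D1 - 1 < d" "D1 - 1 \<le> \<theta>" using \<theta>_large T_pos by linarith+
  show False if "a \<in> H" "fst (psrc a) \<in> S" "fst (pdst a) \<notin> S" "T < snd (pdst a)" for a
    using leave_S[OF that(1-3)] that(4) by simp
qed (use b w in auto)

lemma reached_from_s0:
  assumes a: "a \<in> H" "fst (pdst a) \<in> S" "D1 \<le> snd (pdst a)"
  shows "aconn (s0, 0) (N (pdst a))"
proof -
  obtain w q where w: "hwalk (pdst a) w q" and q: "snd q \<le> 0 \<or> fst q \<in> {s0, t0}"
    using H_forward[OF a(1)] by blast
  note le = H_times(2)[OF a(1)]
  show ?thesis
  proof (cases "snd q \<le> 0")
    case True
    from descent_S[OF a(2,3) le w True] show ?thesis by (auto simp: dconn_def)
  next
    case False
    then have g: "fst q \<in> {s0, t0}" "1 \<le> snd q" using q by auto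
    have "dconn ta he R s0 (fst q)" using a(2) hwalk_R[OF w] dconn_trans unfolding scomp_def by fast
    then have "N q = (s0, 0)" using g no_st by (auto simp: gnode_def)
    then show ?thesis using hwalk_reverse(1)[OF w le g(2)] by (auto simp: dconn_def)
  qed
qed

lemma mirror_deep: "turnpike_deep E he ta \<tau> c u t0 s0 x (\<lambda>a. \<phi> (rtime \<tau> \<theta> a)) \<theta> d"
proof -
  interpret mir: turnpike E he ta \<tau> c u t0 s0 x "\<lambda>a. \<phi> (rtime \<tau> \<theta> a)" \<theta> d by (rule mirror)
  show ?thesis by unfold_locales (rule T_pos d_D2 horizon)+
qed

lemma reaches_t0:
  assumes a: "a \<in> H" "fst (psrc a) \<in> Q" "snd (psrc a) \<le> \<theta> + 1 - D1"
  shows "aconn (N (psrc a)) (t0, 0)"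
proof -
  interpret mir: turnpike_deep E he ta \<tau> c u t0 s0 x "\<lambda>a. \<phi> (rtime \<tau> \<theta> a)" \<theta> d by (rule mirror_deep)
  have "mir.aconn (t0, 0) (gnode t0 s0 (mir.pdst (ortime \<tau> \<theta> a)))"
    by (rule mir.reached_from_s0) (use a in \<open>simp_all add: mirror_H scomp_swap[of he ta]\<close>)
  then obtain w where w: "mir.awalk (t0, 0) w (gnode t0 s0 (rnode \<theta> (psrc a)))" by (auto simp: dconn_def)
  have "N (rnode \<theta> (gnode t0 s0 (rnode \<theta> (psrc a)))) = N (psrc a)" "N (rnode \<theta> (t0, 0)) = (t0, 0)"
    by (auto simp: gnode_def rnode_def)
  then show ?thesis using mirror_awalk[OF w] by (auto simp: dconn_def)
qed

text \<open>
  Residual walks lead from \<open>s0\<close> to \<open>n\<close>, back along \<open>w\<close> to \<open>m\<close>, and on to \<open>t0\<close>, which together augment \<open>\<phi>\<close>.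
\<close>

lemma no_Q_to_S:
  assumes w: "hwalk m w n" and m: "fst m \<in> Q" "snd m \<le> \<theta> + 1 - D1" and n: "fst n \<in> S" "D1 \<le> snd n"
  shows False
proof -
  have "w \<noteq> []" using w m n S_Q_disjoint by (cases w) auto
  then have hd: "hd w \<in> H" "psrc (hd w) = m" and last: "last w \<in> H" "pdst (last w) = n"
    using owalk_start[OF w] owalk_end[OF w] owalk_set[OF w] hd_in_set[of w] last_in_set[of w] by auto
  have 1: "aconn (s0, 0) (N n)" using reached_from_s0[OF last(1)] last(2) n by simp
  have 2: "aconn (N m) (t0, 0)" using reaches_t0[OF hd(1)] hd(2) m by simp
  have "aconn (N n) (N m)"
    using hwalk_reverse(1)[OF w] m n D_bounds(1) T_pos by (intro dconn_walk) auto
  then show False using 1 2 max_value by (blast intro: dconn_trans)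
qed

lemma descent_Q:
  assumes b: "fst b \<in> Q" "D2 \<le> snd b" "snd b \<le> \<theta> + 1 - D1" and w: "hwalk b w0 q0" "snd q0 \<le> 0"
  shows "\<exists>w. awalk (t0, 0) w (N b) \<and> (\<forall>v. dwalk ta he R t0 v (fst b) \<longrightarrow> cost w \<le> wt (owt c) v) \<and>
    (\<forall>a\<in>set w. inner \<tau> \<theta> d (fst a) \<longrightarrow> orev a \<in> H)"
proof (rule descent[of t0 "D1 + 2 * T" "D2 - 1" "\<theta> + 1 - D1", OF _ T_pos])
  show "0 \<le> D1 + 2 * T" using D_bounds T_pos by linarith
  show "D2 - 1 = D1 + 2 * T + 2 * T + 3 * T * (2 * T * M + 1)" by (simp add: D2_def)
  show "D2 - 1 < d" "D2 - 1 \<le> \<theta> + 1 - D1" using \<theta>_large d_D2 T_pos by linarith+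
  show "snd b \<le> \<theta>" using b(3) D_bounds(1) T_pos by linarith
  fix a v m
  assume a: "a \<in> H" "fst (psrc a) \<in> Q" "fst (pdst a) \<notin> Q" "D1 + 2 * T < snd (pdst a)"
    and m: "fst m \<in> Q" "snd m \<le> \<theta> + 1 - D1" "hwalk m v (psrc a)"
  show False
  proof (rule escape[OF a(1) _ a(3,4)])
    show "dconn ta he R t0 (fst (pdst a))"
      using a(2) dconn_arc[OF H_R[OF a(1)], of ta he] dconn_trans unfolding scomp_def by fastforce
    fix w q assume w: "hwalk (pdst a) w q" "fst q \<in> S" "D1 \<le> snd q"
    have "hwalk m ((v @ [a]) @ w) q" using owalk_snoc[OF m(3) a(1)] w(1) unfolding owalk_append by blast
    from no_Q_to_S[OF this m(1,2) w(2,3)] show False .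
  qed
qed (use b w in auto)

text \<open>
  It remains to see that the target of \<open>a\<close> lies in the component of the terminal \<open>fst p\<close>, where
  \<open>descent\<close> applies. Outside of it the walk \<open>w\<close> could not turn back into the past.
\<close>

lemma interior_from_ground:
  assumes a: "a \<in> H" "inner \<tau> \<theta> d (fst a)" and v: "hwalk p v (psrc a)" "fst p \<in> {s0, t0}"
    and w: "hwalk (pdst a) w q" "snd q \<le> 0"
  shows False
proof -
  let ?n = "pdst a"
  note times = inner_times[OF a(2) H_E[OF a(1)]]
  have pn: "hwalk p (v @ [a]) ?n" by (rule owalk_snoc[OF v(1) a(1)])
  have conn: "dconn ta he R (fst p) (fst ?n)" by (rule hwalk_R[OF pn])
  show False
  proof (cases "fst p = s0")
    case True
    have "fst ?n \<in> S"
    proof (rule ccontr)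
      assume n: "fst ?n \<notin> S"
      have out: "fst m \<notin> S \<union> Q" if m: "hwalk ?n v' m" for v' m
      proof
        assume "fst m \<in> S \<union> Q"
        then consider "fst m \<in> S" | "fst m \<in> Q" by blast
        then show False
        proof cases
          case 1
          then show False using scomp_between[of ta he R s0 "fst ?n" "fst m" s0] conn True hwalk_R[OF m] n by simp
        next
          case 2
          then have "dconn ta he R (fst m) t0" by (simp add: scomp_def)
          then show False using conn True hwalk_R[OF m] no_st by (metis dconn_trans)
        qed
      qed
      have "snd ?n - T \<le> snd q" by (rule hwalk_outside[OF w(1)]) (rule out)
      then show False using w(2) times(2) \<theta>_large(2) D_bounds(1) T_pos by linarith
    qed
    then obtain y where "awalk (s0, 0) y (N ?n)" "\<forall>v'. dwalk ta he R s0 v' (fst ?n) \<longrightarrow> cost y \<le> wt (owt c) v'"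
      "\<forall>b\<in>set y. inner \<tau> \<theta> d (fst b) \<longrightarrow> orev b \<in> H"
      using descent_S[OF _ _ _ w] times \<theta>_large T_pos by force
    then show False
      using interior_not_supplied[OF a v \<theta>_large(3)] True by blast
  next
    case False
    then have p: "fst p = t0" using v(2) by blast
    have no_S: False if y: "hwalk p y m" "fst m \<in> S" "D1 \<le> snd m" for y m
    proof -
      have "y \<noteq> []" using y(1,2) p t0_S by auto
      then have hd: "hd y \<in> H" "psrc (hd y) = p" and last: "last y \<in> H" "pdst (last y) = m"
        using owalk_start[OF y(1)] owalk_end[OF y(1)] owalk_set[OF y(1)] hd_in_set[of y] last_in_set[of y] by auto
      have "snd p \<le> \<theta>" using ground_time(1)[OF hd(1)] hd(2) p by simp
      then have "aconn (N m) (t0, 0)"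
        using hwalk_reverse(1)[OF y(1)] y(3) D_bounds(1) T_pos p by (intro dconn_walk) (auto simp: gnode_def)
      moreover have "aconn (s0, 0) (N m)" using reached_from_s0[OF last(1)] last(2) y by simp
      ultimately show False using max_value by (blast intro: dconn_trans)
    qed
    have "fst ?n \<in> Q"
    proof (rule ccontr)
      assume n: "fst ?n \<notin> Q"
      show False
      proof (rule escape[OF a(1) _ n])
        show "dconn ta he R t0 (fst ?n)" using conn p by simp
        show "D1 + 2 * T < snd ?n" using times(2) \<theta>_large T_pos by linarith
        fix y m assume y: "hwalk ?n y m" "fst m \<in> S" "D1 \<le> snd m"
        have "hwalk p ((v @ [a]) @ y) m" using pn y(1) unfolding owalk_append by blast
        from no_S[OF this y(2,3)] show False .
      qed
    qed
    moreover have "D2 \<le> snd ?n" "snd ?n \<le> \<theta> + 1 - D1" using times d_D2 \<theta>_large T_pos by linarith+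
    ultimately obtain y where "awalk (t0, 0) y (N ?n)" "\<forall>v'. dwalk ta he R t0 v' (fst ?n) \<longrightarrow> cost y \<le> wt (owt c) v'"
      "\<forall>b\<in>set y. inner \<tau> \<theta> d (fst b) \<longrightarrow> orev b \<in> H"
      using descent_Q[OF _ _ _ w] by blast
    then show False
      using interior_not_supplied[OF a v \<theta>_large(3)] p by blast
  qed
qed

lemma interior_to_ground:
  assumes a: "a \<in> H" "inner \<tau> \<theta> d (fst a)" and v: "hwalk p v (psrc a)" "\<theta> < snd p"
    and w: "hwalk (pdst a) w q" "fst q \<in> {s0, t0}"
  shows False
proof -
  interpret mir: turnpike_deep E he ta \<tau> c u t0 s0 x "\<lambda>a. \<phi> (rtime \<tau> \<theta> a)" \<theta> d by (rule mirror_deep)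
  show False
  proof (rule mir.interior_from_ground)
    show "ortime \<tau> \<theta> a \<in> mir.H" using a(1) by (simp add: mirror_H)
    show "inner \<tau> \<theta> d (fst (ortime \<tau> \<theta> a))" using a(2) by simp
    show "mir.hwalk (rnode \<theta> q) (rev (map (ortime \<tau> \<theta>) w)) (mir.psrc (ortime \<tau> \<theta> a))"
      using mirror_hwalk[OF w(1)] by simp
    show "mir.hwalk (mir.pdst (ortime \<tau> \<theta> a)) (rev (map (ortime \<tau> \<theta>) v)) (rnode \<theta> p)"
      using mirror_hwalk[OF v(1)] by simp
    show "fst (rnode \<theta> q) \<in> {t0, s0}" "snd (rnode \<theta> p) \<le> 0" using v(2) w(2) by auto
  qed
qed

text \<open>
  The mirror image of the descent; the cheapest walk to the terminal costs at most \<open>M\<close>.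
\<close>

lemma ascent:
  assumes r: "r \<in> {s0, t0}" and b: "fst b \<in> scomp ta he R r" "D1 \<le> snd b" "snd b \<le> \<theta> + 1 - D2"
    and w: "hwalk p w b" "\<theta> < snd p"
  shows "\<exists>v. awalk (N b) v (r, 0) \<and> cost v \<le> M"
proof -
  interpret mir: turnpike_deep E he ta \<tau> c u t0 s0 x "\<lambda>a. \<phi> (rtime \<tau> \<theta> a)" \<theta> d by (rule mirror_deep)
  have w': "mir.hwalk (rnode \<theta> b) (rev (map (ortime \<tau> \<theta>) w)) (rnode \<theta> p)" "snd (rnode \<theta> p) \<le> 0"
    using mirror_hwalk[OF w(1)] w(2) by auto
  have "\<exists>v. mir.awalk (r, 0) v (gnode t0 s0 (rnode \<theta> b)) \<and>
    (\<forall>v'. dwalk he ta R r v' (fst (rnode \<theta> b)) \<longrightarrow> cost v \<le> wt (owt c) v')"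
  proof (cases "r = s0")
    case True
    then show ?thesis
      using mir.descent_Q[OF _ _ _ w'] b by (force simp: scomp_swap[of he ta])
  next
    case False
    then have r: "r = t0" using r by blast
    have "D1 \<le> \<theta> + 1 - snd b" "\<theta> + 1 - snd b \<le> \<theta>" using b D_bounds T_pos by linarith+
    then show ?thesis
      using mir.descent_S[OF _ _ _ w'] b r by (force simp: scomp_swap[of he ta])
  qed
  then obtain v where v: "mir.awalk (r, 0) v (gnode t0 s0 (rnode \<theta> b))"
    "\<And>v'. dwalk he ta R r v' (fst b) \<Longrightarrow> cost v \<le> wt (owt c) v'" by auto
  have "N (rnode \<theta> (gnode t0 s0 (rnode \<theta> b))) = N b" "N (rnode \<theta> (r, 0)) = (r, 0)"
    using r by (auto simp: gnode_def rnode_def)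
  then have 1: "awalk (N b) (rev (map (ortime \<tau> \<theta>) v)) (r, 0)" using mirror_awalk[OF v(1)] by simp
  have "dconn ta he R (fst b) r" using b(1) by (simp add: scomp_def)
  then obtain y where y: "dwalk ta he R (fst b) y r" "wt (owt c) y \<le> M" using cheap_walk by blast
  have "cost v \<le> M" using v(2)[OF owalk_rev[OF y(1)]] y(2) by simp
  then show ?thesis using 1 by (intro exI[of _ "rev (map (ortime \<tau> \<theta>) v)"]) (simp add: wt_proj wt_map o_def)
qed

text \<open>
  The walk meets the components in a window below \<open>\<theta> + 1 - D2\<close> and again in one below
  \<open>D2 + 3 T\<close>, both times in the same component. Between these visits it cannot cost more than
  \<open>2 M\<close>, as \<open>ascent\<close> and \<open>descent\<close> connect them through the terminal at this cost; but then, by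
  \<open>backward_cost\<close>, it goes back in time by at most \<open>3 T M + T\<close>.
\<close>

lemma no_crossing:
  assumes w: "hwalk p w q" and pq: "\<theta> < snd p" "snd q \<le> 0"
  shows False
proof -
  let ?k = "\<theta> + 1 - D2" and ?l = "D2 + 3 * T"
  have big: "?l + T * (3 * M) + T < ?k - 3 * T" "?k < snd p" "snd q \<le> ?k - 3 * T" "snd q \<le> ?l - 3 * T"
    using horizon \<theta>_large d_D2 D_bounds T_pos pq by (simp_all add: algebra_simps)
  have TM: "0 \<le> T * (3 * M)" using T_nonneg M_nonneg by (intro mult_nonneg_nonneg) auto
  obtain w1 n w2 where n: "hwalk p w1 n" "hwalk n w2 q" "fst n \<in> S \<union> Q" "?k - 3 * T < snd n" "snd n \<le> ?k"
    using crossing[OF w big(2,3) T_pos] by blast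
  have "?l < snd n" using n(4) big(1) TM T_pos by linarith
  from crossing[OF n(2) this big(4) T_pos]
  obtain w3 m w4 where m: "hwalk n w3 m" "hwalk m w4 q" "fst m \<in> S \<union> Q" "?l - 3 * T < snd m" "snd m \<le> ?l"
    by blast
  have times: "snd n \<le> \<theta> + 1 - D1" "D1 \<le> snd m" "D1 \<le> snd n" "snd m \<le> \<theta> + 1 - D1" "snd m \<le> \<theta>" "snd n \<le> \<theta>" "1 \<le> snd m"
    using n m D_bounds T_pos big(1) TM by linarith+
  have "\<exists>r\<in>{s0, t0}. fst n \<in> scomp ta he R r \<and> fst m \<in> scomp ta he R r"
  proof (rule ccontr)
    assume "\<not> ?thesis"
    then consider "fst n \<in> Q" "fst m \<in> S" | "fst n \<in> S" "fst m \<in> Q" using n(3) m(3) by blast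
    then show False
    proof cases
      case 1
      then show False using no_Q_to_S[OF m(1)] times by blast
    next
      case 2
      then have "dconn ta he R s0 (fst n)" "dconn ta he R (fst m) t0" by (simp_all add: scomp_def)
      then show False using hwalk_R[OF m(1)] no_st by (metis dconn_trans)
    qed
  qed
  then obtain r where r: "r \<in> {s0, t0}" "fst n \<in> scomp ta he R r" "fst m \<in> scomp ta he R r" by blast
  obtain v where v: "awalk (N n) v (r, 0)" "cost v \<le> M"
    using ascent[OF r(1,2) times(3) n(5) n(1) pq(1)] by blast
  have m': "D2 \<le> snd m" using m(4) by simp
  have "\<exists>y. awalk (r, 0) y (N m) \<and> (\<forall>v'. dwalk ta he R r v' (fst m) \<longrightarrow> cost y \<le> wt (owt c) v')"
    using descent_S[OF _ times(2,5) m(2) pq(2)] descent_Q[OF _ m' times(4) m(2) pq(2)] r by auto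
  then obtain y where y: "awalk (r, 0) y (N m)" "\<And>v'. dwalk ta he R r v' (fst m) \<Longrightarrow> cost y \<le> wt (owt c) v'"
    by blast
  have "dconn ta he R r (fst m)" using r(3) by (simp add: scomp_def)
  then obtain y' where "dwalk ta he R r y' (fst m)" "wt (owt c) y' \<le> M" using cheap_walk by blast
  then have y_M: "cost y \<le> M" using y(2) by force
  have "awalk (N m) (rev (map orev w3)) (N n)" by (rule hwalk_reverse(1)[OF m(1) times(6,7)])
  then have "awalk (N n) (v @ y @ rev (map orev w3)) (N n)" using v(1) y(1) unfolding owalk_append by blast
  from min_cost[OF this] have "cost w3 \<le> cost v + cost y" by simp
  then have c: "wt (owt c) (map proj w3) \<le> 2 * M" using v(2) y_M by (simp add: wt_proj)
  note P = walk_proj[OF m(1) H_R']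
  have "- T * M - T \<le> T * wt (owt c) (map proj w3) + wt (owt \<tau>) (map proj w3)"
    by (rule backward_cost[OF P(1) r(2,3,1)])
  moreover have "T * wt (owt c) (map proj w3) \<le> T * (2 * M)" by (rule mult_left_mono[OF c T_nonneg])
  ultimately have "snd n - snd m \<le> T * (3 * M) + T" using P(2) by (simp add: algebra_simps)
  then show False using n(4) m(5) big(1) by linarith
qed

theorem deep_interior:
  assumes a: "a \<in> H" shows "\<not> inner \<tau> \<theta> d (fst a)"
proof
  assume inner: "inner \<tau> \<theta> d (fst a)"
  obtain v p where v: "hwalk p v (psrc a)" "\<theta> < snd p \<or> fst p \<in> {s0, t0}" using H_backward[OF a] by blast
  obtain w q where w: "hwalk (pdst a) w q" "snd q \<le> 0 \<or> fst q \<in> {s0, t0}" using H_forward[OF a] by blast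
  have pq: "hwalk p ((v @ [a]) @ w) q" using owalk_snoc[OF v(1) a] w(1) unfolding owalk_append by blast
  show False
    using v(2) w(2) no_crossing[OF pq] interior_from_ground[OF a inner v(1) _ w(1)]
      interior_to_ground[OF a inner v(1) _ w(1)] ground_to_ground[OF pq] by blast
qed

end

text \<open>
  Without closed residual walks that run back in time, a walk of \<open>H\<close> drifts by at most \<open>T\<close> into the
  past. So an inner copy can only lie on a walk that joins two terminals.
\<close>

theorem (in turnpike) shallow_interior:
  assumes nonneg: "\<And>p w. dwalk ta he R p w p \<Longrightarrow> 0 \<le> wt (owt \<tau>) w" and d: "T + 1 \<le> d"
    and a: "a \<in> H"
  shows "\<not> inner \<tau> \<theta> d (fst a)"
proof
  assume inner: "inner \<tau> \<theta> d (fst a)"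
  note times = inner_times[OF inner H_E[OF a]]
  have drift: "snd p - T \<le> snd q" if w: "hwalk p w q" for p w q
  proof -
    have "- (\<Sum>e\<in>E. \<bar>\<tau> e\<bar>) \<le> wt (owt \<tau>) (map proj w)"
      by (rule walk_weight_lower_bound[OF fin R_E(2) nonneg walk_proj(1)[OF w H_R']])
    then show ?thesis using walk_proj(2)[OF w H_R'] T_abs by simp
  qed
  obtain v p where v: "hwalk p v (psrc a)" "\<theta> < snd p \<or> fst p \<in> {s0, t0}" using H_backward[OF a] by blast
  obtain w q where w: "hwalk (pdst a) w q" "snd q \<le> 0 \<or> fst q \<in> {s0, t0}" using H_forward[OF a] by blast
  have pq: "hwalk p ((v @ [a]) @ w) q" using owalk_snoc[OF v(1) a] w(1) unfolding owalk_append by blast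
  have "fst p \<in> {s0, t0}" "fst q \<in> {s0, t0}"
    using v(2) w(2) drift[OF v(1)] drift[OF w(1)] times d by auto
  then show False using ground_to_ground[OF pq] by simp
qed

section \<open>Optimal flows over time that follow the steady state\<close>

lemma closed_walk_neighbours:
  assumes w: "owalk sr ds B p w p" and a: "a \<in> set w"
  shows "\<exists>b\<in>set w. ds b = sr a" "\<exists>b\<in>set w. sr b = ds a"
proof -
  obtain v v' where v: "w = v @ a # v'" "owalk sr ds B p v (sr a)" "owalk sr ds B (ds a) v' p"
    by (rule owalk_arc[OF w a])
  have ne: "w \<noteq> []" using v(1) by simp
  have p: "ds (last w) = p" "sr (hd w) = p" using owalk_end[OF w] owalk_start[OF w] ne by auto
  show "\<exists>b\<in>set w. ds b = sr a"
  proof (cases "v = []")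
    case True
    then show ?thesis using v(2) p(1) ne by (intro bexI[of _ "last w"]) auto
  next
    case False
    then show ?thesis using owalk_end[OF v(2)] v(1) by (intro bexI[of _ "last v"]) auto
  qed
  show "\<exists>b\<in>set w. sr b = ds a"
  proof (cases "v' = []")
    case True
    then show ?thesis using v(3) p(2) ne by (intro bexI[of _ "hd w"]) auto
  next
    case False
    then show ?thesis using owalk_start[OF v(3)] v(1) by (intro bexI[of _ "hd v'"]) auto
  qed
qed

lemma fst_gnode [simp]: "fst (gnode s t n) = fst n"
  by (simp add: gnode_def)

text \<open>
  In a closed walk every node that is no terminal is the target of one copy and the source of
  another, and therefore lies within the horizon. A walk in a component has nonnegative cost
  because \<open>x\<close> is steady. Any other walk avoids the terminals; it really closes in the time-expanded
  network, so its transit time is 0, and again the cost is nonnegative.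
\<close>

lemma (in turnpike_base) closed_hwalk:
  assumes w: "dwalk (N \<circ> ctail ta) (N \<circ> chead he \<tau>) H p w p"
  shows "\<forall>a\<in>set w. orev a \<in> A" "0 \<le> cost w"
proof -
  let ?s = "osrc (N \<circ> ctail ta) (N \<circ> chead he \<tau>)" and ?d = "odst (N \<circ> ctail ta) (N \<circ> chead he \<tau>)"
  have H: "a \<in> H" if "a \<in> set w" for a using owalk_set[OF w] that by blast
  have times: "snd (psrc a) \<le> \<theta>" "1 \<le> snd (pdst a)" if a: "a \<in> set w" for a
  proof -
    obtain b b' where b: "b \<in> set w" "?d b = ?s a" "b' \<in> set w" "?s b' = ?d a"
      using closed_walk_neighbours[OF w a] by blast
    then have *: "N (pdst b) = N (psrc a)" "N (psrc b') = N (pdst a)" by (simp_all add: osrc_comp)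
    show "snd (psrc a) \<le> \<theta>"
    proof (cases "fst (psrc a) \<in> {s0, t0}")
      case False
      then have "snd (pdst b) = snd (psrc a)" using *(1) by (auto simp: gnode_def split: if_splits)
      then show ?thesis using H_times(2)[OF H[OF b(1)]] by simp
    qed (rule ground_time(1)[OF H[OF a]])
    show "1 \<le> snd (pdst a)"
    proof (cases "fst (pdst a) \<in> {s0, t0}")
      case False
      then have "snd (psrc b') = snd (pdst a)" using *(2) by (auto simp: gnode_def split: if_splits)
      then show ?thesis using H_times(1)[OF H[OF b(3)]] by simp
    qed (rule ground_time(2)[OF H[OF a]])
  qed
  show "\<forall>a\<in>set w. orev a \<in> A" using H_real(2)[OF H] times by blast
  have st: "dwalk ta he R (fst p) (map proj w) (fst p)"
    by (rule owalk_map[OF w]) (use H H_R in \<open>auto simp: osrc_comp\<close>)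
  have "0 \<le> wt (owt c) (map proj w)"
  proof (cases "fst p \<in> S \<union> Q")
    case False
    have out: "osrc ta he (proj a) \<notin> {s0, t0}" "odst ta he (proj a) \<notin> {s0, t0}" if a: "a \<in> set w" for a
    proof -
      have "proj a \<in> set (map proj w)" using a by simp
      note * = scomp_closed_walk[OF st this]
      show "osrc ta he (proj a) \<notin> {s0, t0}" "odst ta he (proj a) \<notin> {s0, t0}"
        using *(1)[of s0] *(1)[of t0] *(2)[of s0] *(2)[of t0] False by auto
    qed
    have "snd q = snd p' + wt (owt \<tau>) (map proj v)"
      if "dwalk (N \<circ> ctail ta) (N \<circ> chead he \<tau>) H p' v q" "set v \<subseteq> set w" for p' q v
      using that
    proof (induction v arbitrary: p')
      case (Cons a v)
      then have a: "a \<in> set w" "?s a = p'" "dwalk (N \<circ> ctail ta) (N \<circ> chead he \<tau>) H (?d a) v q"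
        by (simp_all only: owalk.simps list.set insert_subset simp_thms)
      have "?s a = N (psrc a)" "?d a = N (pdst a)" by (rule osrc_comp)+
      then have "snd p' = snd (psrc a)" "snd (?d a) = snd (pdst a)"
        using out[OF a(1)] a(2) by (auto simp: gnode_def)
      then show ?case using Cons.IH[OF a(3)] Cons.prems(2) snd_odst[of he \<tau> ta a] by simp
    qed simp
    from this[OF w] have "wt (owt \<tau>) (map proj w) = 0" by simp
    then show ?thesis by (rule closed_walk_outside(2)[OF st False])
  qed (rule closed_walk_in_component(1)[OF st])
  then show "0 \<le> cost w" by (simp add: wt_proj)
qed

text \<open>
  Where \<open>w\<close> is directed against the deviation, the augmentation moves \<open>\<phi>\<close> by one unit towards \<open>x\<close>; no
  step overshoots because the flows are integral.
\<close>

lemma aug_closer: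
  assumes fin: "finite X" and dist: "distinct (map fst w)"
    and rev: "\<And>b. b \<in> set w \<Longrightarrow> fst b \<in> X \<Longrightarrow> 0 < owt (dev x \<phi>) (orev b)"
  shows "(\<Sum>a\<in>X. \<bar>dev x (aug \<phi> w) a\<bar>) \<le> (\<Sum>a\<in>X. \<bar>dev x \<phi> a\<bar>)"
    "b \<in> set w \<Longrightarrow> fst b \<in> X \<Longrightarrow> (\<Sum>a\<in>X. \<bar>dev x (aug \<phi> w) a\<bar>) < (\<Sum>a\<in>X. \<bar>dev x \<phi> a\<bar>)"
proof -
  have T: "dev x \<phi> a < 0" if "(a, True) \<in> set w" "a \<in> X" for a using rev[of "(a, True)"] that by (simp add: owt_def)
  have F: "0 < dev x \<phi> a" if "(a, False) \<in> set w" "a \<in> X" for a using rev[of "(a, False)"] that by (simp add: owt_def)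
  have le: "\<bar>dev x (aug \<phi> w) a\<bar> \<le> \<bar>dev x \<phi> a\<bar>" if "a \<in> X" for a
    using T[of a] F[of a] that by (auto simp: dev_def aug_value[OF dist])
  then show "(\<Sum>a\<in>X. \<bar>dev x (aug \<phi> w) a\<bar>) \<le> (\<Sum>a\<in>X. \<bar>dev x \<phi> a\<bar>)" by (rule sum_mono)
  show "(\<Sum>a\<in>X. \<bar>dev x (aug \<phi> w) a\<bar>) < (\<Sum>a\<in>X. \<bar>dev x \<phi> a\<bar>)" if b: "b \<in> set w" "fst b \<in> X"
  proof (rule sum_strict_mono_ex1[OF fin])
    show "\<forall>a\<in>X. \<bar>dev x (aug \<phi> w) a\<bar> \<le> \<bar>dev x \<phi> a\<bar>" using le by blast
    obtain e s where "b = (e, s)" by (cases b)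
    then have "(fst b, True) \<in> set w \<or> (fst b, False) \<in> set w" using b(1) by (cases s) auto
    then have "\<bar>dev x (aug \<phi> w) (fst b)\<bar> < \<bar>dev x \<phi> (fst b)\<bar>"
      using T[of "fst b"] F[of "fst b"] b(2) by (auto simp: dev_def aug_value[OF dist])
    then show "\<exists>a\<in>X. \<bar>dev x (aug \<phi> w) a\<bar> < \<bar>dev x \<phi> a\<bar>" using b(2) by blast
  qed
qed

lemma finite_real_copies: "finite E \<Longrightarrow> (\<And>e. e \<in> E \<Longrightarrow> 0 \<le> \<tau> e) \<Longrightarrow> finite (real_copies E \<tau> \<theta>)"
  by (rule finite_subset[of _ "E \<times> {1..\<theta>}"]) (fastforce simp: real_copies_def)+

text \<open>
  Choose \<open>\<phi>\<close> by maximal value, then minimal cost, then minimal distance from \<open>x\<close> on the inner copies,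
  then minimal distance on all copies. A closed residual walk of cost at most 0 contains a simple one
  through any given arc of it, and augmenting along that one keeps value and cost optimal. So it
  cannot reduce the distances.
\<close>

lemma optimal_flow_near_steady:
  fixes ta he :: "'e \<Rightarrow> 'v"
  assumes fin: "finite E" and st: "s0 \<noteq> t0" and \<tau>: "\<And>e. e \<in> E \<Longrightarrow> 0 \<le> \<tau> e"
    and ground: "\<And>e. e \<in> E \<Longrightarrow> ta e \<in> {s0, t0} \<or> he e \<in> {s0, t0} \<Longrightarrow> \<tau> e = 0"
    and x: "iflow E ta he u s0 t0 x" and steady: "steady E ta he (residual E u x) \<tau> c s0 t0"
    and Fl_def: "Fl = iflow (real_copies E \<tau> \<theta>) (gnode s0 t0 \<circ> ctail ta) (gnode s0 t0 \<circ> chead he \<tau>)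
      (\<lambda>a. u (fst a)) (s0, 0) (t0, 0)"
    and val_def: "val = (\<lambda>\<phi>. bal (real_copies E \<tau> \<theta>) (gnode s0 t0 \<circ> ctail ta) (gnode s0 t0 \<circ> chead he \<tau>) \<phi> (s0, 0))"
    and co_def: "co = (\<lambda>\<phi>. \<Sum>a\<in>real_copies E \<tau> \<theta>. c (fst a) * \<phi> a)"
  shows "\<exists>\<phi>. Fl \<phi> \<and> (\<forall>\<psi>. Fl \<psi> \<longrightarrow> val \<psi> \<le> val \<phi>) \<and> (\<forall>\<psi>. Fl \<psi> \<longrightarrow> val \<psi> = val \<phi> \<longrightarrow> co \<phi> \<le> co \<psi>) \<and>
    turnpike E ta he \<tau> c u s0 t0 x \<phi> \<theta> d"
proof -
  let ?RC = "real_copies E \<tau> \<theta>" and ?t = "gnode s0 t0 \<circ> ctail ta" and ?h = "gnode s0 t0 \<circ> chead he \<tau>"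
  let ?cap = "\<lambda>a :: 'e \<times> int. u (fst a)"
  let ?near = "\<lambda>X \<phi>. \<Sum>a\<in>X. \<bar>dev x \<phi> a\<bar>"
  let ?in = "{a \<in> ?RC. inner \<tau> \<theta> d a}"
  have finRC: "finite ?RC" and fin_in: "finite ?in" using finite_real_copies[OF fin \<tau>] by auto
  have xb: "0 \<le> x e" "x e \<le> u e" if "e \<in> E" for e using x that by (auto simp: iflow_def)
  have bnd: "0 \<le> \<phi> a \<and> \<phi> a \<le> u (fst a)" if "Fl \<phi>" "a \<in> ?RC" for \<phi> a
    using that by (simp add: Fl_def iflow_def)
  have u: "0 \<le> u (fst a)" if "a \<in> ?RC" for a using xb[of "fst a"] that by (auto simp: real_copies_def)
  have "Fl (\<lambda>_. 0)" using u by (simp add: Fl_def iflow_def bal_def)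
  then have "\<exists>\<phi>. Fl \<phi> \<and> (\<forall>\<psi>. Fl \<psi> \<longrightarrow> - val \<phi> \<le> - val \<psi>)"
    by (intro int_attains_min[where b = "- (\<Sum>a\<in>?RC. u (fst a))"])
      (use iflow_value_bound[OF finRC] in \<open>auto simp: Fl_def val_def\<close>)
  then obtain \<phi>1 where \<phi>1: "Fl \<phi>1" "\<And>\<psi>. Fl \<psi> \<Longrightarrow> val \<psi> \<le> val \<phi>1" by auto
  define F1 where "F1 \<phi> \<longleftrightarrow> Fl \<phi> \<and> val \<phi> = val \<phi>1" for \<phi>
  have "- (\<Sum>a\<in>?RC. \<bar>c (fst a)\<bar> * u (fst a)) \<le> co \<phi>" if "F1 \<phi>" for \<phi>
  proof -
    have "- (\<bar>c (fst a)\<bar> * u (fst a)) \<le> c (fst a) * \<phi> a" if "a \<in> ?RC" for a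
    proof -
      have "\<bar>c (fst a) * \<phi> a\<bar> \<le> \<bar>c (fst a)\<bar> * u (fst a)"
        using bnd[of \<phi> a] \<open>F1 \<phi>\<close> that by (simp add: F1_def abs_mult mult_left_mono)
      then show ?thesis by linarith
    qed
    then show ?thesis unfolding co_def by (simp flip: sum_negf) (rule sum_mono)
  qed
  then have "\<exists>\<phi>. F1 \<phi> \<and> (\<forall>\<psi>. F1 \<psi> \<longrightarrow> co \<phi> \<le> co \<psi>)"
    by (rule int_attains_min) (use \<phi>1 in \<open>auto simp: F1_def\<close>)
  then obtain \<phi>2 where \<phi>2: "F1 \<phi>2" "\<And>\<psi>. F1 \<psi> \<Longrightarrow> co \<phi>2 \<le> co \<psi>" by auto
  define F2 where "F2 \<phi> \<longleftrightarrow> F1 \<phi> \<and> co \<phi> = co \<phi>2" for \<phi>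
  have "\<exists>\<phi>. F2 \<phi> \<and> (\<forall>\<psi>. F2 \<psi> \<longrightarrow> ?near ?in \<phi> \<le> ?near ?in \<psi>)"
    by (rule int_attains_min[where b = 0]) (use \<phi>2 in \<open>auto simp: F2_def intro: sum_nonneg\<close>)
  then obtain \<phi>3 where \<phi>3: "F2 \<phi>3" "\<And>\<psi>. F2 \<psi> \<Longrightarrow> ?near ?in \<phi>3 \<le> ?near ?in \<psi>" by auto
  define F3 where "F3 \<phi> \<longleftrightarrow> F2 \<phi> \<and> ?near ?in \<phi> = ?near ?in \<phi>3" for \<phi>
  have "\<exists>\<phi>. F3 \<phi> \<and> (\<forall>\<psi>. F3 \<psi> \<longrightarrow> ?near ?RC \<phi> \<le> ?near ?RC \<psi>)"
    by (rule int_attains_min[where b = 0]) (use \<phi>3 in \<open>auto simp: F3_def intro: sum_nonneg\<close>)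
  then obtain \<phi> where \<phi>: "F3 \<phi>" "\<And>\<psi>. F3 \<psi> \<Longrightarrow> ?near ?RC \<phi> \<le> ?near ?RC \<psi>" by auto
  have Fl: "Fl \<phi>" and val: "val \<phi> = val \<phi>1" and co: "co \<phi> = co \<phi>2"
    using \<phi>(1) by (auto simp: F3_def F2_def F1_def)
  have best: "val \<psi> \<le> val \<phi>" if "Fl \<psi>" for \<psi> using \<phi>1(2)[OF that] val by simp
  have cheapest: "co \<phi> \<le> co \<psi>" if "Fl \<psi>" "val \<psi> = val \<phi>" for \<psi>
    using \<phi>2(2)[of \<psi>] that val co by (simp add: F1_def)
  have zero: "\<phi> a = 0" if "a \<notin> ?RC" for a using Fl that unfolding Fl_def iflow_def by blast
  interpret turnpike_base E ta he \<tau> c u s0 t0 x \<phi> \<theta>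
  proof
    show "0 \<le> \<phi> (e, k) \<and> \<phi> (e, k) \<le> u e" if "e \<in> E" for e k
      using bnd[OF Fl, of "(e, k)"] zero[of "(e, k)"] xb[OF that] by (cases "(e, k) \<in> ?RC") auto
    show "bal E ta he x v = 0" if "v \<noteq> s0" "v \<noteq> t0" for v using x that by (simp add: iflow_def)
    show "(\<Sum>e\<in>{e \<in> E. ta e = v}. \<phi> (e, i)) = (\<Sum>e\<in>{e \<in> E. he e = v}. \<phi> (e, i - \<tau> e))"
      if v: "v \<noteq> s0" "v \<noteq> t0" and i: "1 \<le> i" "i \<le> \<theta>" for v i
    proof -
      have "(v, i) \<noteq> (s0, 0)" "(v, i) \<noteq> (t0, 0)" using v by auto
      then have "bal ?RC ?t ?h \<phi> (v, i) = 0" using Fl by (simp add: Fl_def iflow_def)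
      moreover have "(\<Sum>a\<in>{a \<in> ?RC. ?t a = (v, i)}. \<phi> a) = (\<Sum>e\<in>{e \<in> E. ta e = v}. \<phi> (e, i))"
      proof -
        have "{a \<in> ?RC. ?t a = (v, i)} \<subseteq> (\<lambda>e. (e, i)) ` {e \<in> E. ta e = v}"
          using v by (auto simp: real_copies_def gnode_def ctail_def split: if_splits)
        then have "(\<Sum>a\<in>{a \<in> ?RC. ?t a = (v, i)}. \<phi> a) = (\<Sum>a\<in>(\<lambda>e. (e, i)) ` {e \<in> E. ta e = v}. \<phi> a)"
          by (rule sum.mono_neutral_left[rotated]) (use fin v zero in \<open>auto simp: gnode_def ctail_def\<close>)
        then show ?thesis by (simp add: sum.reindex inj_on_def)
      qed
      moreover have "(\<Sum>a\<in>{a \<in> ?RC. ?h a = (v, i)}. \<phi> a) = (\<Sum>e\<in>{e \<in> E. he e = v}. \<phi> (e, i - \<tau> e))"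
      proof -
        have "{a \<in> ?RC. ?h a = (v, i)} \<subseteq> (\<lambda>e. (e, i - \<tau> e)) ` {e \<in> E. he e = v}"
          using v by (auto simp: real_copies_def gnode_def chead_def image_iff split: if_splits)
        then have "(\<Sum>a\<in>{a \<in> ?RC. ?h a = (v, i)}. \<phi> a) = (\<Sum>a\<in>(\<lambda>e. (e, i - \<tau> e)) ` {e \<in> E. he e = v}. \<phi> a)"
          by (rule sum.mono_neutral_left[rotated]) (use fin v zero in \<open>auto simp: gnode_def chead_def\<close>)
        then show ?thesis by (simp add: sum.reindex inj_on_def)
      qed
      ultimately show ?thesis by (simp add: bal_def)
    qed
  qed (use fin st \<tau> ground xb zero steady in auto)
  have flow: "iflow ?RC ?t ?h ?cap (s0, 0) (t0, 0) \<phi>" using Fl by (simp add: Fl_def)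
  have nonneg: "0 \<le> cost w" if "awalk p w p" for p w
    by (rule closed_residual_nonneg[OF finRC flow _ that])
      (use cheapest in \<open>simp add: Fl_def val_def co_def\<close>)
  have swap: "\<exists>v. set v \<subseteq> set w \<and> a \<in> set v \<and> (distinct (map fst v) \<and> F2 (aug \<phi> v) \<or> orev a \<in> set v)"
    if w: "awalk p w p" "cost w \<le> 0" "a \<in> set w" for p w a
  proof -
    have "\<exists>q v. awalk q v q \<and> distinct (map (osrc ?t ?h) v) \<and> a \<in> set v \<and> set v \<subseteq> set w \<and> cost v \<le> 0"
      by (rule simple_closed_walk_through[OF _ w(1,3,2)]) (rule nonneg)
    then obtain q v where v: "awalk q v q" "distinct (map (osrc ?t ?h) v)" "a \<in> set v" "set v \<subseteq> set w" "cost v \<le> 0"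
      by blast
    show ?thesis
    proof (cases "distinct (map fst v)")
      case True
      note g = aug_closed[OF finRC flow v(1) True]
      have "fst ` set v \<subseteq> ?RC" using owalk_set[OF v(1)] by (auto simp: residual_def)
      then have "co (aug \<phi> v) = co \<phi> + cost v" unfolding co_def by (rule aug_cost[OF finRC])
      then have "F2 (aug \<phi> v)"
        using g v(5) val co cheapest[of "aug \<phi> v"] by (simp add: F2_def F1_def Fl_def val_def)
      then show ?thesis using v True by blast
    next
      case False
      then obtain b where "v = [b, orev b]" using simple_closed_walk_arcs[OF v(1,2)] by blast
      then have "orev a \<in> set v" using v(3) by auto
      then show ?thesis using v by blast
    qed
  qed
  have H_pos: "0 < owt (dev x \<phi>) b" if "b \<in> H" for b using that by (simp add: osupp_def)
  have "turnpike E ta he \<tau> c u s0 t0 x \<phi> \<theta> d"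
  proof unfold_locales
    show "\<not> aconn (s0, 0) (t0, 0)"
    proof
      assume "aconn (s0, 0) (t0, 0)"
      then obtain w where "awalk (s0, 0) w (t0, 0)" by (auto simp: dconn_def)
      from aug_path[OF finRC flow _ this] st obtain g where "Fl g" "val g = val \<phi> + 1"
        by (auto simp: Fl_def val_def)
      then show False using best by force
    qed
  next
    fix p w assume w: "dwalk ?t ?h H p w p"
    note c = closed_hwalk[OF w]
    let ?w = "rev (map orev w)"
    show "w = []"
    proof (rule ccontr)
      assume "w \<noteq> []"
      then obtain a where a: "orev a \<in> set ?w" by (cases w) auto
      have "awalk p ?w p" by (rule dwalk_orev[OF w]) (use c(1) in blast)
      moreover have "cost ?w \<le> 0" using c(2) by simp
      ultimately obtain v where v: "set v \<subseteq> set ?w" "orev a \<in> set v"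
        "distinct (map fst v) \<and> F2 (aug \<phi> v) \<or> orev (orev a) \<in> set v"
        using swap[OF _ _ a] by blast
      have rev: "0 < owt (dev x \<phi>) (orev b)" if "b \<in> set v" for b
        using v(1) that owalk_set[OF w] H_pos by force
      have "orev (orev a) \<notin> set v" using rev[OF v(2)] rev[of "orev (orev a)"] by auto
      then have dist: "distinct (map fst v)" and F2: "F2 (aug \<phi> v)" using v(3) by auto
      obtain b where "b \<in> set w" "orev a = orev b" using v(1,2) by auto
      then have "orev a \<in> A" using c(1) by simp
      then have "fst (orev a) \<in> ?RC" by (auto simp: residual_def)
      then have "?near ?RC (aug \<phi> v) < ?near ?RC \<phi>"
        by (intro aug_closer(2)[OF finRC dist _ v(2)]) (rule rev)
      moreover have "?near ?in (aug \<phi> v) \<le> ?near ?in \<phi>" by (rule aug_closer(1)[OF fin_in dist rev])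
      then have "F3 (aug \<phi> v)" using F2 \<phi>3(2)[OF F2] \<phi>(1) by (simp add: F3_def)
      ultimately show False using \<phi>(2) by force
    qed
  next
    fix p w a assume w: "awalk p w p" "cost w \<le> 0" "a \<in> set w" "inner \<tau> \<theta> d (fst a)"
    show "\<exists>b\<in>set w. inner \<tau> \<theta> d (fst b) \<and> orev b \<notin> H"
    proof (rule ccontr)
      assume none: "\<not> ?thesis"
      obtain v where v: "set v \<subseteq> set w" "a \<in> set v" "distinct (map fst v) \<and> F2 (aug \<phi> v) \<or> orev a \<in> set v"
        using swap[OF w(1-3)] by blast
      have rev: "0 < owt (dev x \<phi>) (orev b)" if "b \<in> set v" "fst b \<in> ?in" for b
        using none v(1) that H_pos by blast
      have RC: "fst b \<in> ?RC" if "b \<in> set v" for b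
        using v(1) that owalk_set[OF w(1)] by (auto simp: residual_def)
      then have a: "fst a \<in> ?in" using v(2) w(4) by blast
      have "orev a \<notin> set v" using rev[OF v(2) a] rev[of "orev a"] a by auto
      then have dist: "distinct (map fst v)" and F2: "F2 (aug \<phi> v)" using v(3) by auto
      have "?near ?in (aug \<phi> v) < ?near ?in \<phi>" by (rule aug_closer(2)[OF fin_in dist rev v(2) a])
      then show False using \<phi>3(2)[OF F2] \<phi>(1) by (simp add: F3_def)
    qed
  qed (rule nonneg)
  then show ?thesis using Fl best cheapest by blast
qed

section \<open>Optimal flows over time that are constant in the interior\<close>

text \<open>
  If \<open>M = 0\<close>, residual arcs have cost 0, so a steady flow has no closed residual walk of negative
  transit time; if \<open>T = 0\<close>, all transit times vanish. Otherwise \<open>d\<close> is at least \<open>D2\<close>, written out as a polynomial.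
\<close>

theorem optimal_flow_constant_inside:
  fixes ta he :: "'e \<Rightarrow> 'v" and \<tau> c u :: "'e \<Rightarrow> int"
  assumes fin: "finite E" and st: "s0 \<noteq> t0" and u: "\<And>e. e \<in> E \<Longrightarrow> 0 \<le> u e" and \<tau>: "\<And>e. e \<in> E \<Longrightarrow> 0 \<le> \<tau> e"
    and ground: "\<And>e. e \<in> E \<Longrightarrow> ta e \<in> {s0, t0} \<or> he e \<in> {s0, t0} \<Longrightarrow> \<tau> e = 0"
    and Fl_def: "Fl = iflow (real_copies E \<tau> \<theta>) (gnode s0 t0 \<circ> ctail ta) (gnode s0 t0 \<circ> chead he \<tau>)
      (\<lambda>a. u (fst a)) (s0, 0) (t0, 0)"
    and val_def: "val = (\<lambda>\<phi>. bal (real_copies E \<tau> \<theta>) (gnode s0 t0 \<circ> ctail ta) (gnode s0 t0 \<circ> chead he \<tau>) \<phi> (s0, 0))"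
    and co_def: "co = (\<lambda>\<phi>. \<Sum>a\<in>real_copies E \<tau> \<theta>. c (fst a) * \<phi> a)"
    and T_sum: "T = (\<Sum>e\<in>E. \<tau> e)" and M_sum: "M = (\<Sum>e\<in>E. \<bar>c e\<bar> * u e)"
    and shallow: "T = 0 \<or> M = 0 \<Longrightarrow> T + 1 \<le> d"
    and deep: "T \<noteq> 0 \<Longrightarrow> M \<noteq> 0 \<Longrightarrow> 12 * T\<^sup>2 * M + 13 * T + 2 \<le> d \<and> 2 * d + 7 * T + 3 * T * M \<le> \<theta>"
  shows "\<exists>\<phi> x. Fl \<phi> \<and> (\<forall>\<psi>. Fl \<psi> \<longrightarrow> val \<psi> \<le> val \<phi>) \<and> (\<forall>\<psi>. Fl \<psi> \<longrightarrow> val \<psi> = val \<phi> \<longrightarrow> co \<phi> \<le> co \<psi>) \<and>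
    (\<forall>a. fst a \<in> E \<longrightarrow> inner \<tau> \<theta> d a \<longrightarrow> \<phi> a = x (fst a))"
proof -
  obtain x where x: "iflow E ta he u s0 t0 x" "steady E ta he (residual E u x) \<tau> c s0 t0"
    using steady_flow_exists[OF fin st, where u = u and \<tau> = \<tau> and ta = ta and he = he and c = c] u \<tau> by blast
  obtain \<phi> where \<phi>: "Fl \<phi>" "\<forall>\<psi>. Fl \<psi> \<longrightarrow> val \<psi> \<le> val \<phi>" "\<forall>\<psi>. Fl \<psi> \<longrightarrow> val \<psi> = val \<phi> \<longrightarrow> co \<phi> \<le> co \<psi>"
    and tp: "turnpike E ta he \<tau> c u s0 t0 x \<phi> \<theta> d"
    using optimal_flow_near_steady[OF fin st \<tau> ground x Fl_def val_def co_def] by blast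
  interpret turnpike E ta he \<tau> c u s0 t0 x \<phi> \<theta> d by (rule tp)
  have TM: "turnpike_base.T E \<tau> = T" "turnpike_base.M E c u = M"
    by (simp_all only: T_def M_def T_sum M_sum)
  have T0: "0 \<le> T" and M0: "0 \<le> M" using T_nonneg M_nonneg TM by auto
  have d: "T + 1 \<le> d"
  proof (cases "T = 0 \<or> M = 0")
    case False
    moreover have "0 \<le> T\<^sup>2 * M" using M0 by simp
    ultimately show ?thesis using deep T0 by auto
  qed (rule shallow)
  have no_dev: "\<not> inner \<tau> \<theta> d (fst a)" if a: "a \<in> H" for a
  proof (cases "T = 0 \<or> M = 0")
    case True
    have "0 \<le> wt (owt \<tau>) w" if w: "dwalk ta he R p w p" for p w
    proof (cases "T = 0")
      case T: True
      have "\<tau> e = 0" if "e \<in> E" for e using T fin \<tau> that unfolding T_sum by (simp add: sum_nonneg_eq_0_iff)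
      then have "owt \<tau> b = 0" if "b \<in> set w" for b
        using R_E(1)[OF subsetD[OF owalk_set[OF w] that]] by (simp add: owt_def)
      then have "wt (owt \<tau>) w = 0" by (induction w) auto
      then show ?thesis by simp
    next
      case False
      then have M: "M = 0" using True by simp
      have "c e = 0 \<or> u e = 0" if "e \<in> E" for e
        using M fin u that unfolding M_sum by (simp add: sum_nonneg_eq_0_iff)
      then have "owt c b = 0" if "b \<in> R" for b
        using that x_bounds[of "fst b"] by (force simp: residual_def owt_def split: if_splits)
      then have "owt c b = 0" if "b \<in> set w" for b using owalk_set[OF w] that by blast
      then have "wt (owt c) w = 0" by (induction w) auto
      then show ?thesis using conjunct2[OF x(2)[unfolded steady_def], rule_format, OF w] by (auto split: if_splits)
    qed
    then show ?thesis using shallow_interior[OF _ _ a] d TM by blast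
  next
    case False
    have "turnpike_deep E ta he \<tau> c u s0 t0 x \<phi> \<theta> d"
    proof unfold_locales
      show "1 \<le> turnpike_base.T E \<tau>" using False T0 TM by simp
      show "D2 \<le> d" using deep False by (simp add: D2_def D1_def TM power2_eq_square algebra_simps)
      show "2 * d + 7 * turnpike_base.T E \<tau> + 3 * turnpike_base.T E \<tau> * turnpike_base.M E c u \<le> \<theta>"
        using deep False by (simp add: TM)
    qed
    from turnpike_deep.deep_interior[OF this a] show ?thesis .
  qed
  have "\<phi> a = x (fst a)" if a: "fst a \<in> E" "inner \<tau> \<theta> d a" for a
  proof -
    have "a \<in> copies E \<tau> \<theta>" using a d T0 \<tau>[OF a(1)] by (simp add: copies_def inner_def)
    then have "(a, True) \<in> H \<or> (a, False) \<in> H \<or> \<phi> a = x (fst a)"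
      by (auto simp: osupp_def owt_def dev_def)
    then show ?thesis using no_dev[of "(a, True)"] no_dev[of "(a, False)"] a(2) by auto
  qed
  then show ?thesis using \<phi> by blast
qed

section \<open>Encoding the time-expanded network\<close>

text \<open>
  The super-source and the super-sink become ordinary terminals \<open>Inr True\<close> and \<open>Inr False\<close>, and the arcs
  at them become the copies of the two arcs \<open>Inr True\<close>, into the source, and \<open>Inr False\<close>, out of the
  sink, both with transit time 0.
\<close>

definition ext_arcs :: "('v, 'a) pre_digraph \<Rightarrow> ('a + bool) set" where
  "ext_arcs D = Inl ` arcs D \<union> {Inr True, Inr False}"

definition ext_tail :: "('v, 'a) pre_digraph \<Rightarrow> 'v \<Rightarrow> 'a + bool \<Rightarrow> 'v + bool" where
  "ext_tail D t = case_sum (\<lambda>a. Inl (tail D a)) (\<lambda>b. if b then Inr True else Inl t)"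

definition ext_head :: "('v, 'a) pre_digraph \<Rightarrow> 'v \<Rightarrow> 'a + bool \<Rightarrow> 'v + bool" where
  "ext_head D s = case_sum (\<lambda>a. Inl (head D a)) (\<lambda>b. if b then Inl s else Inr False)"

definition ext_fun :: "('a \<Rightarrow> int) \<Rightarrow> int \<Rightarrow> 'a + bool \<Rightarrow> int" where
  "ext_fun f r = case_sum f (\<lambda>_. r)"

primrec enc :: "'a time_arc \<Rightarrow> ('a + bool) \<times> int" where
  "enc (Arc_Copy a i) = (Inl a, int i)"
| "enc (Source_Arc i) = (Inr True, int i)"
| "enc (Sink_Arc i) = (Inr False, int i)"

text \<open>
  Nonpositive times are sent to time 0, where no copies exist. Hence a flow that vanishes outside
  the time-expanded network still does so after decoding.
\<close>

definition dec :: "('a + bool) \<times> int \<Rightarrow> 'a time_arc" where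
  "dec a = case_sum (\<lambda>e. Arc_Copy e (nat (snd a)))
     (\<lambda>b. if b then Source_Arc (nat (snd a)) else Sink_Arc (nat (snd a))) (fst a)"

primrec enc_node :: "'v time_node \<Rightarrow> ('v + bool) \<times> int" where
  "enc_node (Node_Copy v i) = (Inl v, int i)"
| "enc_node Super_Source = (Inr True, 0)"
| "enc_node Super_Sink = (Inr False, 0)"

lemma ext_simps [simp]:
  "ext_tail D t (Inl a) = Inl (tail D a)" "ext_tail D t (Inr b) = (if b then Inr True else Inl t)"
  "ext_head D s (Inl a) = Inl (head D a)" "ext_head D s (Inr b) = (if b then Inl s else Inr False)"
  "ext_fun f r (Inl a) = f a" "ext_fun f r (Inr b) = r"
  "Inl a \<in> ext_arcs D \<longleftrightarrow> a \<in> arcs D" "Inr b \<in> ext_arcs D"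
  by (cases b; auto simp: ext_tail_def ext_head_def ext_fun_def ext_arcs_def)+

lemma dec_enc [simp]: "dec (enc e) = e"
  by (cases e) (simp_all add: dec_def)

lemma inj_enc: "inj enc"
  by (rule inj_on_inverseI) (rule dec_enc)

lemma inj_enc_node: "inj enc_node"
proof (rule injI)
  fix n m :: "'v time_node" assume "enc_node n = enc_node m"
  then show "n = m" by (cases n; cases m) auto
qed

context flow_over_time_network
begin

abbreviation "Ext \<equiv> ext_arcs D"
abbreviation "xt \<equiv> ext_fun (\<lambda>a. int (\<tau> a)) 0"
abbreviation "xu \<equiv> ext_fun (\<lambda>a. int (u a)) (\<Sum>a\<in>arcs D. int (u a))"
abbreviation "TE \<theta> \<equiv> time_expanded D s t \<tau> \<theta>"
abbreviation "RC \<theta> \<equiv> real_copies Ext xt (int \<theta>)"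
abbreviation "xtail \<equiv> gnode (Inr True) (Inr False) \<circ> ctail (ext_tail D t)"
abbreviation "xhead \<equiv> gnode (Inr True) (Inr False) \<circ> chead (ext_head D s) xt"
abbreviation "xflow \<theta> \<equiv> iflow (RC \<theta>) xtail xhead (\<lambda>a. xu (fst a)) (Inr True, 0) (Inr False, 0)"

lemma enc_arc: "enc e \<in> RC \<theta> \<longleftrightarrow> e \<in> arcs (TE \<theta>)"
  by (cases e) (auto simp: real_copies_def time_expanded_def)

lemma dec_arc: "dec a \<in> arcs (TE \<theta>) \<longleftrightarrow> a \<in> RC \<theta>"
proof (cases a)
  case (Pair e k)
  show ?thesis
    by (cases e) (auto simp: Pair dec_def real_copies_def time_expanded_def image_iff Bex_def)
qed

lemma enc_dec: "a \<in> RC \<theta> \<Longrightarrow> enc (dec a) = a"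
  by (cases a; cases "fst a") (auto simp: dec_def real_copies_def)

lemma enc_image: "enc ` arcs (TE \<theta>) = RC \<theta>"
proof
  show "enc ` arcs (TE \<theta>) \<subseteq> RC \<theta>" by (rule image_subsetI) (simp only: enc_arc)
  show "RC \<theta> \<subseteq> enc ` arcs (TE \<theta>)"
  proof
    fix a assume a: "a \<in> RC \<theta>"
    show "a \<in> enc ` arcs (TE \<theta>)"
      by (rule image_eqI[of _ _ "dec a"]) (simp_all only: enc_dec[OF a] dec_arc a)
  qed
qed

lemma xtail_enc: "xtail (enc e) = enc_node (tail (TE \<theta>) e)"
  by (cases e) (auto simp: gnode_def ctail_def time_expanded_def)

lemma xhead_enc: "xhead (enc e) = enc_node (head (TE \<theta>) e)"
  by (cases e) (auto simp: gnode_def chead_def time_expanded_def)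

lemma bal_enc:
  assumes "\<And>e. e \<in> arcs (TE \<theta>) \<Longrightarrow> \<phi> (enc e) = int (f e)"
  shows "bal (RC \<theta>) xtail xhead \<phi> (enc_node v) = net_outflow (TE \<theta>) f v"
proof -
  have *: "{a \<in> RC \<theta>. xtail a = enc_node v} = enc ` out_arcs (TE \<theta>) v"
    "{a \<in> RC \<theta>. xhead a = enc_node v} = enc ` in_arcs (TE \<theta>) v"
    unfolding enc_image[symmetric] out_arcs_def in_arcs_def
    by (auto simp only: xtail_enc[of _ \<theta>] xhead_enc[of _ \<theta>] inj_eq[OF inj_enc_node] image_iff mem_Collect_eq)
  show ?thesis
    unfolding bal_def net_outflow_def * using assms
    by (simp add: sum.reindex[OF inj_on_subset[OF inj_enc]])
qed

lemma finite_TE: "finite (arcs (TE \<theta>))"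
proof (rule finite_imageD)
  have "finite (RC \<theta>)" by (rule finite_real_copies) (auto simp: ext_arcs_def)
  then show "finite (enc ` arcs (TE \<theta>))" by (simp add: enc_image)
qed (rule inj_on_subset[OF inj_enc subset_UNIV])

lemma enc_node_ends:
  assumes "a \<in> RC \<theta>"
  shows "xtail a \<in> enc_node ` verts (TE \<theta>)" "xhead a \<in> enc_node ` verts (TE \<theta>)"
proof -
  have "tail (TE \<theta>) e \<in> verts (TE \<theta>) \<and> head (TE \<theta>) e \<in> verts (TE \<theta>)" if "e \<in> arcs (TE \<theta>)" for e
    using that source_in_verts sink_in_verts by (cases e) (auto simp: time_expanded_def)
  moreover have "dec a \<in> arcs (TE \<theta>)" using assms by (simp add: dec_arc)
  moreover have "xtail a = enc_node (tail (TE \<theta>) (dec a))" "xhead a = enc_node (head (TE \<theta>) (dec a))"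
    using xtail_enc[of "dec a"] xhead_enc[of "dec a"] by (simp_all only: enc_dec[OF assms])
  ultimately show "xtail a \<in> enc_node ` verts (TE \<theta>)" "xhead a \<in> enc_node ` verts (TE \<theta>)"
    by auto
qed

lemma decode_flow:
  assumes "xflow \<theta> \<phi>"
  shows "flow_over_time \<theta> (\<lambda>e. nat (\<phi> (enc e)))" "\<phi> (enc e) = int (nat (\<phi> (enc e)))"
proof -
  have zero: "\<phi> (enc e) = 0" if "e \<notin> arcs (TE \<theta>)" for e
    using assms that enc_arc unfolding iflow_def by blast
  have nonneg: "0 \<le> \<phi> (enc e)" for e
    using assms zero[of e] enc_arc[of e \<theta>] unfolding iflow_def by (cases "e \<in> arcs (TE \<theta>)") auto
  then show "\<phi> (enc e) = int (nat (\<phi> (enc e)))" by simp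
  show "flow_over_time \<theta> (\<lambda>e. nat (\<phi> (enc e)))"
    unfolding flow_over_time_def integral_flow_def
  proof (intro conjI ballI allI impI)
    fix e assume "e \<in> arcs (TE \<theta>)"
    then have le: "\<phi> (enc e) \<le> xu (fst (enc e))" using assms by (simp add: iflow_def enc_arc)
    then show "enat (nat (\<phi> (enc e))) \<le> time_capacity u e" by (cases e) auto
  next
    fix e assume "e \<notin> arcs (TE \<theta>)"
    then show "nat (\<phi> (enc e)) = 0" by (simp add: zero)
  next
    fix v assume v: "v \<in> verts (TE \<theta>) - {Super_Source, Super_Sink}"
    have "bal (RC \<theta>) xtail xhead \<phi> (enc_node v) = 0"
      using assms v by (cases v) (simp_all add: iflow_def)
    then show "net_outflow (TE \<theta>) (\<lambda>e. nat (\<phi> (enc e))) v = 0"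
      using bal_enc[of \<theta> \<phi> "\<lambda>e. nat (\<phi> (enc e))" v] nonneg by simp
  qed
qed

text \<open>
  The new terminal arcs have finite capacity. This is no restriction: a unit on a copy of
  such an arc continues, or has come, on an original arc at that time, since source and sink differ.
\<close>

lemma encode_flow:
  assumes f: "flow_over_time \<theta> f"
  shows "xflow \<theta> (\<lambda>a. int (f (dec a)))"
proof -
  note flow = f[unfolded flow_over_time_def integral_flow_def]
  have zero: "f e = 0" if "e \<notin> arcs (TE \<theta>)" for e using flow that by blast
  have cap: "int (f (Arc_Copy a i)) \<le> int (u a)" for a i
    using flow zero[of "Arc_Copy a i"] by (cases "Arc_Copy a i \<in> arcs (TE \<theta>)") force+
  have total: "(\<Sum>e\<in>X. int (f e)) \<le> (\<Sum>a\<in>arcs D. int (u a))"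
    if "X \<subseteq> (\<lambda>a. Arc_Copy a (k a)) ` arcs D" for X k
  proof -
    have "(\<Sum>e\<in>X. int (f e)) \<le> (\<Sum>e\<in>(\<lambda>a. Arc_Copy a (k a)) ` arcs D. int (f e))"
      using that by (intro sum_mono2) auto
    also have "\<dots> = (\<Sum>a\<in>arcs D. int (f (Arc_Copy a (k a))))"
      by (subst sum.reindex) (auto intro: inj_onI)
    also have "\<dots> \<le> (\<Sum>a\<in>arcs D. int (u a))" by (intro sum_mono cap)
    finally show ?thesis .
  qed
  have cons: "(\<Sum>e\<in>out_arcs (TE \<theta>) v. int (f e)) = (\<Sum>e\<in>in_arcs (TE \<theta>) v. int (f e))"
    if "v \<in> verts (TE \<theta>) - {Super_Source, Super_Sink}" for v
    using flow that by (simp add: net_outflow_def)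
  have fin_in: "finite (in_arcs (TE \<theta>) v)" and fin_out: "finite (out_arcs (TE \<theta>) v)" for v
    using finite_TE by (simp_all add: in_arcs_def out_arcs_def)
  have source: "int (f (Source_Arc i)) \<le> (\<Sum>a\<in>arcs D. int (u a))" if i: "i \<in> {1..\<theta>}" for i
  proof -
    have "Source_Arc i \<in> in_arcs (TE \<theta>) (Node_Copy s i)" using i by (auto simp: time_expanded_def)
    then have "int (f (Source_Arc i)) \<le> (\<Sum>e\<in>in_arcs (TE \<theta>) (Node_Copy s i). int (f e))"
      by (intro member_le_sum[OF _ _ fin_in]) auto
    also have "\<dots> = (\<Sum>e\<in>out_arcs (TE \<theta>) (Node_Copy s i). int (f e))"
      using i source_in_verts by (intro cons[symmetric]) (auto simp: time_expanded_def)
    also have "\<dots> \<le> (\<Sum>a\<in>arcs D. int (u a))"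
      using source_neq_sink by (intro total[of _ "\<lambda>_. i"]) (auto simp: time_expanded_def)
    finally show ?thesis .
  qed
  have sink: "int (f (Sink_Arc i)) \<le> (\<Sum>a\<in>arcs D. int (u a))" if i: "i \<in> {1..\<theta>}" for i
  proof -
    have "Sink_Arc i \<in> out_arcs (TE \<theta>) (Node_Copy t i)" using i by (auto simp: time_expanded_def)
    then have "int (f (Sink_Arc i)) \<le> (\<Sum>e\<in>out_arcs (TE \<theta>) (Node_Copy t i). int (f e))"
      by (intro member_le_sum[OF _ _ fin_out]) auto
    also have "\<dots> = (\<Sum>e\<in>in_arcs (TE \<theta>) (Node_Copy t i). int (f e))"
      using i sink_in_verts by (intro cons) (auto simp: time_expanded_def)
    also have "\<dots> \<le> (\<Sum>a\<in>arcs D. int (u a))"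
      using source_neq_sink
      by (intro total[of _ "\<lambda>a. i - \<tau> a"]) (auto simp: time_expanded_def image_iff)
    finally show ?thesis .
  qed
  show ?thesis
    unfolding iflow_def
  proof (intro conjI ballI allI impI)
    fix a assume a: "a \<in> RC \<theta>"
    show "0 \<le> int (f (dec a))" by simp
    have "int (f e) \<le> xu (fst (enc e))" if "e \<in> arcs (TE \<theta>)" for e
      using that cap source sink by (cases e) (auto simp: time_expanded_def)
    from this[of "dec a"] a show "int (f (dec a)) \<le> xu (fst a)" by (simp add: dec_arc enc_dec)
  next
    fix a assume "a \<notin> RC \<theta>"
    then show "int (f (dec a)) = 0" using zero[of "dec a"] by (simp add: dec_arc)
  next
    fix n :: "('v + bool) \<times> int" assume n: "n \<noteq> (Inr True, 0)" "n \<noteq> (Inr False, 0)"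
    show "bal (RC \<theta>) xtail xhead (\<lambda>a. int (f (dec a))) n = 0"
    proof (cases "n \<in> enc_node ` verts (TE \<theta>)")
      case True
      then obtain v where v: "v \<in> verts (TE \<theta>)" "n = enc_node v" by blast
      then have "net_outflow (TE \<theta>) f v = 0" using flow n by auto
      then show ?thesis using bal_enc[of \<theta> "\<lambda>a. int (f (dec a))" f v] v by simp
    next
      case False
      then have "{a \<in> RC \<theta>. xtail a = n} = {}" "{a \<in> RC \<theta>. xhead a = n} = {}"
        using enc_node_ends by blast+
      then show ?thesis by (simp only: bal_def sum.empty diff_self)
    qed
  qed
qed

lemma value_enc:
  assumes "\<And>e. \<phi> (enc e) = int (f e)"
  shows "bal (RC \<theta>) xtail xhead \<phi> (Inr True, 0) = fot_value \<theta> f"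
  using bal_enc[of \<theta> \<phi> f Super_Source] assms by (simp add: fot_value_def)

lemma cost_enc:
  assumes "\<And>e. \<phi> (enc e) = int (f e)"
  shows "(\<Sum>a\<in>RC \<theta>. ext_fun c 0 (fst a) * \<phi> a) = fot_cost c \<theta> f"
proof -
  have "ext_fun c 0 (fst (enc e)) = time_cost c e" for e by (cases e) auto
  then show ?thesis
    unfolding fot_cost_def flow_cost_def enc_image[symmetric]
    by (simp add: sum.reindex[OF inj_on_subset[OF inj_enc]] assms)
qed

lemma sum_ext: "(\<Sum>e\<in>Ext. g e) = (\<Sum>a\<in>arcs D. g (Inl a)) + g (Inr True) + (g (Inr False) :: int)"
  unfolding ext_arcs_def
  by (subst sum.union_disjoint) (auto simp: sum.reindex inj_on_def)

lemma two_le_card_verts: "2 \<le> card (verts D)"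
proof -
  have "card {s, t} \<le> card (verts D)"
    using source_in_verts sink_in_verts by (intro card_mono) auto
  then show ?thesis using source_neq_sink by simp
qed

lemma T_const_nonneg: "0 \<le> T_const" and M_const_nonneg: "0 \<le> M_const c"
  unfolding T_const_def M_const_def by (auto intro: sum_nonneg)

lemma B_const_degenerate: "T_const = 0 \<or> M_const c = 0 \<Longrightarrow> 4 * T_const \<le> B_const c" "0 \<le> B_const c"
proof -
  have J: "0 \<le> J_const c x" if "0 \<le> x" for x
    unfolding J_const_def h_const_def using T_const_nonneg M_const_nonneg[of c] that by simp
  have p: "0 \<le> p_const c"
    unfolding p_const_def using T_const_nonneg M_const_nonneg[of c] by simp
  show "0 \<le> B_const c" unfolding B_const_def using p J[OF p] J[of "p_const c + J_const c (p_const c)"] by simp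
  show "4 * T_const \<le> B_const c" if "T_const = 0 \<or> M_const c = 0"
    using that T_const_nonneg by (auto simp: B_const_def J_const_def p_const_def)
qed

text \<open>
  Of the two values of \<open>J\<close> only the terms that come from \<open>|V| \<ge> 2\<close>, \<open>T\<close> and \<open>h\<close> are kept.
\<close>

lemma B_const_large:
  assumes T: "1 \<le> T_const" and M: "1 \<le> M_const c"
  shows "48 * (T_const\<^sup>2 * M_const c) + 40 * (T_const * M_const c) \<le> B_const c"
proof -
  define T M n :: real where "T = T_const" and "M = M_const c" and "n = real (card (verts D))"
  have T1: "1 \<le> T" and M1: "1 \<le> M" and n2: "2 \<le> n"
    using T M two_le_card_verts by (simp_all add: T_def M_def n_def)
  have J: "14 * (T\<^sup>2 * M) + 10 * (T * M) \<le> J_const c y" if y: "0 \<le> y" for y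
  proof -
    have "3 * (2 * T + 3) \<le> (n + 1) * (2 * T + 3)" using n2 T1 by (intro mult_right_mono) auto
    moreover have "4 * T \<le> 2 * T * (1 + M)" using T1 M1 by (simp add: algebra_simps)
    ultimately have "3 * (2 * T + 3) + 1 + 2 * (4 * T) + 2 * 0
        \<le> (n + 1) * (2 * T + 3) + 1 + 2 * (2 * T * (1 + M)) + 2 * y"
      using y by (intro add_mono mult_left_mono) simp_all
    then have "14 * T + 10 \<le> (n + 1) * (2 * T + 3) + 1 + 2 * (2 * T * (1 + M)) + 2 * y" by simp
    then have "T * (14 * T + 10) * M
        \<le> T * ((n + 1) * (2 * T + 3) + 1 + 2 * (2 * T * (1 + M)) + 2 * y) * M"
      using T1 M1 by (intro mult_right_mono mult_left_mono) auto
    then have "14 * (T\<^sup>2 * M) + 10 * (T * M) \<le> J_const c y - 3 * T"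
      by (simp add: J_const_def h_const_def T_def M_def n_def power2_eq_square algebra_simps)
    then show ?thesis using T1 by simp
  qed
  have q: "0 \<le> T\<^sup>2 * M" "0 \<le> T * M" using T1 M1 by simp_all
  have p: "p_const c = 6 * (T * M)" by (simp add: p_const_def T_def M_def)
  have J1: "14 * (T\<^sup>2 * M) + 10 * (T * M) \<le> J_const c (p_const c)" by (rule J) (use p q in simp)
  have J2: "14 * (T\<^sup>2 * M) + 10 * (T * M) \<le> J_const c (p_const c + J_const c (p_const c))"
    by (rule J) (use p q J1 in linarith)
  have "48 * X + 40 * Y \<le> 2 * (p' + j + j')"
    if "14 * X + 10 * Y \<le> j" "14 * X + 10 * Y \<le> j'" "p' = 6 * Y" "0 \<le> X" "0 \<le> Y" for X Y p' j j' :: real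
    using that by (simp add: algebra_simps)
  from this[OF J1 J2 p q] show ?thesis by (simp add: B_const_def T_def M_def)
qed

text \<open>
  A copy that leaves between \<open>K\<close> and \<open>\<theta> - K\<close> arrives at most \<open>T\<close> later. Since \<open>K = B / 2\<close> is at
  least \<open>d + T - 1\<close> for the margin \<open>d\<close> of \<open>optimal_flow_constant_inside\<close>, it is an inner copy.
\<close>

theorem repeated_optimal_flow:
  assumes \<theta>: "B_const c < real \<theta>"
  shows "\<exists>f. max_min_cost_fot c \<theta> f \<and>
    (\<forall>a\<in>arcs D. \<forall>i. 1 \<le> i \<longrightarrow> B_const c / 2 \<le> real i \<longrightarrow> real (i + 1) \<le> real \<theta> - B_const c / 2 \<longrightarrow>
      f (Arc_Copy a i) = f (Arc_Copy a (i + 1)))"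
proof -
  define T M where "T = (\<Sum>e\<in>Ext. xt e)" and "M = (\<Sum>e\<in>Ext. \<bar>ext_fun c 0 e\<bar> * xu e)"
  have T: "real_of_int T = T_const" and M: "real_of_int M = M_const c"
    by (simp_all add: T_def M_def T_const_def M_const_def sum_ext)
  have T0: "0 \<le> T" and M0: "0 \<le> M" using T M T_const_nonneg M_const_nonneg[of c] by linarith+
  define d where "d = (if T = 0 \<or> M = 0 then T + 1 else 12 * T\<^sup>2 * M + 13 * T + 2)"
  have d: "real_of_int (2 * (d + T - 1)) \<le> B_const c"
    "T \<noteq> 0 \<Longrightarrow> M \<noteq> 0 \<Longrightarrow> real_of_int (2 * d + 7 * T + 3 * T * M) \<le> B_const c"
  proof -
    have "real_of_int (2 * (d + T - 1)) \<le> B_const c \<and>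
      (T \<noteq> 0 \<longrightarrow> M \<noteq> 0 \<longrightarrow> real_of_int (2 * d + 7 * T + 3 * T * M) \<le> B_const c)"
    proof (cases "T = 0 \<or> M = 0")
      case True
      then have "T_const = 0 \<or> M_const c = 0" using T M by auto
      then show ?thesis using True B_const_degenerate(1)[of c] T by (auto simp: d_def)
    next
      case False
      then have TM: "1 \<le> T" "1 \<le> M" using T0 M0 by auto
      then have "T * 1 \<le> T * M" by (intro mult_left_mono) auto
      moreover have "1 * (T * M) \<le> T * (T * M)" using TM by (intro mult_right_mono) auto
      moreover have "T * (T * M) = T\<^sup>2 * M" by (simp add: power2_eq_square)
      ultimately have ineq: "T \<le> T * M" "T * M \<le> T\<^sup>2 * M" by simp_all
      have lin: "2 * (12 * X + 13 * T + 2 + T - 1) \<le> 48 * X + 40 * Y"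
        "2 * (12 * X + 13 * T + 2) + 7 * T + 3 * Y \<le> 48 * X + 40 * Y"
        if "T \<le> Y" "Y \<le> X" "1 \<le> T" for X Y
        using that by (simp_all add: algebra_simps)
      have dd: "d = 12 * (T\<^sup>2 * M) + 13 * T + 2" using False by (simp add: d_def)
      have "real_of_int (48 * (T\<^sup>2 * M) + 40 * (T * M)) \<le> B_const c"
        using B_const_large[of c] TM T M by simp
      moreover have "2 * (d + T - 1) \<le> 48 * (T\<^sup>2 * M) + 40 * (T * M)"
        "2 * d + 7 * T + 3 * T * M \<le> 48 * (T\<^sup>2 * M) + 40 * (T * M)"
        using lin[OF ineq TM(1)] dd by (simp_all add: mult.assoc)
      ultimately show ?thesis by (meson of_int_le_iff order_trans)
    qed
    then show "real_of_int (2 * (d + T - 1)) \<le> B_const c"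
      "T \<noteq> 0 \<Longrightarrow> M \<noteq> 0 \<Longrightarrow> real_of_int (2 * d + 7 * T + 3 * T * M) \<le> B_const c" by auto
  qed
  let ?val = "\<lambda>\<phi>. bal (RC \<theta>) xtail xhead \<phi> (Inr True, 0)"
  let ?co = "\<lambda>\<phi>. \<Sum>a\<in>RC \<theta>. ext_fun c 0 (fst a) * \<phi> a"
  have "\<exists>\<phi> x. xflow \<theta> \<phi> \<and> (\<forall>\<psi>. xflow \<theta> \<psi> \<longrightarrow> ?val \<psi> \<le> ?val \<phi>) \<and>
    (\<forall>\<psi>. xflow \<theta> \<psi> \<longrightarrow> ?val \<psi> = ?val \<phi> \<longrightarrow> ?co \<phi> \<le> ?co \<psi>) \<and>
    (\<forall>a. fst a \<in> Ext \<longrightarrow> inner xt (int \<theta>) d a \<longrightarrow> \<phi> a = x (fst a))"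
  proof (rule optimal_flow_constant_inside[where T = T and M = M and u = xu])
    show "finite Ext" by (simp add: ext_arcs_def)
    show "0 \<le> xu e" for e by (cases e) (auto intro: sum_nonneg)
    show "0 \<le> xt e" for e by (cases e) auto
    show "xt e = 0" if "ext_tail D t e \<in> {Inr True, Inr False} \<or> ext_head D s e \<in> {Inr True, Inr False}" for e
      using that by (cases e) auto
    show "T + 1 \<le> d" if "T = 0 \<or> M = 0" using that by (simp add: d_def)
    show "12 * T\<^sup>2 * M + 13 * T + 2 \<le> d \<and> 2 * d + 7 * T + 3 * T * M \<le> int \<theta>" if "T \<noteq> 0" "M \<noteq> 0"
    proof
      show "12 * T\<^sup>2 * M + 13 * T + 2 \<le> d" using that by (simp add: d_def)
      have "real_of_int (2 * d + 7 * T + 3 * T * M) \<le> real_of_int (int \<theta>)" using d(2)[OF that] \<theta> by simp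
      then show "2 * d + 7 * T + 3 * T * M \<le> int \<theta>" by (simp only: of_int_le_iff)
    qed
  qed (simp_all add: T_def M_def)
  then obtain \<phi> x where \<phi>: "xflow \<theta> \<phi>" "\<And>\<psi>. xflow \<theta> \<psi> \<Longrightarrow> ?val \<psi> \<le> ?val \<phi>"
    "\<And>\<psi>. xflow \<theta> \<psi> \<Longrightarrow> ?val \<psi> = ?val \<phi> \<Longrightarrow> ?co \<phi> \<le> ?co \<psi>"
    and const: "\<And>a. fst a \<in> Ext \<Longrightarrow> inner xt (int \<theta>) d a \<Longrightarrow> \<phi> a = x (fst a)"
    by blast
  define f where "f = (\<lambda>e. nat (\<phi> (enc e)))"
  have f: "flow_over_time \<theta> f" "\<And>e. \<phi> (enc e) = int (f e)"
    using decode_flow[OF \<phi>(1)] by (simp_all add: f_def)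
  have val: "fot_value \<theta> g \<le> fot_value \<theta> f" if "flow_over_time \<theta> g" for g
    using \<phi>(2)[OF encode_flow[OF that]] value_enc[of \<phi> f] f(2) value_enc[of "\<lambda>a. int (g (dec a))" g \<theta>]
    by simp
  have "maximum_fot \<theta> f" using f(1) val by (simp add: maximum_fot_def)
  moreover have "fot_cost c \<theta> f \<le> fot_cost c \<theta> g" if g: "maximum_fot \<theta> g" for g
  proof -
    have fg: "flow_over_time \<theta> g" "fot_value \<theta> g = fot_value \<theta> f"
      using g f(1) val[of g] by (auto simp: maximum_fot_def intro: antisym)
    note eg = value_enc[of "\<lambda>a. int (g (dec a))" g \<theta>] cost_enc[of "\<lambda>a. int (g (dec a))" g c \<theta>]
    show ?thesis
      using \<phi>(3)[OF encode_flow[OF fg(1)]] eg fg(2) value_enc[of \<phi> f] cost_enc[of \<phi> f c \<theta>] f(2) by simp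
  qed
  ultimately have opt: "max_min_cost_fot c \<theta> f" by (simp add: max_min_cost_fot_def)
  have copy: "f (Arc_Copy a k) = nat (x (Inl a))"
    if a: "a \<in> arcs D" and k: "1 \<le> k" "B_const c / 2 \<le> real k" "real k \<le> real \<theta> - B_const c / 2" for a k
  proof -
    have "real_of_int (d + T - 1) \<le> real_of_int (int k)"
      "real_of_int (int k) \<le> real_of_int (int \<theta> - (d + T - 1))"
      using d(1) k by simp_all
    then have k': "d + T - 1 \<le> int k" "int k \<le> int \<theta> - (d + T - 1)" by (simp_all only: of_int_le_iff)
    have "int (\<tau> a) \<le> T"
      unfolding T_def sum_ext using a member_le_sum[of a "arcs D" "\<lambda>a. int (\<tau> a)"] by simp
    moreover have "d \<le> int k" using k' k(1) T0 by (cases "T = 0") (auto simp: d_def)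
    ultimately have "inner xt (int \<theta>) d (Inl a, int k)" using k'(2) by (simp add: inner_def)
    then show ?thesis using const[of "(Inl a, int k)"] a by (simp add: f_def)
  qed
  have "f (Arc_Copy a i) = f (Arc_Copy a (i + 1))"
    if "a \<in> arcs D" "1 \<le> i" "B_const c / 2 \<le> real i" "real (i + 1) \<le> real \<theta> - B_const c / 2" for a i
    using copy[of a i] copy[of a "i + 1"] that by simp
  then show ?thesis using opt by blast
qed

end

theorem theorem1:
  fixes D :: "('v, 'a) pre_digraph"
    and s t :: 'v
    and u \<tau> :: "'a \<Rightarrow> nat"
    and c :: "'a \<Rightarrow> int"
  assumes "flow_over_time_network D s t"
  shows "\<exists>K::real. 0 \<le> K \<and> 2 * K \<le> flow_over_time_network.B_const D u \<tau> c \<and>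
    (\<forall>\<theta>::nat. 1 \<le> \<theta> \<longrightarrow> flow_over_time_network.B_const D u \<tau> c < real \<theta> \<longrightarrow>
      (\<exists>f. flow_over_time_network.max_min_cost_fot D s t u \<tau> c \<theta> f \<and>
        (\<forall>a\<in>arcs D. \<forall>i::nat. 1 \<le> i \<longrightarrow> K \<le> real i \<longrightarrow> real (i + 1) \<le> real \<theta> - K \<longrightarrow>
          f (Arc_Copy a i) = f (Arc_Copy a (i + 1)))))"
proof -
  interpret flow_over_time_network D s t u \<tau> by (rule assms)
  show ?thesis
    using B_const_degenerate(2)[of c] repeated_optimal_flow[of c]
    by (intro exI[of _ "B_const c / 2"]) simp
qed

end
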